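(* Let $G$ be a finite abelian group that is neither cyclic nor an elementary $2$-group, and suppose that $G$ satisfies at least one of the following conditions. (a) $G$ is a $p$-group for some prime $p$, and $\gcd(\exp(G)-2, \mathsf D(G)-2)=1$. (b) $G\cong C_{p^{s_1}}^{r_1}\oplus C_{p^{s_2}}^{r_2}$, where $p$ is a prime and $r_1,r_2,s_1,s_2$ are positive integers such that $s_1$ divides $s_2$. (c) $\exp(G)=pq$, where $p,q$ are distinct primes satisfying at least one of the following properties: (i) $\gcd(pq-2,\mathsf D(G)-2)=1$; (ii) $\gcd(pq-2,p+q-3)=1$; (iii) $q=2$ and $p-1$ is a power of $2$; (iv) $q=2$ and $\mathsf r_p(G)=1$. (d) $\exp(G)\in\{3,4,5,6,7,9,10,11\}$. Then for every minimal zero-sum sequence $U=g_1\cdots g_\ell$ over $G$ of length $\ell=\mathsf D(G)$ there are a positive integer $k$ and minimal zero-sum sequences $U_1,\ldots,U_k,V_1,\ldots,V_{k+1}$, all of whose terms lie in $\{g_1,\ldots,g_\ell,-g_1,\ldots,-g_\ell\}$, such that $U_1\cdots U_k=V_1\cdots V_{k+1}$.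
   Context: Let $G$ be an additively written finite abelian group. A sequence over a subset $G_0\subset G$ is a finite sequence of terms from $G_0$ in which order is disregarded and repetition is allowed, i.e. an element of the free abelian monoid $\mathcal F(G_0)$ with basis $G_0$, written multiplicatively; the product of sequences is concatenation. A sequence $S=g_1\cdots g_\ell$ has length $\ell$; it is a zero-sum sequence if $g_1+\cdots+g_\ell=0$. A minimal zero-sum sequence is a non-empty zero-sum sequence such that $\sum_{i\in I}g_i\neq 0$ for every $\emptyset\ne I\subsetneq[1,\ell]$. The Davenport constant $\mathsf D(G)$ is the maximal length of a minimal zero-sum sequence over $G$. $\exp(G)$ is the exponent of $G$, $C_n$ is the cyclic group of order $n$, $C_n^r$ is the direct sum of $r$ copies of $C_n$, and $\mathsf r_p(G)$ is the $p$-rank of $G$. An elementary $2$-group is a group isomorphic to $C_2^r$ for some $r$. Convention: $\gcd(0,n)=n$. *)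

theory Defs
  imports
    "HOL-Algebra.Algebra"
    "HOL-Library.Multiset"
    "HOL-Computational_Algebra.Primes"
begin

text \<open>
  The abelian group is written multiplicatively, as in HOL-Algebra: the unit \<open>\<one>\<^bsub>G\<^esub>\<close> is the zero
  element and \<open>inv\<^bsub>G\<^esub> g\<close> is \<open>- g\<close>. A sequence over \<open>G\<close> is a multiset with elements in \<open>carrier G\<close>;
  concatenation of sequences is multiset addition and the length is \<open>size\<close>.
\<close>

definition seq_sum :: "('a, 'b) monoid_scheme \<Rightarrow> 'a multiset \<Rightarrow> 'a"
  where "seq_sum G S = finprod G (\<lambda>g. g [^]\<^bsub>G\<^esub> count S g) (set_mset S)"

text \<open>
  Non-empty proper index sets of a sequence correspond to non-empty proper submultisets.
\<close>

definition minimal_zero_sum_seq :: "('a, 'b) monoid_scheme \<Rightarrow> 'a multiset \<Rightarrow> bool"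
  where "minimal_zero_sum_seq G S \<longleftrightarrow>
    set_mset S \<subseteq> carrier G \<and> S \<noteq> {#} \<and> seq_sum G S = \<one>\<^bsub>G\<^esub> \<and>
    (\<forall>T. T \<noteq> {#} \<and> T \<subset># S \<longrightarrow> seq_sum G T \<noteq> \<one>\<^bsub>G\<^esub>)"

definition davenport_constant :: "('a, 'b) monoid_scheme \<Rightarrow> nat"
  where "davenport_constant G = Max {size S | S. minimal_zero_sum_seq G S}"

definition group_exponent :: "('a, 'b) monoid_scheme \<Rightarrow> nat"
  where "group_exponent G = (LEAST n. 0 < n \<and> (\<forall>g \<in> carrier G. g [^]\<^bsub>G\<^esub> n = \<one>\<^bsub>G\<^esub>))"

text \<open>The direct sum of \<open>r\<close> copies of the cyclic group of order \<open>n\<close> (for positive \<open>n\<close>).\<close>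

definition cyclic_power :: "nat \<Rightarrow> nat \<Rightarrow> (nat \<Rightarrow> int) monoid"
  where "cyclic_power n r = product_group {..<r} (\<lambda>_. integer_mod_group n)"

definition elementary_2_group :: "('a, 'b) monoid_scheme \<Rightarrow> bool"
  where "elementary_2_group G \<longleftrightarrow> (\<exists>r. G \<cong> cyclic_power 2 r)"

definition is_p_group :: "nat \<Rightarrow> ('a, 'b) monoid_scheme \<Rightarrow> bool"
  where "is_p_group p G \<longleftrightarrow> group G \<and> (\<exists>n. order G = p ^ n)"

text \<open>The largest rank of an elementary abelian \<open>p\<close>-subgroup.\<close>

definition p_rank :: "nat \<Rightarrow> ('a, 'b) monoid_scheme \<Rightarrow> nat"
  where "p_rank p G = Max {r. \<exists>H. subgroup H G \<and> G\<lparr>carrier := H\<rparr> \<cong> cyclic_power p r}"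

end

theory Submission
  imports Defs
begin

text \<open>
  Two factorizations of the same sequence over \<open>A = {g, -g | g in U}\<close> have lengths differing by an
  element of a subgroup of the integers. If \<open>1\<close> is not in it, then for some prime \<open>m\<close> the number of
  factors is well defined modulo \<open>m\<close>, and it is additive. Comparing \<open>g\<^sup>n (-g)\<^sup>n\<close> and \<open>U (-U)\<close> with products
  of pairs \<open>g (-g)\<close> shows that \<open>m\<close> divides \<open>ord g - 2\<close> for each term \<open>g\<close>, and \<open>|U| - 2\<close>. As \<open>U\<close> has maximal
  length, its terms generate the group, which settles the cases with \<open>gcd(exp - 2, D - 2) = 1\<close>.

  Otherwise take an independent family \<open>F\<close> of terms and another term \<open>y\<close> of order \<open>N\<close> modulo \<open>\<langle>F\<rangle>\<close>, and
  count the factors of the sequences given by \<open>N y\<close> and \<open>2 N y\<close> together with copies of the \<open>\<plusminus>x\<close>,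
  where \<open>x\<close> is in \<open>F\<close>. Either \<open>F\<close> and \<open>y\<close> are independent, or \<open>N\<close> is \<open>1\<close> modulo \<open>m\<close> and \<open>N y\<close> is a
  multiple of one \<open>x\<close> or a sum of elements of order two. The arithmetic hypotheses
  exclude the second case for \<open>N > 1\<close>, so \<open>F\<close> generates the group and the terms of \<open>U\<close> lie on the lines
  \<open>\<langle>x\<rangle>\<close> or have order two. Such a sequence \<open>U\<close> is either decomposable or can be lengthened.
\<close>

section \<open>Length functions on lattices of exponent vectors\<close>

text \<open>Only minimal vectors have a known count, so everything rests on exhibiting many of them.
  If a relation takes \<open>y\<close> with its order \<open>N\<close> modulo the span of
  \<open>F\<close>, and its entries on \<open>F\<close> are below the orders \<open>n i\<close>, no
  proper part of it vanishes, whatever the signs. So an entry may be moved across zero by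
  \<open>n i\<close> without losing minimality, and comparing the two counts shows that its absolute
  value is 1 modulo \<open>m\<close>; the length relation then gives \<open>N + |K| = 2\<close>
  modulo \<open>m\<close> for the support \<open>K\<close>. The doubled relation has a minimal form
  for each admissible set \<open>S\<close> of moved entries, and each forces \<open>|S| = 1\<close>
  modulo \<open>m\<close>. Admissible sets that differ by one element would contradict each other,
  so only a single member or a set of half-order entries survives as support. Orders
  \<open>N\<close> that are 1 modulo \<open>m\<close> are the real obstacle. In case (b) those that
  remain possible are defeated by heights of elements of order \<open>p\<close>. For exponent
  \<open>2 * p\<close> and \<open>m = 2\<close> the value \<open>N = p\<close> is never excluded,
  since \<open>p\<close> is odd; there independence is weakened to independence modulo
  \<open>p\<close>, and a parity argument recovers what was lost.\<close>

definition cancel :: "int \<Rightarrow> int \<Rightarrow> int"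
  where "cancel a b = (\<bar>a\<bar> + \<bar>b\<bar> - \<bar>a + b\<bar>) div 2"

lemma cancel_zero [simp]: "cancel a 0 = 0" "cancel 0 a = 0"
  and cancel_self [simp]: "cancel a a = 0"
  and cancel_uminus [simp]: "cancel a (- a) = \<bar>a\<bar>"
  by (simp_all add: cancel_def)

lemma cancel_flip: "\<bar>a\<bar> \<le> n \<Longrightarrow> cancel a (- (sgn a * n)) = \<bar>a\<bar>"
  unfolding cancel_def by (cases a "0::int" rule: linorder_cases) auto

text \<open>In terms of sequences: \<open>u\<close> encodes a subsequence of the sequence encoded by
  \<open>e\<close>.\<close>

definition conformal :: "'i set \<Rightarrow> ('i \<Rightarrow> int) \<Rightarrow> ('i \<Rightarrow> int) \<Rightarrow> bool"
  where "conformal I u e \<longleftrightarrow> (\<forall>i\<in>I. (0 \<le> u i \<and> u i \<le> e i) \<or> (e i \<le> u i \<and> u i \<le> 0))"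

definition spike :: "'i \<Rightarrow> int \<Rightarrow> 'i \<Rightarrow> int"
  where "spike i c = (\<lambda>j. if j = i then c else 0)"

lemma spike_simps [simp]: "spike i c i = c" "j \<noteq> i \<Longrightarrow> spike i c j = 0"
  by (simp_all add: spike_def)

text \<open>
  Exponent vectors \<open>e\<close> on \<open>I\<close> stand for the sequences with \<open>e i\<close> copies of the \<open>i\<close>-th term
  (copies of its negative if \<open>e i < 0\<close>), \<open>L\<close> singles out the zero-sum ones, and \<open>f\<close> is the
  number of factors in a factorization into minimal ones, which is meaningful modulo \<open>m\<close>.
  When two sequences are concatenated, \<open>cancel\<close> counts the pairs \<open>g (-g)\<close> that split off.
\<close>

locale length_lattice =
  fixes I :: "'i set" and L :: "('i \<Rightarrow> int) \<Rightarrow> bool" and f :: "('i \<Rightarrow> int) \<Rightarrow> int" and m :: int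
  assumes finite_I: "finite I"
    and m_gt_1: "1 < m"
    and L_zero: "L (\<lambda>_. 0)"
    and L_diff: "L e \<Longrightarrow> L e' \<Longrightarrow> L (\<lambda>i. e i - e' i)"
    and L_cong: "L e \<Longrightarrow> (\<And>i. i \<in> I \<Longrightarrow> e i = e' i) \<Longrightarrow> L e'"
    and f_add: "L e \<Longrightarrow> L e' \<Longrightarrow>
      m dvd f e + f e' - f (\<lambda>i. e i + e' i) - (\<Sum>i\<in>I. cancel (e i) (e' i))"
    and f_minimal: "L e \<Longrightarrow> \<exists>i\<in>I. e i \<noteq> 0 \<Longrightarrow>
      (\<And>u. L u \<Longrightarrow> conformal I u e \<Longrightarrow> (\<forall>i\<in>I. u i = 0) \<or> (\<forall>i\<in>I. u i = e i)) \<Longrightarrow>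
      m dvd f e - 1"
begin

definition minimal :: "('i \<Rightarrow> int) \<Rightarrow> bool"
  where "minimal e \<longleftrightarrow> L e \<and> (\<exists>i\<in>I. e i \<noteq> 0) \<and>
    (\<forall>u. L u \<and> conformal I u e \<longrightarrow> (\<forall>i\<in>I. u i = 0) \<or> (\<forall>i\<in>I. u i = e i))"

lemma L_uminus: "L e \<Longrightarrow> L (\<lambda>i. - e i)"
  using L_diff[OF L_zero, of e] by simp

lemma L_add: "L e \<Longrightarrow> L e' \<Longrightarrow> L (\<lambda>i. e i + e' i)"
  using L_diff[OF _ L_uminus, of e e'] by simp

lemma f_of_minimal: "minimal e \<Longrightarrow> m dvd f e - 1"
  using f_minimal unfolding minimal_def by blast

lemma minimal_uminus:
  assumes "minimal e"
  shows "minimal (\<lambda>i. - e i)"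
  unfolding minimal_def
proof (intro conjI allI impI)
  show "L (\<lambda>i. - e i)" "\<exists>i\<in>I. - e i \<noteq> 0"
    using assms L_uminus by (auto simp: minimal_def)
  fix u assume "L u \<and> conformal I u (\<lambda>i. - e i)"
  then have "L (\<lambda>i. - u i)" "conformal I (\<lambda>i. - u i) e"
    using L_uminus by (fastforce simp: conformal_def)+
  then have "(\<forall>i\<in>I. - u i = 0) \<or> (\<forall>i\<in>I. - u i = e i)"
    using assms unfolding minimal_def by blast
  then show "(\<forall>i\<in>I. u i = 0) \<or> (\<forall>i\<in>I. u i = - e i)" by force
qed

lemma minimal_spike:
  assumes "i \<in> I" "n > 0" "L (spike i n)" and dvd: "\<And>u. L u \<Longrightarrow> (\<And>j. j \<in> I \<Longrightarrow> j \<noteq> i \<Longrightarrow> u j = 0) \<Longrightarrow> n dvd u i"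
  shows "minimal (spike i n)"
  unfolding minimal_def
proof (intro conjI allI impI)
  show "L (spike i n)" "\<exists>j\<in>I. spike i n j \<noteq> 0" using assms by (auto intro!: bexI[of _ i])
  fix u assume u: "L u \<and> conformal I u (spike i n)"
  have z: "u j = 0" if "j \<in> I" "j \<noteq> i" for j
    using u that unfolding conformal_def by force
  have "n dvd u i" using dvd u z by blast
  moreover have "0 \<le> u i" "u i \<le> n" using u assms unfolding conformal_def by force+
  ultimately have "u i = 0 \<or> u i = n" by (metis zdvd_imp_le order_le_less order_antisym)
  then show "(\<forall>j\<in>I. u j = 0) \<or> (\<forall>j\<in>I. u j = spike i n j)"
    using z by (metis spike_simps)
qed

lemma f_add_spike:
  assumes "L e" "L (spike i c)" "i \<in> I"
  shows "m dvd f e + f (spike i c) - f (\<lambda>j. e j + spike i c j) - cancel (e i) c"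
proof -
  have "(\<Sum>j\<in>I. cancel (e j) (spike i c j)) = (\<Sum>j\<in>I. if j = i then cancel (e i) c else 0)"
    by (rule sum.cong) (auto simp: spike_def)
  also have "\<dots> = cancel (e i) c" using assms finite_I by simp
  finally show ?thesis using f_add[OF assms(1,2)] by simp
qed

text \<open>Concatenating \<open>e\<close> with \<open>n\<close> terms of opposite sign at
  \<open>i\<close> gives two minimal factors, or else one minimal factor and \<open>|e i|\<close>
  cancelled pairs; hence \<open>2 = 1 + |e i|\<close> modulo \<open>m\<close>.\<close>

lemma flip:
  assumes "i \<in> I" "minimal e" "minimal (spike i n)" "\<bar>e i\<bar> \<le> n"
    and "minimal (\<lambda>j. e j + spike i (- sgn (e i) * n) j)" and "e i \<noteq> 0"
  shows "m dvd \<bar>e i\<bar> - 1"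
proof -
  have "(\<lambda>j. - spike i n j) = spike i (- n)" by (auto simp: spike_def)
  then have "minimal (spike i (- n))" using minimal_uminus[OF assms(3)] by simp
  then have sp: "minimal (spike i (- sgn (e i) * n))"
    using assms by (cases "e i" "0::int" rule: linorder_cases) auto
  have "m dvd f e + f (spike i (- sgn (e i) * n)) - f (\<lambda>j. e j + spike i (- sgn (e i) * n) j) - \<bar>e i\<bar>"
    using f_add_spike[OF _ _ assms(1), of e "- sgn (e i) * n"] assms sp
    by (simp add: minimal_def cancel_flip)
  from dvd_diff[OF dvd_diff[OF dvd_add[OF f_of_minimal[OF assms(2)] f_of_minimal[OF sp]]
        f_of_minimal[OF assms(5)]] this]
  show ?thesis by (simp add: algebra_simps)
qed

lemma f_zero: "m dvd f (\<lambda>_. 0)"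
  using f_add[OF L_zero L_zero] by simp

text \<open>The concatenation of \<open>e\<close> and its negative has two minimal factors, but it
  also falls into as many cancelling pairs as \<open>e\<close> has terms.\<close>

lemma f_uminus:
  assumes "minimal e"
  shows "m dvd 2 - (\<Sum>i\<in>I. \<bar>e i\<bar>)"
proof -
  have "m dvd f e + f (\<lambda>i. - e i) - f (\<lambda>_. 0) - (\<Sum>i\<in>I. \<bar>e i\<bar>)"
    using f_add[OF _ L_uminus, of e e] assms by (simp add: minimal_def)
  from dvd_diff[OF dvd_add[OF this f_zero] dvd_add[OF f_of_minimal[OF assms] f_of_minimal[OF minimal_uminus[OF assms]]]]
  have "m dvd - (\<Sum>i\<in>I. \<bar>e i\<bar>) + 2" by (simp add: algebra_simps)
  then show ?thesis by (simp add: algebra_simps)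
qed

text \<open>Here \<open>n i\<close> plays the role of the order of the \<open>i\<close>-th term, and
  \<open>N\<close> that of the order of \<open>y\<close> modulo the others. The bound
  \<open>2 * |e i| <= n i\<close> lets both \<open>e i\<close> and \<open>2 * e i\<close> be moved
  across zero by \<open>n i\<close> with complete cancellation.\<close>

lemma order_relation:
  assumes "y \<in> I" and F: "F = I - {y}"
    and n: "\<And>i. i \<in> F \<Longrightarrow> 0 < n i" "\<And>i. i \<in> F \<Longrightarrow> L (spike i (n i))"
    and indep: "\<And>u i. L u \<Longrightarrow> u y = 0 \<Longrightarrow> i \<in> F \<Longrightarrow> n i dvd u i"
    and N: "0 < N" "\<And>u. L u \<Longrightarrow> N dvd u y"
    and e: "L e" "e y = N" "\<And>i. i \<in> F \<Longrightarrow> 2 * \<bar>e i\<bar> \<le> n i"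
    and K: "K = {i \<in> F. e i \<noteq> 0}"
  shows "K = {} \<or> (m dvd N - 1 \<and> (card K = 1 \<or> (\<forall>i\<in>K. 2 * \<bar>e i\<bar> = n i)))"
proof (cases "K = {}")
  case False
  have FI: "F \<subseteq> I" "y \<notin> F" "I = insert y F" using F \<open>y \<in> I\<close> by auto
  have finK: "finite K" "K \<subseteq> F" using K F finite_I by auto
  have small: "u i = 0" if "L u" "u y = 0" "i \<in> F" "\<bar>u i\<bar> < n i" for u i
    using indep[OF that(1-3)] that(4) by (metis dvd_imp_le_int not_le abs_of_pos n(1) that(3))
  have eq: "u i = v i" if "L u" "L v" "u y = v y" "i \<in> F" "\<bar>u i\<bar> \<le> \<bar>v i\<bar>" "\<bar>v i\<bar> < n i"
    "sgn (u i) * sgn (v i) \<ge> 0" for u v i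
  proof -
    have "v i - u i = 0" using small[OF L_diff[OF that(2,1)] _ that(4)] that
      by (cases "u i" "0::int" rule: linorder_cases; cases "v i" "0::int" rule: linorder_cases) auto
    then show ?thesis by simp
  qed
  have conf: "\<bar>u i\<bar> \<le> \<bar>v i\<bar>" "sgn (u i) * sgn (v i) \<ge> 0" if "conformal I u v" "i \<in> I" for u v i
    using that unfolding conformal_def by (force simp: sgn_if)+
  have spike_min: "minimal (spike i (n i))" if "i \<in> F" for i
    using minimal_spike[of i "n i"] n that indep[of _ i] FI
    by (metis F Diff_iff insertI1 singletonD subsetD)
  have spike_min': "minimal (spike i (- sgn a * n i))" if "i \<in> F" "a \<noteq> 0" for i and a :: int
  proof -
    have "(\<lambda>j. - spike i (n i) j) = spike i (- n i)" by (auto simp: spike_def)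
    with spike_min[OF that(1)] minimal_uminus[OF spike_min[OF that(1)]] that(2)
    show ?thesis by (cases a "0::int" rule: linorder_cases) auto
  qed
  \<comment> \<open>A part of \<open>v\<close> has \<open>y\<close>-entry \<open>0\<close> or
    \<open>N\<close>. In the first case it is a relation on \<open>F\<close> with entries below
    \<open>n i\<close>, hence zero; in the second case its complement is.\<close>
  have min_N: "minimal v" if v: "L v" "v y = N" "\<And>i. i \<in> F \<Longrightarrow> \<bar>v i\<bar> < n i" for v
    unfolding minimal_def
  proof (intro conjI allI impI)
    show "L v" "\<exists>i\<in>I. v i \<noteq> 0" using v N(1) \<open>y \<in> I\<close> by (auto intro!: bexI[of _ y])
    fix u assume u: "L u \<and> conformal I u v"
    have "0 \<le> u y" "u y \<le> N" using u \<open>y \<in> I\<close> v(2) N(1) unfolding conformal_def by force+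
    with N(2)[of u] u have "u y = 0 \<or> u y = N"
      by (metis zdvd_imp_le order_le_less order_antisym)
    then show "(\<forall>i\<in>I. u i = 0) \<or> (\<forall>i\<in>I. u i = v i)"
    proof
      assume "u y = 0"
      then have "u i = 0" if "i \<in> F" for i
        using small[of u i] u that v(3)[OF that] conf(1)[of u v i] FI by fastforce
      with \<open>u y = 0\<close> FI show ?thesis by auto
    next
      assume "u y = N"
      then have "u i = v i" if "i \<in> F" for i
        using eq[of u v i] u v that conf[of u v i] FI by fastforce
      with \<open>u y = N\<close> v FI show ?thesis by auto
    qed
  qed
  have lt: "\<bar>e i\<bar> < n i" if "i \<in> F" for i using e(3)[OF that] n(1)[OF that] by linarith
  have min_e: "minimal e" using min_N e lt by blast
  have one: "m dvd \<bar>e i\<bar> - 1" if "i \<in> K" for i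
  proof (rule flip[of i e "n i"])
    have iF: "i \<in> F" "e i \<noteq> 0" using that K by auto
    show "i \<in> I" "minimal e" "minimal (spike i (n i))" "\<bar>e i\<bar> \<le> n i" "e i \<noteq> 0"
      using iF FI min_e spike_min lt by (auto simp: order_less_imp_le)
    show "minimal (\<lambda>j. e j + spike i (- sgn (e i) * n i) j)"
    proof (rule min_N)
      show "L (\<lambda>j. e j + spike i (- sgn (e i) * n i) j)"
        using L_add[OF e(1)] spike_min'[OF iF] by (simp add: minimal_def)
      show "e y + spike i (- sgn (e i) * n i) y = N" using e iF FI by (metis add.right_neutral spike_simps(2))
      show "\<bar>e j + spike i (- sgn (e i) * n i) j\<bar> < n j" if "j \<in> F" for j
      proof (cases "j = i")
        case True
        then show ?thesis using lt[OF iF(1)] iF(2) by (cases "e i" "0::int" rule: linorder_cases) auto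
      next
        case False
        then show ?thesis using lt that by simp
      qed
    qed
  qed
  \<comment> \<open>The length of \<open>e\<close> is \<open>N + card K\<close> modulo
    \<open>m\<close>, because each entry on \<open>K\<close> is 1 modulo \<open>m\<close> in
    absolute value.\<close>
  have NK: "m dvd 2 - N - int (card K)"
  proof -
    have "(\<Sum>i\<in>I. \<bar>e i\<bar>) = N + (\<Sum>i\<in>F. \<bar>e i\<bar>)"
      using FI e(2) N(1) finite_I by simp
    also have "(\<Sum>i\<in>F. \<bar>e i\<bar>) = (\<Sum>i\<in>K. \<bar>e i\<bar>)"
      by (rule sum.mono_neutral_right) (use K F finite_I in auto)
    finally have s: "m dvd 2 - N - (\<Sum>i\<in>K. \<bar>e i\<bar>)" using f_uminus[OF min_e] by (simp add: algebra_simps)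
    have "m dvd (\<Sum>i\<in>K. \<bar>e i\<bar> - 1)" by (rule dvd_sum) (rule one)
    from dvd_add[OF s this] show ?thesis by (simp add: sum_subtractf algebra_simps)
  qed
  \<comment> \<open>The doubled relation with the entries in \<open>S\<close> moved across zero.
    Each move changes the count by \<open>1 - 2 * |e i|\<close>, which is \<open>-1\<close> modulo
    \<open>m\<close>.\<close>
  define v where "v S = (\<lambda>i. if i \<in> S then 2 * e i - sgn (e i) * n i else 2 * e i)" for S
  have fv: "L (v S) \<and> m dvd f (v S) - 2 + int (card S)" if "S \<subseteq> K" for S
    using finite_subset[OF that finK(1)] that
  proof (induction S rule: finite_induct)
    case empty
    have "m dvd f e + f e - f (\<lambda>i. e i + e i)" using f_add[OF e(1) e(1)] by simp
    from dvd_diff[OF dvd_add[OF f_of_minimal[OF min_e] f_of_minimal[OF min_e]] this]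
    have "m dvd f (\<lambda>i. e i + e i) - 2" by (simp add: algebra_simps)
    moreover have "v {} = (\<lambda>i. e i + e i)" by (auto simp: v_def)
    ultimately show ?case using L_add[OF e(1) e(1)] by simp
  next
    case (insert x S)
    then have x: "x \<in> F" "x \<in> K" "e x \<noteq> 0" "x \<in> I" and IH: "L (v S)" "m dvd f (v S) - 2 + int (card S)"
      using K FI by auto
    have eqv: "v (insert x S) = (\<lambda>j. v S j + spike x (- sgn (e x) * n x) j)"
      using insert(2) by (auto simp: v_def spike_def)
    have vx: "v S x = 2 * e x" using insert(2) by (simp add: v_def)
    have Ls: "L (spike x (- sgn (e x) * n x))" using spike_min'[OF x(1,3)] by (simp add: minimal_def)
    have "cancel (v S x) (- sgn (e x) * n x) = 2 * \<bar>e x\<bar>"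
      using cancel_flip[of "2 * e x" "n x"] e(3)[OF x(1)] vx by (simp add: sgn_mult abs_mult)
    with f_add_spike[OF IH(1) Ls x(4)] eqv
    have "m dvd f (v S) + f (spike x (- sgn (e x) * n x)) - f (v (insert x S)) - 2 * \<bar>e x\<bar>" by simp
    from dvd_diff[OF dvd_add[OF IH(2) f_of_minimal[OF spike_min'[OF x(1,3)]]]
        dvd_add[OF this dvd_mult[OF one[OF x(2)], of 2]]]
    have "m dvd f (v (insert x S)) - 2 + int (card (insert x S))"
      using insert(1,2) by (simp add: algebra_simps)
    moreover have "L (v (insert x S))" using L_add[OF IH(1) Ls] eqv by simp
    ultimately show ?case by simp
  qed
  \<comment> \<open>Half-order entries must belong to \<open>S\<close>: their doubles would be
    \<open>n i\<close> in absolute value and split off alone. For empty \<open>S\<close> the vector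
    is two copies of \<open>e\<close>.\<close>
  have card_S: "m dvd int (card S) - 1" if S: "S \<subseteq> K" "S \<noteq> {}" "{i \<in> K. 2 * \<bar>e i\<bar> = n i} \<subseteq> S" for S
  proof -
    have Lv: "L (v S)" using fv S by blast
    have vlt: "\<bar>v S i\<bar> < n i" if "i \<in> F" for i
    proof (cases "i \<in> S")
      case True
      then have "e i \<noteq> 0" using S K by auto
      then show ?thesis using True e(3)[OF that] n(1)[OF that]
        by (cases "e i" "0::int" rule: linorder_cases) (auto simp: v_def)
    next
      case False
      then have "2 * \<bar>e i\<bar> \<noteq> n i" using S(3) K that n(1)[OF that] by fastforce
      then show ?thesis using False e(3)[OF that] by (auto simp: v_def abs_mult)
    qed
    have vy: "v S y = 2 * N" using S(1) finK FI e(2) by (auto simp: v_def)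
    have "minimal (v S)"
      unfolding minimal_def
    proof (intro conjI allI impI)
      show "L (v S)" by fact
      show "\<exists>i\<in>I. v S i \<noteq> 0" using vy N(1) \<open>y \<in> I\<close> by (auto intro!: bexI[of _ y])
      fix u assume u: "L u \<and> conformal I u (v S)"
      have "0 \<le> u y" "u y \<le> 2 * N" using u \<open>y \<in> I\<close> vy N(1) unfolding conformal_def by force+
      moreover obtain k where k: "u y = N * k" using N(2)[of u] u by (auto elim: dvdE)
      ultimately have "0 \<le> k" "k \<le> 2" using N(1) by (auto simp: zero_le_mult_iff mult.commute)
      then consider "k = 0" | "k = 1" | "k = 2" by linarith
      then show "(\<forall>i\<in>I. u i = 0) \<or> (\<forall>i\<in>I. u i = v S i)"
      proof cases
        case 1
        then have "u i = 0" if "i \<in> F" for i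
          using small[of u i] u that vlt[OF that] conf(1)[of u "v S" i] FI k by fastforce
        with 1 k FI show ?thesis by auto
      next
        case 3
        then have "u i = v S i" if "i \<in> F" for i
          using eq[of u "v S" i] u Lv that conf[of u "v S" i] FI vlt k vy by fastforce
        with 3 k vy FI show ?thesis by auto
      next
        case 2
        \<comment> \<open>such a \<open>u\<close> would agree with \<open>e\<close> modulo \<open>n i\<close>, impossible at an \<open>i\<close> whose sign was flipped\<close>
        obtain i where i: "i \<in> S" using S(2) by auto
        then have iF: "i \<in> F" "e i \<noteq> 0" "i \<in> I" using S(1) K FI by auto
        have dvd: "n i dvd u i - e i" using indep[OF L_diff[of u e] _ iF(1)] u e 2 k by simp
        have cf: "(0 \<le> u i \<and> u i \<le> v S i) \<or> (v S i \<le> u i \<and> u i \<le> 0)"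
          using u iF(3) unfolding conformal_def by blast
        have False
        proof (cases "e i > 0")
          case True
          then have "u i \<le> 0" "2 * e i - n i \<le> u i" using cf i e(3)[OF iF(1)] by (auto simp: v_def)
          with True have "0 < e i - u i" "e i - u i < n i" by auto
          moreover have "n i dvd e i - u i" using dvd by (simp add: dvd_diff_commute)
          ultimately show False using zdvd_not_zless by blast
        next
          case False
          then have "0 \<le> u i" "u i \<le> 2 * e i + n i" "e i < 0"
            using cf i e(3)[OF iF(1)] iF by (auto simp: v_def sgn_if)
          then have "0 < u i - e i" "u i - e i < n i" by auto
          then show False using zdvd_not_zless dvd by blast
        qed
        then show ?thesis ..
      qed
    qed
    from dvd_diff[OF conjunct2[OF fv[OF S(1)]] f_of_minimal[OF this]] show ?thesis by simp
  qed
  define H where "H = {i \<in> K. 2 * \<bar>e i\<bar> = n i}"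
  \<comment> \<open>Both \<open>S\<close> and \<open>insert j S\<close> are admissible, so both
    cardinalities would be 1 modulo \<open>m\<close>.\<close>
  have step: False if "S \<subseteq> K" "S \<noteq> {}" "H \<subseteq> S" "j \<in> K" "j \<notin> S" for S j
  proof -
    have "m dvd int (card S) - 1" using card_S that by (simp add: H_def)
    moreover have "m dvd int (card (insert j S)) - 1"
      by (rule card_S) (use that in \<open>auto simp: H_def\<close>)
    moreover have "finite S" using that finK finite_subset by blast
    ultimately have "m dvd (int (card (insert j S)) - 1) - (int (card S) - 1)" "card (insert j S) = Suc (card S)"
      using that(5) dvd_diff by (blast, simp)
    then have "m dvd 1" by simp
    then show False using m_gt_1 by (simp add: zdvd1_eq)
  qed
  have "card K = 1 \<or> H = K"
  proof (rule ccontr)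
    assume *: "\<not> ?thesis"
    then obtain j where j: "j \<in> K" "j \<notin> H" by (auto simp: H_def)
    have "card K \<noteq> 1" using * by simp
    then obtain j' where "j' \<in> K" "j' \<noteq> j" using j(1) False finK(1)
      by (metis card_1_singleton_iff is_singletonI' is_singleton_def One_nat_def)
    then show False using step[of H j] step[of "{j}" j'] j by (cases "H = {}") (auto simp: H_def)
  qed
  moreover have "m dvd int (card K) - 1"
    by (rule card_S) (use False in \<open>auto\<close>)
  from dvd_add[OF NK this] have "m dvd N - 1" by (simp add: dvd_diff_commute)
  ultimately show ?thesis by (auto simp: H_def)
qed simp

end

section \<open>Zero-sum sequences and factorization lengths modulo m\<close>

lemma int_subgroup_cyclic:
  fixes D :: "int set"
  assumes "0 \<in> D" and diff: "\<And>a b. a \<in> D \<Longrightarrow> b \<in> D \<Longrightarrow> a - b \<in> D"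
  shows "\<exists>d\<ge>0. \<forall>k. k \<in> D \<longleftrightarrow> d dvd k"
proof (cases "\<exists>a\<in>D. a \<noteq> 0")
  case False
  then show ?thesis using assms(1) by (intro exI[of _ 0]) auto
next
  case True
  then obtain a where a: "a \<in> D" "a \<noteq> 0" by blast
  have pos: "\<exists>k. 0 < k \<and> int k \<in> D"
    using a diff[OF assms(1) a(1)] by (intro exI[of _ "nat \<bar>a\<bar>"]) (auto simp: abs_if)
  define d where "d = (LEAST k. 0 < k \<and> int k \<in> D)"
  have d: "0 < d" "int d \<in> D" using LeastI_ex[OF pos] by (auto simp: d_def)
  have mult: "c - int k * int d \<in> D" if "c \<in> D" for c k
  proof (induction k)
    case (Suc k)
    from diff[OF this d(2)] show ?case by (simp add: algebra_simps)
  qed (use that in simp)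
  have mult': "c + int k * int d \<in> D" if "c \<in> D" for c k
    using diff[OF that mult[OF assms(1), of k]] by simp
  have mult_int: "c - k * int d \<in> D" if "c \<in> D" for c k
    using mult[OF that, of "nat k"] mult'[OF that, of "nat (- k)"] by (cases "k \<ge> 0") auto
  have "int d dvd c" if "c \<in> D" for c
  proof (rule ccontr)
    assume "\<not> int d dvd c"
    then have "c mod int d \<noteq> 0" by (simp add: mod_eq_0_iff_dvd)
    moreover have "0 \<le> c mod int d" "c mod int d < int d" using d(1) by simp_all
    ultimately have r: "0 < c mod int d" "c mod int d < int d" by linarith+
    have "c mod int d \<in> D" using mult_int[OF that, of "c div int d"] by (simp add: minus_div_mult_eq_mod)
    then have "0 < nat (c mod int d) \<and> int (nat (c mod int d)) \<in> D" using r by simp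
    then have "d \<le> nat (c mod int d)" unfolding d_def by (rule Least_le)
    then show False using r by simp
  qed
  moreover have "c \<in> D" if "int d dvd c" for c
    using that mult_int[OF assms(1), of "- (c div int d)"] by simp
  ultimately show ?thesis by (intro exI[of _ "int d"]) auto
qed

lemma cancel_eq: "cancel a b = (if (0 \<le> a) = (0 \<le> b) then 0 else min \<bar>a\<bar> \<bar>b\<bar>)"
  unfolding cancel_def by (cases "0 \<le> a"; cases "0 \<le> b"; cases "0 \<le> a + b") simp_all

context comm_group
begin

section \<open>Sums of sequences, minimality and factorization\<close>

lemma seq_sum_superset:
  assumes "finite J" "set_mset S \<subseteq> J" "J \<subseteq> carrier G"
  shows "seq_sum G S = (\<Otimes>g\<in>J. g [^] count S g)"
  unfolding seq_sum_def
  by (rule finprod_mono_neutral_cong_left) (use assms in \<open>auto simp: not_in_iff\<close>)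

lemma seq_sum_empty [simp]: "seq_sum G {#} = \<one>"
  by (simp add: seq_sum_def)

lemma seq_sum_closed [simp]: "set_mset S \<subseteq> carrier G \<Longrightarrow> seq_sum G S \<in> carrier G"
  unfolding seq_sum_def by (rule finprod_closed) auto

lemma seq_sum_add [simp]:
  assumes "set_mset S \<subseteq> carrier G" "set_mset T \<subseteq> carrier G"
  shows "seq_sum G (S + T) = seq_sum G S \<otimes> seq_sum G T"
proof -
  let ?J = "set_mset S \<union> set_mset T"
  have "seq_sum G (S + T) = (\<Otimes>g\<in>?J. g [^] count S g \<otimes> g [^] count T g)"
    using assms by (subst seq_sum_superset[of ?J]) (auto intro!: finprod_cong' simp: nat_pow_mult)
  also have "\<dots> = (\<Otimes>g\<in>?J. g [^] count S g) \<otimes> (\<Otimes>g\<in>?J. g [^] count T g)"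
    using assms by (intro finprod_multf) auto
  also have "\<dots> = seq_sum G S \<otimes> seq_sum G T"
    using assms by (simp add: seq_sum_superset[of ?J])
  finally show ?thesis .
qed

lemma seq_sum_single [simp]: "x \<in> carrier G \<Longrightarrow> seq_sum G {#x#} = x"
  by (simp add: seq_sum_def)

lemma seq_sum_add_mset [simp]:
  "x \<in> carrier G \<Longrightarrow> set_mset S \<subseteq> carrier G \<Longrightarrow> seq_sum G (add_mset x S) = x \<otimes> seq_sum G S"
  using seq_sum_add[of "{#x#}" S] by simp

lemma seq_sum_replicate [simp]: "x \<in> carrier G \<Longrightarrow> seq_sum G (replicate_mset n x) = x [^] n"
  by (induction n) (auto simp: m_comm)

lemma repeat_mset_Suc: "repeat_mset (Suc n) S = S + repeat_mset n S"
  by simp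

lemma set_mset_repeat_subset: "set_mset (repeat_mset n S) \<subseteq> set_mset S"
  by (auto simp flip: count_greater_zero_iff)

lemma seq_sum_repeat:
  assumes "set_mset S \<subseteq> carrier G" "seq_sum G S = \<one>"
  shows "seq_sum G (repeat_mset n S) = \<one>"
proof (induction n)
  case (Suc n)
  have "set_mset (repeat_mset n S) \<subseteq> carrier G"
    by (rule subset_trans[OF set_mset_repeat_subset assms(1)])
  from seq_sum_add[OF assms(1) this] show ?case by (simp only: repeat_mset_Suc Suc assms(2) l_one one_closed)
qed simp

lemma seq_sum_sum:
  assumes "finite I" "\<And>i. i \<in> I \<Longrightarrow> set_mset (S i) \<subseteq> carrier G"
  shows "seq_sum G (\<Sum>i\<in>I. S i) = (\<Otimes>i\<in>I. seq_sum G (S i))"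
  using assms
proof (induction I rule: finite_induct)
  case (insert x I)
  have "set_mset (\<Sum>i\<in>I. S i) \<subseteq> carrier G" using insert by (auto simp: set_mset_sum)
  moreover have "(\<Otimes>i\<in>insert x I. seq_sum G (S i)) = seq_sum G (S x) \<otimes> (\<Otimes>i\<in>I. seq_sum G (S i))"
    by (rule finprod_insert) (use insert in auto)
  ultimately show ?case using insert by simp
qed simp

lemma minimal_zero_sum_seqD:
  assumes "minimal_zero_sum_seq G S"
  shows "set_mset S \<subseteq> carrier G" "S \<noteq> {#}" "seq_sum G S = \<one>"
    and "T \<subseteq># S \<Longrightarrow> seq_sum G T = \<one> \<Longrightarrow> T = {#} \<or> T = S"
  using assms unfolding minimal_zero_sum_seq_def by (auto simp: subset_mset.less_le)

lemma minimal_zero_sum_seqI: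
  assumes "set_mset S \<subseteq> carrier G" "S \<noteq> {#}" "seq_sum G S = \<one>"
    and "\<And>T. T \<subseteq># S \<Longrightarrow> seq_sum G T = \<one> \<Longrightarrow> T = {#} \<or> T = S"
  shows "minimal_zero_sum_seq G S"
  using assms unfolding minimal_zero_sum_seq_def by (auto simp: subset_mset.less_le)

text \<open>If \<open>x\<close> has order two, both terms coincide; the argument therefore goes by
  the size of \<open>T\<close>, not by its members.\<close>

lemma minimal_zero_sum_seq_pair:
  assumes "x \<in> carrier G" "x \<noteq> \<one>"
  shows "minimal_zero_sum_seq G {#x, inv x#}"
proof (rule minimal_zero_sum_seqI)
  fix T assume T: "T \<subseteq># {#x, inv x#}" "seq_sum G T = \<one>"
  show "T = {#} \<or> T = {#x, inv x#}"
  proof (rule ccontr)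
    assume *: "\<not> ?thesis"
    have "size T \<noteq> 2" using T(1) * mset_subset_size[of T "{#x, inv x#}"]
      by (auto simp: subset_mset.less_le)
    moreover have "size T \<le> 2" using size_mset_mono[OF T(1)] by simp
    moreover have "size T \<noteq> 0" using * by simp
    ultimately have "size T = 1" by linarith
    then obtain a where a: "T = {#a#}" by (metis One_nat_def size_eq_Suc_imp_eq_union add_mset_add_single
          empty_neutral(1) size_eq_0_iff_empty size_1_singleton_mset)
    then have "a = x \<or> a = inv x" using mset_subset_eqD[OF T(1), of a] by auto
    then show False using T(2) a assms by auto
  qed
qed (use assms in auto)

lemma minimal_factorization:
  assumes "set_mset S \<subseteq> A" "A \<subseteq> carrier G" "seq_sum G S = \<one>"
  shows "\<exists>Us. (\<forall>W\<in>set Us. minimal_zero_sum_seq G W \<and> set_mset W \<subseteq> A) \<and> sum_list Us = S"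
  using assms(1,3)
proof (induction "size S" arbitrary: S rule: less_induct)
  case less
  show ?case
  proof (cases "S = {#} \<or> minimal_zero_sum_seq G S")
    case True
    then show ?thesis
    proof
      assume "S = {#}"
      then show ?thesis by (intro exI[of _ "[]"]) simp
    next
      assume "minimal_zero_sum_seq G S"
      then show ?thesis using less(2) by (intro exI[of _ "[S]"]) simp
    qed
  next
    case False
    then obtain T where T: "T \<noteq> {#}" "T \<subset># S" "seq_sum G T = \<one>"
      using less assms unfolding minimal_zero_sum_seq_def by auto
    define R where "R = S - T"
    have S: "S = T + R" "R \<noteq> {#}" using T(2) by (auto simp: R_def subset_mset.less_le Diff_eq_empty_iff_mset)
    then have sub: "set_mset T \<subseteq> A" "set_mset R \<subseteq> A" using less(2) by auto
    then have "seq_sum G R = \<one>" using less(3) S T(3) assms(2) by simp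
    then obtain Us Vs where
      "\<forall>W\<in>set Us. minimal_zero_sum_seq G W \<and> set_mset W \<subseteq> A" "sum_list Us = T"
      "\<forall>W\<in>set Vs. minimal_zero_sum_seq G W \<and> set_mset W \<subseteq> A" "sum_list Vs = R"
      using less(1)[of T] less(1)[of R] S T sub by (auto simp: nonempty_has_size)
    then show ?thesis using S by (intro exI[of _ "Us @ Vs"]) auto
  qed
qed

lemma ex_length_mod:
  assumes A: "A \<subseteq> carrier G"
    and no: "\<And>Us Vs. \<forall>W\<in>set Us \<union> set Vs. minimal_zero_sum_seq G W \<and> set_mset W \<subseteq> A \<Longrightarrow>
      sum_list Us = sum_list Vs \<Longrightarrow> length Vs \<noteq> length Us + 1"
  shows "\<exists>(m::int) \<phi>. Factorial_Ring.prime m \<and>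
    (\<forall>S T. set_mset S \<subseteq> A \<and> set_mset T \<subseteq> A \<and> seq_sum G S = \<one> \<and> seq_sum G T = \<one> \<longrightarrow>
      m dvd \<phi> (S + T) - \<phi> S - \<phi> T) \<and>
    (\<forall>W. minimal_zero_sum_seq G W \<and> set_mset W \<subseteq> A \<longrightarrow> m dvd \<phi> W - 1)"
proof -
  define fac where "fac Us S \<longleftrightarrow>
    (\<forall>W\<in>set Us. minimal_zero_sum_seq G W \<and> set_mset W \<subseteq> A) \<and> sum_list Us = S" for Us S
  define D where "D = {int (length Vs) - int (length Us) | Us Vs S. fac Us S \<and> fac Vs S}"
  have D_diff: "a - b \<in> D" if a: "a \<in> D" and b: "b \<in> D" for a b
  proof -
    obtain Us Vs S where 1: "fac Us S" "fac Vs S" "a = int (length Vs) - int (length Us)"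
      using a unfolding D_def by blast
    obtain Us' Vs' S' where 2: "fac Us' S'" "fac Vs' S'" "b = int (length Vs') - int (length Us')"
      using b unfolding D_def by blast
    note * = 1 2
    then have "fac (Us @ Vs') (S + S')" "fac (Vs @ Us') (S + S')" by (auto simp: fac_def)
    moreover have "a - b = int (length (Vs @ Us')) - int (length (Us @ Vs'))" using * by simp
    ultimately show ?thesis unfolding D_def by blast
  qed
  have one: "1 \<notin> D"
  proof
    assume "1 \<in> D"
    then obtain Us Vs S where "fac Us S" "fac Vs S" "int (length Vs) - int (length Us) = 1"
      unfolding D_def by auto
    then show False using no[of Us Vs] by (auto simp: fac_def)
  qed
  have "\<exists>m::int. Factorial_Ring.prime m \<and> (\<forall>a\<in>D. m dvd a)"
  proof -
    have "fac [] {#}" by (simp add: fac_def)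
    then have "int (length ([] :: 'a multiset list)) - int (length ([] :: 'a multiset list)) \<in> D"
      unfolding D_def by blast
    then have "0 \<in> D" by simp
    then obtain d where d: "\<And>k. k \<in> D \<longleftrightarrow> d dvd k"
      using int_subgroup_cyclic[of D] D_diff by metis
    have nu: "\<not> is_unit d" using d[of 1] one by simp
    have "\<exists>p. p dvd d \<and> Factorial_Ring.prime p"
    proof (cases "d = 0")
      case True
      \<comment> \<open>Here the number of factors is a well-defined integer and any prime
        serves.\<close>
      then show ?thesis by (intro exI[of _ 2]) simp
    next
      case False
      then show ?thesis using prime_divisor_exists nu by blast
    qed
    then obtain p where p: "p dvd d" "Factorial_Ring.prime p" by blast
    have "p dvd a" if "a \<in> D" for a using dvd_trans[OF p(1)] d[of a] that by blast
    then show ?thesis using p(2) by blast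
  qed
  then obtain m :: int where m: "Factorial_Ring.prime m" "\<And>a. a \<in> D \<Longrightarrow> m dvd a" by blast
  \<comment> \<open>The length of one chosen factorization; another choice changes it by a multiple
    of \<open>m\<close>.\<close>
  define \<phi> where "\<phi> S = int (length (SOME Us. fac Us S))" for S
  have \<phi>: "m dvd \<phi> S - int (length Us)" if "fac Us S" for Us S
    using someI[of "\<lambda>Us. fac Us S", OF that] that m(2) unfolding \<phi>_def D_def by blast
  show ?thesis
  proof (intro exI[of _ m] exI[of _ \<phi>] conjI allI impI m(1))
    fix S T assume *: "set_mset S \<subseteq> A \<and> set_mset T \<subseteq> A \<and> seq_sum G S = \<one> \<and> seq_sum G T = \<one>"
    then obtain Us Vs where UV: "fac Us S" "fac Vs T" using minimal_factorization A unfolding fac_def by metis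
    then have "fac (Us @ Vs) (S + T)" by (auto simp: fac_def)
    from dvd_diff[OF \<phi>[OF this] dvd_add[OF \<phi>[OF UV(1)] \<phi>[OF UV(2)]]]
    show "m dvd \<phi> (S + T) - \<phi> S - \<phi> T" by (simp add: algebra_simps)
  next
    fix W assume "minimal_zero_sum_seq G W \<and> set_mset W \<subseteq> A"
    then have "fac [W] W" by (simp add: fac_def)
    from \<phi>[OF this] show "m dvd \<phi> W - 1" by simp
  qed
qed

section \<open>Exponent vectors over a set of terms and the sequences they encode\<close>

definition lincomb :: "'a set \<Rightarrow> ('a \<Rightarrow> int) \<Rightarrow> 'a"
  where "lincomb I e = (\<Otimes>x\<in>I. x [^] e x)"

lemma lincomb_closed [simp]: "I \<subseteq> carrier G \<Longrightarrow> lincomb I e \<in> carrier G"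
  unfolding lincomb_def by (rule finprod_closed) auto

lemma lincomb_cong:
  "I \<subseteq> carrier G \<Longrightarrow> (\<And>x. x \<in> I \<Longrightarrow> e x = e' x) \<Longrightarrow> lincomb I e = lincomb I e'"
  unfolding lincomb_def by (rule finprod_cong') auto

lemma lincomb_zero: "I \<subseteq> carrier G \<Longrightarrow> (\<And>x. x \<in> I \<Longrightarrow> e x = 0) \<Longrightarrow> lincomb I e = \<one>"
  unfolding lincomb_def by (rule finprod_one_eqI) auto

lemma lincomb_add:
  assumes "I \<subseteq> carrier G"
  shows "lincomb I (\<lambda>x. e x + e' x) = lincomb I e \<otimes> lincomb I e'"
proof -
  have "lincomb I (\<lambda>x. e x + e' x) = (\<Otimes>x\<in>I. x [^] e x \<otimes> x [^] e' x)"
    unfolding lincomb_def using assms by (intro finprod_cong') (auto simp: int_pow_mult subset_iff)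
  also have "\<dots> = lincomb I e \<otimes> lincomb I e'"
    unfolding lincomb_def using assms by (intro finprod_multf) auto
  finally show ?thesis .
qed

lemma lincomb_uminus:
  assumes "I \<subseteq> carrier G"
  shows "lincomb I (\<lambda>x. - e x) = inv lincomb I e"
proof (rule inv_equality[symmetric])
  show "lincomb I (\<lambda>x. - e x) \<otimes> lincomb I e = \<one>"
    using lincomb_add[OF assms, of "\<lambda>x. - e x" e] lincomb_zero[OF assms] by simp
qed (use assms in auto)

lemma lincomb_diff:
  "I \<subseteq> carrier G \<Longrightarrow> lincomb I (\<lambda>x. e x - e' x) = lincomb I e \<otimes> inv lincomb I e'"
  using lincomb_add[of I e "\<lambda>x. - e' x"] lincomb_uminus by simp

lemma lincomb_mult:
  assumes "I \<subseteq> carrier G" "finite I"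
  shows "lincomb I (\<lambda>x. c * e x) = lincomb I e [^] (c::int)"
  using assms(2,1)
proof (induction I rule: finite_induct)
  case empty
  then show ?case by (simp add: lincomb_def int_pow_one)
next
  case (insert x F)
  then have c: "(\<lambda>x. x [^] e x) \<in> F \<rightarrow> carrier G" "(\<lambda>x. x [^] (c * e x)) \<in> F \<rightarrow> carrier G" by auto
  have "lincomb F e \<in> carrier G" using insert by simp
  then show ?case using insert c unfolding lincomb_def
    by (simp add: int_pow_distrib int_pow_pow mult.commute)
qed

lemma lincomb_insert:
  assumes "finite F" "x \<notin> F" "insert x F \<subseteq> carrier G"
  shows "lincomb (insert x F) e = x [^] e x \<otimes> lincomb F e"
  unfolding lincomb_def by (rule finprod_insert) (use assms in auto)

lemma lincomb_mono_neutral: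
  assumes "finite J" "I \<subseteq> J" "J \<subseteq> carrier G" "\<And>x. x \<in> J - I \<Longrightarrow> x [^] e x = \<one>"
  shows "lincomb J e = lincomb I e"
  unfolding lincomb_def
  by (rule finprod_mono_neutral_cong_right) (use assms in auto)

lemma lincomb_single:
  assumes "finite I" "x \<in> I" "I \<subseteq> carrier G" "\<And>z. z \<in> I \<Longrightarrow> z \<noteq> x \<Longrightarrow> e z = 0"
  shows "lincomb I e = x [^] e x"
proof -
  have "lincomb I e = lincomb {x} e"
    by (rule lincomb_mono_neutral) (use assms in auto)
  then show ?thesis using lincomb_insert[of "{}" x] assms by (auto simp: lincomb_def)
qed

lemma lincomb_spike:
  "finite I \<Longrightarrow> x \<in> I \<Longrightarrow> I \<subseteq> carrier G \<Longrightarrow> lincomb I (spike x c) = x [^] c"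
  using lincomb_single[of I x "spike x c"] by simp

lemma lincomb_subset:
  assumes "finite F" "F \<subseteq> carrier G" "E \<subseteq> F"
  shows "lincomb F (\<lambda>x. if x \<in> E then e x else 0) = lincomb E e"
proof -
  have "lincomb F (\<lambda>x. if x \<in> E then e x else 0) = lincomb E (\<lambda>x. if x \<in> E then e x else 0)"
    by (rule lincomb_mono_neutral) (use assms in auto)
  also have "\<dots> = lincomb E e" by (rule lincomb_cong) (use assms in auto)
  finally show ?thesis .
qed

definition signed_seq :: "'a set \<Rightarrow> ('a \<Rightarrow> int) \<Rightarrow> 'a multiset"
  where "signed_seq I e = (\<Sum>x\<in>I. replicate_mset (nat \<bar>e x\<bar>) (if 0 \<le> e x then x else inv x))"

lemma set_signed_seq: "finite I \<Longrightarrow> set_mset (signed_seq I e) \<subseteq> I \<union> (\<lambda>x. inv x) ` I"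
  unfolding signed_seq_def by (auto simp: set_mset_sum split: if_splits)

lemma size_signed_seq: "finite I \<Longrightarrow> size (signed_seq I e) = (\<Sum>x\<in>I. nat \<bar>e x\<bar>)"
  unfolding signed_seq_def by (simp add: size_multiset_sum)

lemma signed_seq_cong: "(\<And>x. x \<in> I \<Longrightarrow> e x = e' x) \<Longrightarrow> signed_seq I e = signed_seq I e'"
  unfolding signed_seq_def by (rule sum.cong) auto

lemma seq_sum_signed_seq:
  assumes "finite I" "I \<subseteq> carrier G"
  shows "seq_sum G (signed_seq I e) = lincomb I e"
proof -
  have "seq_sum G (signed_seq I e) =
      (\<Otimes>x\<in>I. seq_sum G (replicate_mset (nat \<bar>e x\<bar>) (if 0 \<le> e x then x else inv x)))"
    unfolding signed_seq_def by (rule seq_sum_sum) (use assms in \<open>auto split: if_splits\<close>)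
  also have "\<dots> = lincomb I e"
    unfolding lincomb_def
  proof (rule finprod_cong'[OF refl])
    show "(\<lambda>x. x [^] e x) \<in> I \<rightarrow> carrier G" using assms by auto
    fix x assume "x \<in> I"
    then have "x \<in> carrier G" using assms by auto
    then show "seq_sum G (replicate_mset (nat \<bar>e x\<bar>) (if 0 \<le> e x then x else inv x)) = x [^] e x"
      by (auto simp: int_pow_inv int_pow_neg)
  qed
  finally show ?thesis .
qed

text \<open>Different indices may have the same \<open>h x\<close>, as a term and its inverse may
  both be indexed. The induction step gives \<open>y\<close> as many copies as it can take and
  leaves the rest to \<open>I\<close>.\<close>

lemma submset_sum_replicate:
  assumes "finite I" "T \<subseteq># (\<Sum>x\<in>I. replicate_mset (c x) (h x))"
  shows "\<exists>c'. (\<forall>x\<in>I. c' x \<le> c x) \<and> T = (\<Sum>x\<in>I. replicate_mset (c' x) (h x))"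
  using assms
proof (induction I arbitrary: T rule: finite_induct)
  case (insert y I)
  let ?R = "replicate_mset (c y) (h y)"
  have "T - ?R \<subseteq># (\<Sum>x\<in>I. replicate_mset (c x) (h x))"
    using insert by (simp add: subset_eq_diff_conv add.commute)
  then obtain c' where c': "\<forall>x\<in>I. c' x \<le> c x" "T - ?R = (\<Sum>x\<in>I. replicate_mset (c' x) (h x))"
    using insert.IH by blast
  obtain k where k: "k \<le> c y" "T \<inter># ?R = replicate_mset k (h y)"
    using msubseteq_replicate_msetE[of "T \<inter># ?R" "c y" "h y"] by (auto simp: subset_mset.inf.cobounded2)
  have "T = (T \<inter># ?R) + (T - ?R)" by (simp add: multiset_eq_iff)
  also have "\<dots> = replicate_mset k (h y) + (\<Sum>x\<in>I. replicate_mset (c' x) (h x))" using k c' by simp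
  also have "(\<Sum>x\<in>I. replicate_mset (c' x) (h x)) = (\<Sum>x\<in>I. replicate_mset ((c'(y := k)) x) (h x))"
    by (rule sum.cong) (use insert in auto)
  finally show ?case using insert k c' by (intro exI[of _ "c'(y := k)"]) auto
qed auto

text \<open>Several vectors may encode one sequence, but the existence of a conformal one suffices
  to carry minimality from vectors to sequences.\<close>

lemma submset_signed_seq:
  assumes "finite I" "T \<subseteq># signed_seq I e"
  shows "\<exists>u. conformal I u e \<and> T = signed_seq I u"
proof -
  obtain c where c: "\<forall>x\<in>I. c x \<le> nat \<bar>e x\<bar>"
    "T = (\<Sum>x\<in>I. replicate_mset (c x) (if 0 \<le> e x then x else inv x))"
    using submset_sum_replicate[OF assms(1) assms(2)[unfolded signed_seq_def]] by blast
  define u where "u x = (if 0 \<le> e x then int (c x) else - int (c x))" for x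
  have "T = signed_seq I u" unfolding c signed_seq_def u_def by (rule sum.cong) auto
  moreover have "conformal I u e" using c(1) unfolding conformal_def u_def by (auto simp: le_nat_iff abs_if split: if_splits)
  ultimately show ?thesis by blast
qed

lemma signed_seq_add:
  "signed_seq I e + signed_seq I e' = signed_seq I (\<lambda>x. e x + e' x) +
    (\<Sum>x\<in>I. repeat_mset (nat (cancel (e x) (e' x))) {#x, inv x#})"
proof -
  have *: "replicate_mset (nat \<bar>a\<bar>) (if 0 \<le> a then x else y) + replicate_mset (nat \<bar>b\<bar>) (if 0 \<le> b then x else y)
      = replicate_mset (nat \<bar>a + b\<bar>) (if 0 \<le> a + b then x else y) + repeat_mset (nat (cancel a b)) {#x, y#}"
    for a b :: int and x y :: 'a
    unfolding cancel_eq
    by (rule multiset_eqI) (cases "0 \<le> a"; cases "0 \<le> b"; cases "0 \<le> a + b"; auto simp: nat_add_distrib)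
  show ?thesis unfolding signed_seq_def sum.distrib[symmetric] by (rule sum.cong) (simp_all only: *)
qed

end

text \<open>The outcome of \<open>ex_length_mod\<close>, where \<open>A\<close> will be the terms
  and their negatives. Keeping the unit out of \<open>A\<close> makes each pair \<open>x\<close>,
  \<open>inv x\<close> minimal, hence of count 1.\<close>

locale length_mod = comm_group G for G (structure) +
  fixes A :: "'a set" and \<phi> :: "'a multiset \<Rightarrow> int" and m :: int
  assumes A_sub: "A \<subseteq> carrier G"
    and inv_A: "x \<in> A \<Longrightarrow> inv x \<in> A"
    and one_notin_A: "\<one> \<notin> A"
    and m_gt_1: "1 < m"
    and \<phi>_add: "set_mset S \<subseteq> A \<Longrightarrow> set_mset T \<subseteq> A \<Longrightarrow> seq_sum G S = \<one> \<Longrightarrow> seq_sum G T = \<one> \<Longrightarrow>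
      m dvd \<phi> (S + T) - \<phi> S - \<phi> T"
    and \<phi>_minimal: "minimal_zero_sum_seq G W \<Longrightarrow> set_mset W \<subseteq> A \<Longrightarrow> m dvd \<phi> W - 1"
begin

lemma \<phi>_empty: "m dvd \<phi> {#}"
  using \<phi>_add[of "{#}" "{#}"] by simp

lemma \<phi>_repeat:
  assumes "minimal_zero_sum_seq G W" "set_mset W \<subseteq> A"
  shows "m dvd \<phi> (repeat_mset n W) - int n"
proof (induction n)
  case (Suc n)
  have "m dvd \<phi> (W + repeat_mset n W) - \<phi> W - \<phi> (repeat_mset n W)"
    using assms minimal_zero_sum_seqD[OF assms(1)] seq_sum_repeat set_mset_repeat_subset[of n W]
    by (intro \<phi>_add) auto
  from dvd_add[OF this dvd_add[OF Suc \<phi>_minimal[OF assms]]] show ?case by (simp add: algebra_simps)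
qed (use \<phi>_empty in simp)

lemma \<phi>_sum:
  assumes "finite I" "\<And>i. i \<in> I \<Longrightarrow> set_mset (S i) \<subseteq> A" "\<And>i. i \<in> I \<Longrightarrow> seq_sum G (S i) = \<one>"
    "\<And>i. i \<in> I \<Longrightarrow> m dvd \<phi> (S i) - c i"
  shows "m dvd \<phi> (\<Sum>i\<in>I. S i) - (\<Sum>i\<in>I. c i)"
  using assms
proof (induction I rule: finite_induct)
  case (insert x I)
  note S = insert.prems
  have IH: "m dvd \<phi> (\<Sum>i\<in>I. S i) - (\<Sum>i\<in>I. c i)"
    by (rule insert.IH) (rule S, simp)+
  have sub: "set_mset (\<Sum>i\<in>I. S i) \<subseteq> A"
    unfolding set_mset_sum[OF insert(1)] by (rule UN_least) (rule S(1), simp)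
  have "seq_sum G (\<Sum>i\<in>I. S i) = (\<Otimes>i\<in>I. seq_sum G (S i))"
    by (rule seq_sum_sum[OF insert(1)]) (rule subset_trans[OF S(1) A_sub], simp)
  also have "\<dots> = \<one>" by (rule finprod_one_eqI) (rule S(2), simp)
  finally have z: "seq_sum G (\<Sum>i\<in>I. S i) = \<one>" .
  have "m dvd \<phi> (S x + (\<Sum>i\<in>I. S i)) - \<phi> (S x) - \<phi> (\<Sum>i\<in>I. S i)"
    by (rule \<phi>_add[OF S(1) sub S(2) z]) simp_all
  from dvd_add[OF this dvd_add[OF IH S(3)[OF insertI1]]] show ?case
    using insert(1,2) by (simp add: algebra_simps)
qed (use \<phi>_empty in simp)

lemma minimal_signed_seq:
  assumes "finite I" "I \<subseteq> A" "lincomb I e = \<one>" "\<exists>x\<in>I. e x \<noteq> 0"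
    and min: "\<And>u. lincomb I u = \<one> \<Longrightarrow> conformal I u e \<Longrightarrow> (\<forall>x\<in>I. u x = 0) \<or> (\<forall>x\<in>I. u x = e x)"
  shows "minimal_zero_sum_seq G (signed_seq I e)" "set_mset (signed_seq I e) \<subseteq> A"
proof -
  have IG: "I \<subseteq> carrier G" using assms A_sub by auto
  show sub: "set_mset (signed_seq I e) \<subseteq> A" using set_signed_seq[OF assms(1), of e] assms inv_A by blast
  show "minimal_zero_sum_seq G (signed_seq I e)"
  proof (rule minimal_zero_sum_seqI)
    show "set_mset (signed_seq I e) \<subseteq> carrier G" using sub A_sub by auto
    have "size (signed_seq I e) \<noteq> 0" using assms(1,4) by (auto simp: size_signed_seq)
    then show "signed_seq I e \<noteq> {#}" by auto
    show "seq_sum G (signed_seq I e) = \<one>" using assms IG by (simp add: seq_sum_signed_seq)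
    fix T assume "T \<subseteq># signed_seq I e" and T: "seq_sum G T = \<one>"
    then obtain u where u: "conformal I u e" "T = signed_seq I u" using submset_signed_seq assms by blast
    then have "lincomb I u = \<one>" using T seq_sum_signed_seq assms IG by auto
    from min[OF this u(1)] show "T = {#} \<or> T = signed_seq I e"
    proof
      assume "\<forall>x\<in>I. u x = 0"
      then have "size T = 0" using u assms by (simp add: size_signed_seq)
      then show ?thesis by simp
    next
      assume "\<forall>x\<in>I. u x = e x"
      then show ?thesis using u signed_seq_cong by metis
    qed
  qed
qed

lemma length_lattice:
  assumes "finite I" "I \<subseteq> A"
  shows "length_lattice I (\<lambda>e. lincomb I e = \<one>) (\<lambda>e. \<phi> (signed_seq I e)) m"
proof
  have IG: "I \<subseteq> carrier G" using assms A_sub by auto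
  show "finite I" "1 < m" using assms m_gt_1 by auto
  show "lincomb I (\<lambda>_. 0) = \<one>" using lincomb_zero[OF IG] by simp
  show "lincomb I (\<lambda>i. e i - e' i) = \<one>" if "lincomb I e = \<one>" "lincomb I e' = \<one>" for e e'
    using that lincomb_diff[OF IG] by simp
  show "lincomb I e' = \<one>" if "lincomb I e = \<one>" "\<And>i. i \<in> I \<Longrightarrow> e i = e' i" for e e'
    using that lincomb_cong[OF IG] by metis
  show "m dvd \<phi> (signed_seq I e) - 1" if "lincomb I e = \<one>" "\<exists>i\<in>I. e i \<noteq> 0"
    "\<And>u. lincomb I u = \<one> \<Longrightarrow> conformal I u e \<Longrightarrow> (\<forall>i\<in>I. u i = 0) \<or> (\<forall>i\<in>I. u i = e i)" for e
    using \<phi>_minimal minimal_signed_seq[OF assms that] by blast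
  show "m dvd \<phi> (signed_seq I e) + \<phi> (signed_seq I e') - \<phi> (signed_seq I (\<lambda>i. e i + e' i)) -
      (\<Sum>i\<in>I. cancel (e i) (e' i))" if L: "lincomb I e = \<one>" "lincomb I e' = \<one>" for e e'
  proof -
    have sub: "set_mset (signed_seq I u) \<subseteq> A" for u using set_signed_seq[OF assms(1), of u] assms inv_A by blast
    have L': "lincomb I (\<lambda>i. e i + e' i) = \<one>" using L lincomb_add[OF IG] by simp
    \<comment> \<open>The pairs cancelled at \<open>x\<close>: a zero-sum sequence whose count is
      \<open>cancel (e x) (e' x)\<close> modulo \<open>m\<close>.\<close>
    define P where "P x = repeat_mset (nat (cancel (e x) (e' x))) {#x, inv x#}" for x
    have pair: "minimal_zero_sum_seq G {#x, inv x#}" "set_mset {#x, inv x#} \<subseteq> A" if "x \<in> I" for x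
      using minimal_zero_sum_seq_pair that IG one_notin_A assms inv_A by auto
    have "cancel a b \<ge> 0" for a b by (simp add: cancel_def)
    then have P: "m dvd \<phi> (P x) - cancel (e x) (e' x)" if "x \<in> I" for x
      using \<phi>_repeat[OF pair[OF that], of "nat (cancel (e x) (e' x))"] by (simp add: P_def)
    have Pz: "seq_sum G (P x) = \<one>" if "x \<in> I" for x
      unfolding P_def by (rule seq_sum_repeat) (rule minimal_zero_sum_seqD[OF pair(1)[OF that]])+
    have Psub: "set_mset (P x) \<subseteq> A" if "x \<in> I" for x
      unfolding P_def by (rule subset_trans[OF set_mset_repeat_subset pair(2)[OF that]])
    have 1: "m dvd \<phi> (\<Sum>x\<in>I. P x) - (\<Sum>x\<in>I. cancel (e x) (e' x))"
      by (rule \<phi>_sum[OF assms(1) Psub Pz P])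
    have "seq_sum G (\<Sum>x\<in>I. P x) = (\<Otimes>x\<in>I. seq_sum G (P x))"
      by (rule seq_sum_sum[OF assms(1) subset_trans[OF Psub A_sub]])
    also have "\<dots> = \<one>" by (rule finprod_one_eqI[OF Pz])
    finally have Ps: "seq_sum G (\<Sum>x\<in>I. P x) = \<one>" .
    have Pset: "set_mset (\<Sum>x\<in>I. P x) \<subseteq> A"
      unfolding set_mset_sum[OF assms(1)] by (rule UN_least[OF Psub])
    have 2: "m dvd \<phi> (signed_seq I (\<lambda>i. e i + e' i) + (\<Sum>x\<in>I. P x)) -
        \<phi> (signed_seq I (\<lambda>i. e i + e' i)) - \<phi> (\<Sum>x\<in>I. P x)"
      by (rule \<phi>_add[OF sub Pset _ Ps]) (use L' assms IG in \<open>simp add: seq_sum_signed_seq\<close>)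
    have 3: "m dvd \<phi> (signed_seq I e + signed_seq I e') - \<phi> (signed_seq I e) - \<phi> (signed_seq I e')"
      by (rule \<phi>_add[OF sub sub]) (use L assms IG in \<open>simp_all add: seq_sum_signed_seq\<close>)
    have "signed_seq I e + signed_seq I e' = signed_seq I (\<lambda>i. e i + e' i) + (\<Sum>x\<in>I. P x)"
      unfolding P_def by (rule signed_seq_add)
    from dvd_diff[OF dvd_add[OF 1 2] 3[unfolded this]] show ?thesis by (simp add: algebra_simps)
  qed
qed

end

section \<open>Minimal zero-sum sequences of maximal length\<close>

lemma submset_add:
  assumes "T \<subseteq># M + N"
  obtains T1 T2 where "T1 \<subseteq># M" "T2 \<subseteq># N" "T = T1 + T2"
proof
  show "T \<inter># M \<subseteq># M" by (simp add: subset_mset.inf.cobounded2)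
  show "T - M \<subseteq># N" using assms by (simp add: subset_eq_diff_conv add.commute)
  show "T = T \<inter># M + (T - M)" by (simp add: multiset_eq_iff min_def)
qed

lemma submset_single: "T \<subseteq># {#a#} \<Longrightarrow> T = {#} \<or> T = {#a#}"
  using msubseteq_replicate_msetE[of T 1 a] by (metis One_nat_def le_Suc_eq le_zero_eq
      replicate_mset_0 replicate_mset_Suc)

context comm_group
begin

lemma mult_inv_mult:
  assumes "a \<in> carrier G" "b \<in> carrier G" "c \<in> carrier G"
  shows "(a \<otimes> inv b) \<otimes> (b \<otimes> c) = a \<otimes> c"
  using assms m_assoc[of "inv b" b c] by (simp add: m_assoc)

lemma seq_sum_in_subgroup:
  assumes "subgroup Q G" "set_mset S \<subseteq> Q"
  shows "seq_sum G S \<in> Q"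
  using assms(2)
proof (induction S)
  case empty
  then show ?case using subgroup.one_closed[OF assms(1)] by simp
next
  case (add x S)
  then have "set_mset S \<subseteq> carrier G" "x \<in> carrier G" using subgroup.subset[OF assms(1)] by auto
  then show ?case using add subgroup.m_closed[OF assms(1)] by auto
qed

lemma seq_sum_square_in_subgroup:
  assumes "subgroup Q G" "set_mset S \<subseteq> carrier G" "\<And>x. x \<in># S \<Longrightarrow> x \<otimes> x \<in> Q"
  shows "seq_sum G S \<otimes> seq_sum G S \<in> Q"
  using assms(2,3)
proof (induction S)
  case empty
  then show ?case using subgroup.one_closed[OF assms(1)] by simp
next
  case (add x S)
  then have c: "x \<in> carrier G" "seq_sum G S \<in> carrier G" by auto
  have "seq_sum G (add_mset x S) \<otimes> seq_sum G (add_mset x S) = (x \<otimes> x) \<otimes> (seq_sum G S \<otimes> seq_sum G S)"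
    using add c by (simp add: m_ac)
  then show ?case using add subgroup.m_closed[OF assms(1)] by auto
qed

text \<open>Partial sums for some ordering of \<open>S\<close>. They turn the absence of zero-sum
  subsequences into distinctness, which is then used for counting.\<close>

lemma prefix_sums:
  assumes "set_mset S \<subseteq> carrier G"
  shows "\<exists>p. (\<forall>i\<le>size S. p i \<in> carrier G \<and> (\<exists>T. T \<subseteq># S \<and> p i = seq_sum G T)) \<and>
    (\<forall>i j. i < j \<and> j \<le> size S \<longrightarrow> (\<exists>T. T \<subseteq># S \<and> size T = j - i \<and> p j = p i \<otimes> seq_sum G T))"
proof -
  obtain xs where xs: "mset xs = S" using ex_mset by blast
  define p where "p i = seq_sum G (mset (take i xs))" for i
  have sub: "mset (take k (drop i xs)) \<subseteq># S" for i k
  proof -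
    have "mset xs = mset (take i xs) + (mset (take k (drop i xs)) + mset (drop k (drop i xs)))"
      by (metis append_take_drop_id mset_append)
    then show ?thesis using xs by (metis mset_subset_eq_add_left mset_subset_eq_add_right subset_mset.order_trans)
  qed
  have sub0: "mset (take i xs) \<subseteq># S" for i using sub[of i 0] by simp
  have carr: "set_mset T \<subseteq> carrier G" if "T \<subseteq># S" for T using that assms set_mset_mono by blast
  show ?thesis
  proof (intro exI[of _ p] conjI allI impI)
    fix i j assume "i < j \<and> j \<le> size S"
    then have "i < j" "j \<le> size S" by auto
    then have "take j xs = take i xs @ take (j - i) (drop i xs)"
      by (metis le_add_diff_inverse less_imp_le take_add)
    then have "p j = p i \<otimes> seq_sum G (mset (take (j - i) (drop i xs)))"
      unfolding p_def using seq_sum_add[OF carr[OF sub0] carr[OF sub]] by simp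
    moreover have "size (mset (take (j - i) (drop i xs))) = j - i"
      using \<open>j \<le> size S\<close> by (simp flip: xs)
    ultimately show "\<exists>T. T \<subseteq># S \<and> size T = j - i \<and> p j = p i \<otimes> seq_sum G T" using sub by blast
  next
    fix i
    show "p i \<in> carrier G" unfolding p_def by (rule seq_sum_closed[OF carr[OF sub0]])
    show "\<exists>T. T \<subseteq># S \<and> p i = seq_sum G T" unfolding p_def using sub0 by blast
  qed
qed

text \<open>The first \<open>size S\<close> partial sums are distinct. This bound makes the set in
  \<open>davenport_constant\<close> finite, so that its \<open>Max\<close> is meaningful.\<close>

lemma size_minimal_zero_sum_seq_le:
  assumes "finite (carrier G)" "minimal_zero_sum_seq G S"
  shows "size S \<le> order G"
proof -
  note S = minimal_zero_sum_seqD[OF assms(2)]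
  obtain p where p: "\<And>i. i \<le> size S \<Longrightarrow> p i \<in> carrier G"
    "\<And>i. i \<le> size S \<Longrightarrow> \<exists>T. T \<subseteq># S \<and> p i = seq_sum G T"
    "\<And>i j. i < j \<Longrightarrow> j \<le> size S \<Longrightarrow> \<exists>T. T \<subseteq># S \<and> size T = j - i \<and> p j = p i \<otimes> seq_sum G T"
    using prefix_sums[OF S(1)] by blast
  have neq: "p i \<noteq> p j" if ij: "i < j" "j < size S" for i j
  proof
    assume "p i = p j"
    obtain T where T: "T \<subseteq># S" "size T = j - i" "p j = p i \<otimes> seq_sum G T" using p(3)[of i j] ij by auto
    have "seq_sum G T \<in> carrier G" using T(1) S(1) set_mset_mono by (metis seq_sum_closed subset_trans)
    then have "seq_sum G T = \<one>" 
      using T(3) \<open>p i = p j\<close> p(1)[of i] ij l_cancel_one'[of "p i" "seq_sum G T"] by simp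
    from S(4)[OF T(1) this] show False using T(2) ij by auto
  qed
  have "inj_on p {..<size S}"
    by (rule inj_onI) (metis lessThan_iff linorder_neqE_nat neq)
  then have "card (p ` {..<size S}) = size S" by (simp add: card_image)
  moreover have "p ` {..<size S} \<subseteq> carrier G" using p(1) by auto
  ultimately show ?thesis using card_mono[OF assms(1)] unfolding order_def by metis
qed

lemma size_le_davenport_constant:
  assumes "finite (carrier G)" "minimal_zero_sum_seq G S"
  shows "size S \<le> davenport_constant G"
  unfolding davenport_constant_def
proof (rule Max_ge)
  have "{size S |S. minimal_zero_sum_seq G S} \<subseteq> {..order G}"
    using size_minimal_zero_sum_seq_le[OF assms(1)] by auto
  then show "finite {size S |S. minimal_zero_sum_seq G S}" using finite_subset by blast
qed (use assms in blast)

text \<open>A term \<open>g\<close> of a sequence over \<open>Q\<close> can be split into \<open>g - e\<close> and \<open>e\<close> for any \<open>e\<close> outside \<open>Q\<close>.\<close>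

lemma support_of_longest:
  assumes U: "minimal_zero_sum_seq G U" "\<And>S. minimal_zero_sum_seq G S \<Longrightarrow> size S \<le> size U"
    and Q: "subgroup Q G" "set_mset U \<subseteq> Q"
  shows "Q = carrier G"
proof (rule ccontr)
  assume "Q \<noteq> carrier G"
  then obtain e where e: "e \<in> carrier G" "e \<notin> Q" using subgroup.subset[OF Q(1)] by auto
  note D = minimal_zero_sum_seqD[OF U(1)]
  obtain g T where g: "U = add_mset g T" using D(2) multiset_cases by blast
  then have gT: "g \<in> carrier G" "g \<in> Q" "set_mset T \<subseteq> carrier G" "set_mset T \<subseteq> Q" using Q(2) D(1) by auto
  let ?U = "{#g \<otimes> inv e#} + ({#e#} + T)"
  have c: "seq_sum G V \<in> carrier G" "seq_sum G V \<in> Q" "set_mset V \<subseteq> carrier G" if "V \<subseteq># T" for V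
    using seq_sum_in_subgroup[OF Q(1), of V] gT subgroup.subset[OF Q(1)] set_mset_mono[OF that] by auto
  have "minimal_zero_sum_seq G ?U"
  proof (rule minimal_zero_sum_seqI)
    have gT1: "g \<otimes> seq_sum G T = \<one>" using D(3) g gT by simp
    have "seq_sum G ?U = (g \<otimes> inv e) \<otimes> (e \<otimes> seq_sum G T)"
      using e gT by (simp add: m_ac)
    also have "\<dots> = g \<otimes> seq_sum G T" using e gT by (intro mult_inv_mult) auto
    finally show "seq_sum G ?U = \<one>" using gT1 by simp
    fix V assume V: "V \<subseteq># ?U" "seq_sum G V = \<one>"
    obtain V1 V2 V3 where d: "V1 \<subseteq># {#g \<otimes> inv e#}" "V2 \<subseteq># {#e#}" "V3 \<subseteq># T" "V = V1 + (V2 + V3)"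
      using submset_add[OF V(1)] by (metis submset_add)
    note c3 = c[OF d(3)]
    \<comment> \<open>Using just one of the two new terms would put \<open>e\<close> into
      \<open>Q\<close>; using both amounts to using \<open>g\<close>, so the minimality of
      \<open>U\<close> applies.\<close>
    consider "V1 = {#}" "V2 = {#}" | "V1 = {#}" "V2 = {#e#}" | "V1 = {#g \<otimes> inv e#}" "V2 = {#}"
      | "V1 = {#g \<otimes> inv e#}" "V2 = {#e#}" using submset_single[OF d(1)] submset_single[OF d(2)] by blast
    then show "V = {#} \<or> V = ?U"
    proof cases
      case 1
      then have "V3 \<subseteq># U" "seq_sum G V3 = \<one>" using d g V(2) by (auto intro: subset_mset.order_trans)
      from D(4)[OF this] have "V3 = {#}" using d(3) g size_mset_mono[OF d(3)] by auto
      then show ?thesis using 1 d by simp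
    next
      case 2
      then have "e \<otimes> seq_sum G V3 = \<one>" using V(2) d c3 e by simp
      then have "e = inv (seq_sum G V3)" using inv_equality e c3 by metis
      then show ?thesis using e subgroup.m_inv_closed[OF Q(1)] c3 by auto
    next
      case 3
      then have "(g \<otimes> inv e) \<otimes> seq_sum G V3 = \<one>" using V(2) d c3 e gT by simp
      then have "inv e \<otimes> (g \<otimes> seq_sum G V3) = \<one>" using e gT c3 by (simp add: m_ac)
      then have "inv (inv e) = g \<otimes> seq_sum G V3" using e gT c3 by (metis inv_closed inv_equality m_closed m_comm)
      then show ?thesis using e gT c3 subgroup.m_closed[OF Q(1)] by auto
    next
      case 4
      then have "(g \<otimes> inv e) \<otimes> (e \<otimes> seq_sum G V3) = \<one>" using V(2) d c3 e gT by (simp add: m_ac)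
      also have "(g \<otimes> inv e) \<otimes> (e \<otimes> seq_sum G V3) = g \<otimes> seq_sum G V3"
        using e gT c3 by (intro mult_inv_mult) auto
      finally have "seq_sum G (add_mset g V3) = \<one>" using c3 gT by simp
      from D(4)[OF _ this] have "V3 = T" using d(3) g by auto
      then show ?thesis using 4 d by simp
    qed
  qed (use e gT in auto)
  from U(2)[OF this] show False using g by simp
qed

text \<open>If \<open>x [^] i\<close> is an involution, \<open>2 * i\<close> is an odd multiple of
  \<open>ord x\<close>; so two such exponents differ by a multiple of \<open>ord x\<close>.\<close>

lemma generate_square_eq_one:
  assumes "x \<in> carrier G" "a \<in> generate G {x}" "b \<in> generate G {x}"
    and "a \<otimes> a = \<one>" "b \<otimes> b = \<one>" "a \<noteq> \<one>" "b \<noteq> \<one>"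
  shows "a = b"
proof -
  obtain i j :: int where ij: "a = x [^] i" "b = x [^] j" using assms generate_pow[OF assms(1)] by auto
  have "x [^] (i + i) = \<one>" "x [^] (j + j) = \<one>"
    using assms ij int_pow_mult[OF assms(1), of i i] int_pow_mult[OF assms(1), of j j] by simp_all
  then obtain k l where kl: "i + i = int (ord x) * k" "j + j = int (ord x) * l"
    using int_pow_eq_id[OF assms(1)] by (metis dvdE)
  have "odd k"
  proof
    assume "even k"
    then obtain c where "k = 2 * c" by blast
    then have "i = int (ord x) * c" using kl by simp
    then show False using assms ij int_pow_eq_id[OF assms(1)] by simp
  qed
  moreover have "odd l"
  proof
    assume "even l"
    then obtain c where "l = 2 * c" by blast
    then have "j = int (ord x) * c" using kl by simp
    then show False using assms ij int_pow_eq_id[OF assms(1)] by simp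
  qed
  ultimately obtain c where "k - l = 2 * c" by (metis dvd_def even_diff odd_add)
  then have "2 * (i - j) = int (ord x) * (2 * c)" using kl by (metis mult_2 right_diff_distrib)
  then have "i - j = int (ord x) * c" by simp
  then have "x [^] (i - j) = \<one>" using int_pow_eq_id[OF assms(1)] by simp
  then show ?thesis using ij assms(1) 
    by (metis int_pow_closed int_pow_diff inv_equality inv_inv inv_closed)
qed

text \<open>The first \<open>size S\<close> partial sums and their translates by \<open>h\<close>
  are all distinct: a block with sum \<open>h\<close> would leave a zero-sum complement, so it would
  be all of \<open>S\<close>, but the blocks between these partial sums are shorter.\<close>

lemma size_zero_sum_free_le:
  assumes "finite (carrier G)" "x \<in> carrier G" "set_mset S \<subseteq> generate G {x}"
    and free: "\<And>T. T \<subseteq># S \<Longrightarrow> seq_sum G T = \<one> \<Longrightarrow> T = {#}"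
    and h: "h = seq_sum G S" "h \<otimes> h = \<one>" "h \<noteq> \<one>"
  shows "2 * size S \<le> ord x"
proof -
  have sg: "subgroup (generate G {x}) G" using generate_is_subgroup assms(2) by auto
  have H: "generate G {x} \<subseteq> carrier G" using subgroup.subset[OF sg] .
  obtain p where p: "\<And>i. i \<le> size S \<Longrightarrow> p i \<in> carrier G"
    "\<And>i. i \<le> size S \<Longrightarrow> \<exists>T. T \<subseteq># S \<and> p i = seq_sum G T"
    "\<And>i j. i < j \<Longrightarrow> j \<le> size S \<Longrightarrow> \<exists>T. T \<subseteq># S \<and> size T = j - i \<and> p j = p i \<otimes> seq_sum G T"
    using prefix_sums[OF subset_trans[OF assms(3) H]] by blast
  have carr: "seq_sum G T \<in> carrier G" "seq_sum G T \<in> generate G {x}" "set_mset T \<subseteq> carrier G" if "T \<subseteq># S" for T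
    using seq_sum_in_subgroup[OF sg, of T] set_mset_mono[OF that] assms(3) H by blast+
  have hc: "h \<in> carrier G" "h \<in> generate G {x}" using carr[of S] h by auto
  have pH: "p i \<in> generate G {x}" if "i \<le> size S" for i using p(2)[OF that] carr by auto
  have neq: "p i \<noteq> p j" "p i \<otimes> h \<noteq> p j" "p j \<otimes> h \<noteq> p i" if ij: "i < j" "j < size S" for i j
  proof -
    obtain T where T: "T \<subseteq># S" "size T = j - i" "p j = p i \<otimes> seq_sum G T" using p(3)[of i j] ij by auto
    have cc: "p i \<in> carrier G" "seq_sum G T \<in> carrier G" using p(1)[of i] ij carr[OF T(1)] by auto
    have ne1: "seq_sum G T \<noteq> \<one>" using free[OF T(1)] T(2) ij by auto
    have ne2: "seq_sum G T \<noteq> h"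
    proof
      assume "seq_sum G T = h"
      have S: "S = T + (S - T)" using T(1) by simp
      have TS: "S - T \<subseteq># S" by simp
      have "h = seq_sum G T \<otimes> seq_sum G (S - T)" 
        unfolding h(1) by (rule trans[OF arg_cong[OF S, of "seq_sum G"] seq_sum_add[OF carr(3)[OF T(1)] carr(3)[OF TS]]])
      then have "seq_sum G (S - T) = \<one>" using l_cancel_one'[OF hc(1) carr(1)[OF TS]] \<open>seq_sum G T = h\<close> by metis
      then have "S - T = {#}" using free[OF TS] by blast
      then have "T = S" using S by (metis add.right_neutral)
      then show False using T(2) ij by simp
    qed
    show "p i \<noteq> p j" using ne1 T(3) l_cancel_one'[OF cc] by metis
    show "p i \<otimes> h \<noteq> p j" using ne2 T(3) cc hc by simp
    show "p j \<otimes> h \<noteq> p i"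
    proof
      assume "p j \<otimes> h = p i"
      then have "p i \<otimes> (seq_sum G T \<otimes> h) = p i" using T(3) cc hc by (simp add: m_assoc)
      then have "seq_sum G T \<otimes> h = \<one>" using cc hc l_cancel_one[of "p i" "seq_sum G T \<otimes> h"] by simp
      then have "seq_sum G T \<otimes> h = h \<otimes> h" using h by simp
      then show False using ne2 cc hc r_cancel[of h "seq_sum G T" h] by simp
    qed
  qed
  let ?A = "p ` {..<size S}" and ?B = "(\<lambda>i. p i \<otimes> h) ` {..<size S}"
  have "inj_on p {..<size S}"
    by (rule inj_onI) (metis lessThan_iff linorder_neqE_nat neq(1))
  moreover have "inj_on (\<lambda>i. p i \<otimes> h) {..<size S}"
  proof (rule inj_onI)
    fix i j assume *: "i \<in> {..<size S}" "j \<in> {..<size S}" "p i \<otimes> h = p j \<otimes> h"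
    then have "p i = p j" using p(1)[of i] p(1)[of j] hc by (simp add: r_cancel)
    then show "i = j" using * by (metis lessThan_iff linorder_neqE_nat neq(1))
  qed
  moreover have "?A \<inter> ?B = {}"
  proof (rule ccontr)
    assume "?A \<inter> ?B \<noteq> {}"
    then obtain i j where ij: "i < size S" "j < size S" "p i = p j \<otimes> h" by auto
    have "i \<noteq> j" using ij p(1)[of i] hc h(3) l_cancel_one'[of "p i" h] by auto
    then show False using neq(2)[of j i] neq(3)[of i j] ij by (metis linorder_neqE_nat)
  qed
  ultimately have "card (?A \<union> ?B) = 2 * size S"
    by (subst card_Un_disjoint) (auto simp: card_image)
  moreover have "?A \<union> ?B \<subseteq> generate G {x}" using pH hc subgroup.m_closed[OF sg] by auto
  moreover have "finite (generate G {x})" using H assms(1) finite_subset by blast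
  moreover have "card (generate G {x}) = ord x" using generate_pow_card[OF assms(2)] by simp
  ultimately show ?thesis using card_mono by metis
qed

text \<open>
  Write \<open>U = U\<^sub>x R\<close> with \<open>U\<^sub>x\<close> the terms in \<open>\<langle>x\<rangle>\<close>. Both parts sum to the involution \<open>h\<close> of \<open>\<langle>x\<rangle>\<close>, so
  \<open>U\<^sub>x\<close> has length at most \<open>ord x / 2\<close>. Replacing \<open>U\<^sub>x\<close> by \<open>ord x - 1\<close> copies of \<open>x\<close> and adding
  \<open>x + h\<close> to one term of \<open>R\<close> gives a longer minimal zero-sum sequence.
\<close>

lemma longest_not_split:
  assumes fin: "finite (carrier G)"
    and U: "minimal_zero_sum_seq G U" "\<And>S. minimal_zero_sum_seq G S \<Longrightarrow> size S \<le> size U"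
    and x: "x \<in># U" "2 < ord x"
    and Q: "subgroup Q G" "generate G {x} \<inter> Q \<subseteq> {\<one>}"
    and split: "\<And>t. t \<in># U \<Longrightarrow> t \<in> generate G {x} \<or> t \<otimes> t \<in> Q"
    and y: "y \<in># U" "y \<notin> generate G {x}"
  shows False
proof -
  note D = minimal_zero_sum_seqD[OF U(1)]
  define H where "H = generate G {x}"
  define n where "n = ord x"
  have xc: "x \<in> carrier G" using x D(1) by auto
  have sg: "subgroup H G" unfolding H_def using generate_is_subgroup xc by auto
  have HG: "H \<subseteq> carrier G" using subgroup.subset[OF sg] .
  have xH: "x \<in> H" unfolding H_def by (rule generate.incl) simp
  define Ux where "Ux = filter_mset (\<lambda>t. t \<in> H) U"
  define R where "R = filter_mset (\<lambda>t. t \<notin> H) U"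
  have UxR: "U = Ux + R" by (simp add: Ux_def R_def)
  have cU: "set_mset Ux \<subseteq> carrier G" "set_mset R \<subseteq> carrier G" using D(1) by (auto simp: Ux_def R_def)
  have carr: "set_mset T \<subseteq> carrier G" "seq_sum G T \<in> carrier G" if "T \<subseteq># R" for T
    using set_mset_mono[OF that] cU(2) by (auto intro!: seq_sum_closed)
  have UxH: "set_mset Ux \<subseteq> H" by (auto simp: Ux_def)
  \<comment> \<open>Twice such a sum lies in both \<open>Q\<close> and \<open>H\<close>, which meet
    trivially.\<close>
  have sq: "seq_sum G T \<otimes> seq_sum G T = \<one>" if T: "T \<subseteq># R" "seq_sum G T \<in> H" for T
  proof -
    have "seq_sum G T \<otimes> seq_sum G T \<in> Q"
      by (rule seq_sum_square_in_subgroup[OF Q(1) carr(1)[OF T(1)]])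
        (use mset_subset_eqD[OF T(1)] split in \<open>auto simp: R_def H_def\<close>)
    then show ?thesis using Q(2) subgroup.m_closed[OF sg T(2) T(2)] by (auto simp: H_def)
  qed
  define h where "h = seq_sum G Ux"
  have hH: "h \<in> H" using seq_sum_in_subgroup[OF sg UxH] by (simp add: h_def)
  then have hc: "h \<in> carrier G" using HG by auto
  have "h \<otimes> seq_sum G R = \<one>" using D(3) UxR cU by (simp add: h_def)
  then have hR: "inv h = seq_sum G R" using hc carr(2)[of R] by (metis inv_comm inv_equality subset_mset.order_refl)
  then have RH: "seq_sum G R \<in> H" using subgroup.m_inv_closed[OF sg hH] by simp
  have hh: "h \<otimes> h = \<one>"
  proof -
    have "inv h \<otimes> inv h = \<one>" using sq[OF _ RH] hR by simp
    then have "inv (h \<otimes> h) = \<one>" using hc by (simp add: inv_mult_group)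
    then show ?thesis using hc by (metis inv_inv inv_one m_closed)
  qed
  then have sumR: "seq_sum G R = h" using hR hc by (metis inv_equality)
  have Rne: "R \<noteq> {#}" "R \<noteq> U" using y x xH by (auto simp: R_def H_def filter_mset_eq_conv)
  have h1: "h \<noteq> \<one>" using D(4)[of R] sumR Rne UxR by auto
  have two: "a = \<one> \<or> a = h" if "a \<in> H" "a \<otimes> a = \<one>" for a
    using generate_square_eq_one[OF xc, of a h] that hh h1 hH by (auto simp: H_def)
  \<comment> \<open>So a part of \<open>R\<close> whose sum lies in \<open>H\<close> sums to zero or
    to \<open>h\<close>; minimality of \<open>U\<close> then makes it empty or all of
    \<open>R\<close>.\<close>
  have R_sub: "seq_sum G T = \<one> \<or> seq_sum G T = h" if "T \<subseteq># R" "seq_sum G T \<in> H" for T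
    using two[OF that(2) sq[OF that]] .
  have R_one: "T = {#}" if "T \<subseteq># R" "seq_sum G T = \<one>" for T
  proof -
    have "T \<subseteq># U" using that(1) UxR by (metis mset_subset_eq_add_right subset_mset.order_trans)
    moreover have "T \<noteq> U" using size_mset_mono[OF that(1)] UxR Rne by auto
    ultimately show ?thesis using D(4) that(2) by blast
  qed
  have R_h: "T = R" if "T \<subseteq># R" "seq_sum G T = h" for T
  proof -
    have "seq_sum G (Ux + T) = \<one>" using that cU carr(1)[OF that(1)] hh by (simp add: h_def[symmetric])
    moreover have "Ux + T \<subseteq># U" using that(1) UxR by simp
    ultimately have "Ux + T = {#} \<or> Ux + T = U" using D(4) by blast
    then show ?thesis using that h1 UxR by auto
  qed
  have "2 * size Ux \<le> n" unfolding n_def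
  proof (rule size_zero_sum_free_le[OF fin xc UxH[unfolded H_def] _ h_def hh h1])
    fix T assume T: "T \<subseteq># Ux" "seq_sum G T = \<one>"
    have "T \<subseteq># U" using T(1) UxR by (metis mset_subset_eq_add_left subset_mset.order_trans)
    moreover have "T \<noteq> U" using size_mset_mono[OF T(1)] UxR Rne by auto
    ultimately show "T = {#}" using D(4) T(2) by blast
  qed
  obtain r R' where r: "R = add_mset r R'" using Rne(1) multiset_cases by blast
  then have rc: "r \<in> carrier G" "set_mset R' \<subseteq> carrier G" "R' \<subseteq># R" using cU by auto
  define s where "s = r \<otimes> (x \<otimes> h)"
  have sc: "s \<in> carrier G" using rc xc hc by (simp add: s_def)
  let ?U = "{#s#} + (replicate_mset (n - 1) x + R')"
  have npos: "n > 2" using x by (simp add: n_def)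
  have xpow: "x [^] c \<in> H" "x [^] c \<in> carrier G" for c :: nat
    using xH xc HG subgroup.m_closed[OF sg] subgroup.one_closed[OF sg] by (induction c) auto
  \<comment> \<open>The term \<open>s\<close> carries one further copy of \<open>x\<close>, hence
    the exponent \<open>Suc c\<close>.\<close>
  have s_sum: "seq_sum G (add_mset s (replicate_mset c x + V)) = x [^] Suc c \<otimes> (seq_sum G (add_mset r V) \<otimes> h)"
    if "V \<subseteq># R'" for c V
  proof -
    have "set_mset V \<subseteq> carrier G" using set_mset_mono[OF that] rc by auto
    moreover from this have "seq_sum G V \<in> carrier G" by simp
    ultimately show ?thesis using rc xc hc xpow sc unfolding s_def by (simp add: m_ac)
  qed
  have "minimal_zero_sum_seq G ?U"
  proof (rule minimal_zero_sum_seqI)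
    show "set_mset ?U \<subseteq> carrier G" using sc xc rc by (auto split: if_splits)
    have "x [^] n = \<one>" using xc pow_ord_eq_1 by (simp add: n_def)
    then show "seq_sum G ?U = \<one>" using s_sum[of R' "n - 1"] npos r sumR hh by simp
    fix T assume T: "T \<subseteq># ?U" "seq_sum G T = \<one>"
    obtain T1 T2 V where d: "T1 \<subseteq># {#s#}" "T2 \<subseteq># replicate_mset (n - 1) x" "V \<subseteq># R'" "T = T1 + (T2 + V)"
      using submset_add[OF T(1)] by (metis submset_add)
    obtain c where c: "c \<le> n - 1" "T2 = replicate_mset c x" using msubseteq_replicate_msetE[OF d(2)] by metis
    have VR: "V \<subseteq># R" using d(3) rc(3) by (rule subset_mset.order_trans)
    note Vc = carr[OF VR]
    from submset_single[OF d(1)] show "T = {#} \<or> T = ?U"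
    proof
      assume "T1 = {#}"
      then have e: "x [^] c \<otimes> seq_sum G V = \<one>" using T(2) d c Vc xc by (auto split: if_splits)
      then have "inv (x [^] c) = seq_sum G V" using xpow Vc by (metis inv_comm inv_equality)
      then have VH: "seq_sum G V \<in> H" using subgroup.m_inv_closed[OF sg xpow(1)] by metis
      have "V \<noteq> R" using d(3) r size_mset_mono[OF d(3)] by auto
      then have V1: "V = {#}" using R_sub[OF VR VH] R_h[OF VR] R_one[OF VR] by auto
      then have "x [^] c = \<one>" using e xpow by simp
      then have "n dvd c" using pow_eq_id xc by (simp add: n_def)
      then have "c = 0" using c(1) npos dvd_imp_le[of n c] by (cases "c = 0") auto
      then show ?thesis using V1 d c \<open>T1 = {#}\<close> by simp
    next
      assume T1: "T1 = {#s#}"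
      have rV: "add_mset r V \<subseteq># R" using d(3) r by simp
      note rVc = carr[OF rV]
      have e: "x [^] Suc c \<otimes> (seq_sum G (add_mset r V) \<otimes> h) = \<one>" using s_sum[OF d(3), of c] T(2) d(4) c T1 by simp
      then have "x [^] Suc c \<otimes> h \<otimes> seq_sum G (add_mset r V) = \<one>" using xpow hc rVc by (simp only: m_ac m_closed)
      moreover have "x [^] Suc c \<otimes> h \<in> H" using subgroup.m_closed[OF sg xpow(1) hH] .
      ultimately have "inv (x [^] Suc c \<otimes> h) = seq_sum G (add_mset r V)" using HG rVc
        by (metis inv_comm inv_equality subsetD)
      then have VH: "seq_sum G (add_mset r V) \<in> H"
        using subgroup.m_inv_closed[OF sg \<open>x [^] Suc c \<otimes> h \<in> H\<close>] by metis
      have V1: "add_mset r V = R" using R_sub[OF rV VH] R_h[OF rV] R_one[OF rV] by auto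
      then have "x [^] Suc c = \<one>" using e sumR hh xpow[of "Suc c"] by (simp only: r_one)
      then have "n dvd Suc c" using pow_eq_id xc n_def by metis
      then have "c = n - 1" using c(1) npos dvd_imp_le[of n "Suc c"] by auto
      then show ?thesis using V1 d c T1 r by simp
    qed
  qed simp
  from U(2)[OF this] have "size ?U \<le> size Ux + size R" using UxR by simp
  \<comment> \<open>Together with \<open>2 * size Ux <= n\<close> this is impossible for
    \<open>n > 2\<close>.\<close>
  then have "n - 1 \<le> size Ux" using r by simp
  then show False using \<open>2 * size Ux \<le> n\<close> npos by linarith
qed

end

section \<open>Relations modulo an independent family\<close>

lemma balanced_residue:
  fixes n a :: int
  assumes "0 < n"
  shows "\<exists>c. n dvd a - c \<and> 2 * \<bar>c\<bar> \<le> n"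
proof (cases "2 * (a mod n) \<le> n")
  case True
  then show ?thesis using assms by (intro exI[of _ "a mod n"]) (simp add: minus_mod_eq_mult_div)
next
  case False
  have "n dvd (a - a mod n) + n" by (simp add: minus_mod_eq_mult_div)
  then have "n dvd a - (a mod n - n)" by (simp add: algebra_simps)
  moreover have "a mod n < n" using assms by simp
  ultimately show ?thesis using False by (intro exI[of _ "a mod n - n"]) simp
qed

context comm_group
begin

section \<open>Independence and spans\<close>

definition span :: "'a set \<Rightarrow> 'a set"
  where "span F = range (lincomb F)"

text \<open>The span is the direct sum of the cyclic groups generated by the members; an exponent
  counts only modulo the order of its term.\<close>

definition independent :: "'a set \<Rightarrow> bool"
  where "independent F \<longleftrightarrow> (\<forall>e. lincomb F e = \<one> \<longrightarrow> (\<forall>x\<in>F. x [^] e x = \<one>))"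

lemma independentD: "independent F \<Longrightarrow> lincomb F e = \<one> \<Longrightarrow> x \<in> F \<Longrightarrow> x [^] e x = \<one>"
  unfolding independent_def by blast

lemma subgroup_span:
  assumes "F \<subseteq> carrier G"
  shows "subgroup (span F) G"
proof (rule subgroupI)
  show "span F \<subseteq> carrier G" using assms by (auto simp: span_def)
  show "span F \<noteq> {}" by (auto simp: span_def)
  show "inv a \<in> span F" if "a \<in> span F" for a
    using that unfolding span_def by (auto simp flip: lincomb_uminus[OF assms])
  show "a \<otimes> b \<in> span F" if "a \<in> span F" "b \<in> span F" for a b
    using that unfolding span_def by (auto simp flip: lincomb_add[OF assms])
qed

lemma span_incl: "finite F \<Longrightarrow> F \<subseteq> carrier G \<Longrightarrow> x \<in> F \<Longrightarrow> x \<in> span F"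
  using lincomb_spike[of F x 1] by (auto simp: span_def image_iff) (metis int_pow_1 subsetD)

lemma int_pow_in_subgroup: "subgroup Q G \<Longrightarrow> x \<in> Q \<Longrightarrow> x [^] (k::int) \<in> Q"
  using subgroup_int_pow_closed by blast

lemma int_pow_mult_eq_one:
  assumes "x \<in> carrier G" "x [^] (a::int) = \<one>"
  shows "x [^] (a * b) = \<one>"
  using assms by (metis int_pow_one int_pow_pow)

lemma lincomb_balanced:
  assumes "finite (carrier G)" "F \<subseteq> carrier G"
  shows "\<exists>c. lincomb F c = lincomb F a \<and>
    (\<forall>x\<in>F. int (ord x) dvd a x - c x \<and> 2 * \<bar>c x\<bar> \<le> int (ord x))"
proof -
  have "\<exists>c. x \<in> F \<longrightarrow> int (ord x) dvd a x - c \<and> 2 * \<bar>c\<bar> \<le> int (ord x)" for x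
    using balanced_residue[of "int (ord x)" "a x"] ord_ge_1[OF assms(1), of x] assms(2) by auto
  then obtain c where c: "\<And>x. x \<in> F \<Longrightarrow> int (ord x) dvd a x - c x \<and> 2 * \<bar>c x\<bar> \<le> int (ord x)" by metis
  have "lincomb F c = lincomb F a"
    unfolding lincomb_def
  proof (rule finprod_cong'[OF refl])
    fix x assume x: "x \<in> F"
    then have "x [^] (a x - c x) = \<one>" using c int_pow_eq_id assms(2) by blast
    then have "x [^] a x \<otimes> inv (x [^] c x) = \<one>" using x assms(2) by (simp add: int_pow_diff subset_iff)
    then show "x [^] c x = x [^] a x"
      using x assms(2) by (metis int_pow_closed inv_closed inv_equality inv_inv subsetD)
  qed (use assms in auto)
  then show ?thesis using c by blast
qed

lemma independent_insert:
  assumes "finite F" "insert y F \<subseteq> carrier G" "y \<notin> F" "independent F"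
    and "\<And>k::int. y [^] k \<in> span F \<Longrightarrow> y [^] k = \<one>"
  shows "independent (insert y F)"
  unfolding independent_def
proof (intro allI impI)
  fix u assume u: "lincomb (insert y F) u = \<one>"
  have c: "y [^] u y \<in> carrier G" "lincomb F u \<in> carrier G" "F \<subseteq> carrier G" using assms by auto
  have yu: "y [^] u y \<otimes> lincomb F u = \<one>" using u lincomb_insert[OF assms(1,3,2)] by simp
  then have "y [^] u y = inv (lincomb F u)" using c inv_equality by metis
  also have "\<dots> \<in> span F" by (rule subgroup.m_inv_closed[OF subgroup_span[OF c(3)]]) (simp add: span_def)
  finally have "y [^] u y = \<one>" by (rule assms(5))
  moreover from this have "lincomb F u = \<one>" using yu c by simp
  ultimately show "\<forall>x\<in>insert y F. x [^] u x = \<one>" using independentD[OF assms(4)] by auto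
qed

lemma span_mono:
  assumes "finite F" "F \<subseteq> carrier G" "E \<subseteq> F"
  shows "span E \<subseteq> span F"
proof
  fix a assume "a \<in> span E"
  then obtain e where e: "a = lincomb E e" by (auto simp: span_def)
  then have "a = lincomb F (\<lambda>x. if x \<in> E then e x else 0)" using lincomb_subset[OF assms] by simp
  then show "a \<in> span F" unfolding span_def by blast
qed

lemma independent_subset:
  assumes "finite F" "F \<subseteq> carrier G" "E \<subseteq> F" "independent F"
  shows "independent E"
  unfolding independent_def
proof (intro allI impI ballI)
  fix e x assume e: "lincomb E e = \<one>" "x \<in> E"
  then have "lincomb F (\<lambda>x. if x \<in> E then e x else 0) = \<one>" using lincomb_subset[OF assms(1-3)] by simp
  from independentD[OF assms(4) this, of x] e(2) assms(3) show "x [^] e x = \<one>" by auto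
qed

text \<open>Subtracting the two expressions for \<open>a\<close> leaves a relation on
  \<open>F\<close>. This form serves both \<open>independent\<close> and
  \<open>independent_mod\<close>.\<close>

lemma generate_inter_span_relation:
  assumes "finite F" "F \<subseteq> carrier G" "x \<in> F" "a \<in> generate G {x}" "a \<in> span (F - {x})"
  shows "\<exists>e. lincomb F e = \<one> \<and> a = x [^] (- e x)"
proof -
  obtain k e where a: "a = x [^] (k::int)" "a = lincomb (F - {x}) e"
    using generate_pow[of x] assms by (auto simp: span_def)
  have xF: "insert x (F - {x}) = F" using assms(3) by auto
  define u where "u = e(x := - k)"
  have c: "x \<in> carrier G" "F - {x} \<subseteq> carrier G" using assms by auto
  have "lincomb F u = x [^] (- k) \<otimes> lincomb (F - {x}) u"
    using lincomb_insert[of "F - {x}" x u] xF assms c by (simp add: u_def)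
  also have "lincomb (F - {x}) u = a" unfolding a(2) by (rule lincomb_cong) (use c in \<open>auto simp: u_def\<close>)
  finally have "lincomb F u = \<one>" using a(1) c by (simp add: int_pow_neg)
  then show ?thesis using a(1) by (intro exI[of _ u]) (simp add: u_def)
qed

lemma generate_inter_span:
  assumes "finite F" "F \<subseteq> carrier G" "independent F" "x \<in> F"
  shows "generate G {x} \<inter> span (F - {x}) \<subseteq> {\<one>}"
proof
  fix a assume "a \<in> generate G {x} \<inter> span (F - {x})"
  then obtain e where e: "lincomb F e = \<one>" "a = x [^] (- e x)"
    using generate_inter_span_relation[OF assms(1,2,4)] by blast
  from independentD[OF assms(3) e(1) assms(4)] show "a \<in> {\<one>}"
    using e(2) assms by (auto simp: int_pow_neg subset_iff)
qed

end

context length_mod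
begin

lemma spike_minimal:
  assumes "finite I" "I \<subseteq> A" "x \<in> I" "finite (carrier G)"
    and "\<And>u. lincomb I u = \<one> \<Longrightarrow> (\<And>z. z \<in> I \<Longrightarrow> z \<noteq> x \<Longrightarrow> u z = 0) \<Longrightarrow> int (ord x) dvd u x"
  shows "length_lattice.minimal I (\<lambda>e. lincomb I e = \<one>) (spike x (int (ord x)))"
proof -
  interpret length_lattice I "\<lambda>e. lincomb I e = \<one>" "\<lambda>e. \<phi> (signed_seq I e)" m
    by (rule length_lattice[OF assms(1,2)])
  have xc: "x \<in> carrier G" "I \<subseteq> carrier G" using assms A_sub by auto
  show ?thesis
  proof (rule minimal_spike[OF assms(3)])
    show "0 < int (ord x)" using ord_ge_1[OF assms(4) xc(1)] by simp
    show "lincomb I (spike x (int (ord x))) = \<one>"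
      using lincomb_spike[OF assms(1,3) xc(2)] int_pow_eq_id[OF xc(1)] by simp
  qed (use assms(5) in blast)
qed

lemma ord_mod:
  assumes "x \<in> A" "finite (carrier G)"
  shows "m dvd int (ord x) - 2"
proof -
  interpret length_lattice "{x}" "\<lambda>e. lincomb {x} e = \<one>" "\<lambda>e. \<phi> (signed_seq {x} e)" m
    by (rule length_lattice) (use assms in auto)
  have xc: "x \<in> carrier G" using assms A_sub by auto
  have "lincomb {x} u = x [^] u x" for u using lincomb_insert[of "{}" x u] xc by (simp add: lincomb_def)
  then have "minimal (spike x (int (ord x)))"
    by (intro spike_minimal) (use assms int_pow_eq_id[OF xc] in auto)
  from f_uminus[OF this] show ?thesis by (simp add: dvd_diff_commute)
qed

text \<open>The group version of \<open>order_relation\<close>. The last clause says that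
  \<open>x [^] e x\<close> and \<open>y [^] N\<close> have the same order: for a single
  \<open>x\<close> they are inverse to each other, otherwise all of them are involutions.\<close>

lemma relation_mod_span:
  assumes fin: "finite F" "finite (carrier G)" and F: "F \<subseteq> A" "independent F" and y: "y \<in> A" "y \<notin> F"
  shows "\<exists>(N::int) e. 0 < N \<and> (\<forall>k::int. y [^] k \<in> span F \<longleftrightarrow> N dvd k) \<and>
    lincomb (insert y F) e = \<one> \<and> e y = N \<and>
    ((\<forall>x\<in>F. e x = 0) \<or>
      (m dvd N - 1 \<and> ((\<exists>x\<in>F. \<forall>z\<in>F - {x}. e z = 0) \<or> (\<forall>x\<in>F. x [^] (2 * e x) = \<one>)) \<and>
       (\<forall>x\<in>F. e x \<noteq> 0 \<longrightarrow> (\<forall>k. x [^] (e x * k) = \<one> \<longleftrightarrow> y [^] (N * k) = \<one>))))"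
proof -
  have FG: "F \<subseteq> carrier G" "y \<in> carrier G" "insert y F \<subseteq> carrier G" using F y A_sub by auto
  have sg: "subgroup (span F) G" using subgroup_span[OF FG(1)] .
  have ordpos: "0 < int (ord x)" if "x \<in> carrier G" for x using ord_ge_1[OF fin(2) that] by simp
  have sp: "lincomb (insert y F) u = y [^] u y \<otimes> lincomb F u" for u
    using lincomb_insert[OF fin(1) y(2) FG(3)] .
  \<comment> \<open>\<open>N\<close> generates the subgroup of exponents that take \<open>y\<close>
    into the span; it is nonzero because \<open>ord y\<close> is such an exponent.\<close>
  have "\<exists>d\<ge>0. \<forall>k. k \<in> {k::int. y [^] k \<in> span F} \<longleftrightarrow> d dvd k"
  proof (rule int_subgroup_cyclic)
    show "0 \<in> {k::int. y [^] k \<in> span F}" using subgroup.one_closed[OF sg] by simp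
    show "a - b \<in> {k::int. y [^] k \<in> span F}"
      if "a \<in> {k::int. y [^] k \<in> span F}" "b \<in> {k::int. y [^] k \<in> span F}" for a b
      using that FG(2) subgroup.m_closed[OF sg] subgroup.m_inv_closed[OF sg] by (simp add: int_pow_diff)
  qed
  then obtain N where N0: "0 \<le> N" and N: "\<And>k::int. y [^] k \<in> span F \<longleftrightarrow> N dvd k" by auto
  have "y [^] int (ord y) \<in> span F"
    using subgroup.one_closed[OF sg] pow_ord_eq_1[OF FG(2)] by (simp only: int_pow_int)
  then have "N dvd int (ord y)" using N by blast
  then have Npos: "0 < N" using N0 ordpos[OF FG(2)] by (cases "N = 0") auto
  have span_iff: "y [^] u y \<in> span F" if "lincomb (insert y F) u = \<one>" for u
  proof -
    have "y [^] u y = inv (lincomb F u)"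
      using that sp[of u] inv_equality FG by (metis int_pow_closed lincomb_closed)
    also have "\<dots> \<in> span F" by (rule subgroup.m_inv_closed[OF sg]) (simp add: span_def)
    finally show ?thesis .
  qed
  have "y [^] N \<in> span F" using N by simp
  then have "inv (y [^] N) \<in> span F" using subgroup.m_inv_closed[OF sg] by blast
  then obtain a where a: "lincomb F a = inv (y [^] N)" by (auto simp: span_def)
  \<comment> \<open>Balanced exponents supply the bound by half the order that
    \<open>order_relation\<close> requires.\<close>
  obtain c where c: "lincomb F c = lincomb F a"
    "\<And>x. x \<in> F \<Longrightarrow> int (ord x) dvd a x - c x \<and> 2 * \<bar>c x\<bar> \<le> int (ord x)"
    using lincomb_balanced[OF fin(2) FG(1), of a] by blast
  define e where "e = c(y := N)"
  have ey: "e y = N" by (simp add: e_def)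
  have eF: "e x = c x" if "x \<in> F" for x using that y by (auto simp: e_def)
  have "lincomb F e = lincomb F a"
    unfolding c(1)[symmetric] by (rule lincomb_cong[OF FG(1)]) (rule eF)
  then have e1: "lincomb (insert y F) e = \<one>" using sp[of e] ey a FG by simp
  have indep: "int (ord x) dvd u x" if "lincomb F u = \<one>" "x \<in> F" for u x
    using independentD[OF F(2) that] int_pow_eq_id FG that by blast
  interpret length_lattice "insert y F" "\<lambda>e. lincomb (insert y F) e = \<one>" "\<lambda>e. \<phi> (signed_seq (insert y F) e)" m
    by (rule length_lattice) (use fin F y in auto)
  define K where "K = {x \<in> F. e x \<noteq> 0}"
  have main: "K = {} \<or> (m dvd N - 1 \<and> (card K = 1 \<or> (\<forall>x\<in>K. 2 * \<bar>e x\<bar> = int (ord x))))"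
  proof (rule order_relation[of y F "\<lambda>x. int (ord x)"])
    show "lincomb (insert y F) (spike x (int (ord x))) = \<one>" if "x \<in> F" for x
      using lincomb_spike[of "insert y F" x] int_pow_eq_id that fin FG by auto
    show "int (ord x) dvd u x" if "lincomb (insert y F) u = \<one>" "u y = 0" "x \<in> F" for u x
      using indep[of u x] that sp[of u] FG by simp
    show "N dvd u y" if "lincomb (insert y F) u = \<one>" for u using span_iff[OF that] N by blast
    show "2 * \<bar>e x\<bar> \<le> int (ord x)" if "x \<in> F" for x using c(2)[OF that] eF[OF that] by simp
  qed (use y Npos e1 ey ordpos FG K_def in auto)
  show ?thesis
  proof (intro exI[of _ N] exI[of _ e] conjI Npos allI N e1 ey)
    show "(\<forall>x\<in>F. e x = 0) \<or>
      (m dvd N - 1 \<and> ((\<exists>x\<in>F. \<forall>z\<in>F - {x}. e z = 0) \<or> (\<forall>x\<in>F. x [^] (2 * e x) = \<one>)) \<and>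
       (\<forall>x\<in>F. e x \<noteq> 0 \<longrightarrow> (\<forall>k. x [^] (e x * k) = \<one> \<longleftrightarrow> y [^] (N * k) = \<one>)))"
    proof (cases "K = {}")
      case True
      then show ?thesis by (auto simp: K_def)
    next
      case False
      have rel: "y [^] (N * k) = \<one> \<longleftrightarrow> (\<forall>z\<in>K. z [^] (e z * k) = \<one>)" for k
      proof -
        have "lincomb (insert y F) (\<lambda>z. k * e z) = \<one>" using lincomb_mult[of "insert y F" k e] e1 fin FG
          by (simp add: int_pow_one)
        then have ke: "y [^] (N * k) \<otimes> lincomb F (\<lambda>z. k * e z) = \<one>" using sp ey by (simp add: mult.commute)
        have KF: "lincomb F (\<lambda>z. k * e z) = lincomb K (\<lambda>z. k * e z)"
          by (rule lincomb_mono_neutral) (use fin FG K_def in auto)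
        show ?thesis
        proof
          assume "y [^] (N * k) = \<one>"
          then have "lincomb F (\<lambda>z. k * e z) = \<one>" using ke FG by simp
          from independentD[OF F(2) this] show "\<forall>z\<in>K. z [^] (e z * k) = \<one>"
            by (auto simp: K_def mult.commute)
        next
          assume "\<forall>z\<in>K. z [^] (e z * k) = \<one>"
          then have "lincomb K (\<lambda>z. k * e z) = \<one>"
            unfolding lincomb_def by (intro finprod_one_eqI) (simp add: mult.commute)
          then show "y [^] (N * k) = \<one>" using ke KF FG by simp
        qed
      qed
      from main False have m1: "m dvd N - 1" and "card K = 1 \<or> (\<forall>x\<in>K. 2 * \<bar>e x\<bar> = int (ord x))" by auto
      from this(2) show ?thesis
      proof
        assume "card K = 1"
        then obtain x where x: "K = {x}" by (meson card_1_singletonE)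
        then have "x \<in> F" "\<forall>z\<in>F - {x}. e z = 0" by (auto simp: K_def)
        moreover have "\<forall>z\<in>F. e z \<noteq> 0 \<longrightarrow> (\<forall>k. z [^] (e z * k) = \<one> \<longleftrightarrow> y [^] (N * k) = \<one>)"
        proof (intro ballI impI allI)
          fix z k assume "z \<in> F" "e z \<noteq> 0"
          then have "z = x" using x by (auto simp: K_def)
          then show "z [^] (e z * k) = \<one> \<longleftrightarrow> y [^] (N * k) = \<one>" using rel[of k] x by simp
        qed
        ultimately show ?thesis using m1 by blast
      next
        assume half: "\<forall>x\<in>K. 2 * \<bar>e x\<bar> = int (ord x)"
        \<comment> \<open>A half-order exponent makes \<open>x [^] e x\<close> an involution, so
          only the parity of \<open>k\<close> matters.\<close>
        have iff: "x [^] (e x * k) = \<one> \<longleftrightarrow> even k" if "x \<in> K" for x k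
        proof -
          have xc: "x \<in> carrier G" using that FG by (auto simp: K_def)
          have "int (ord x) dvd e x * k \<longleftrightarrow> 2 * \<bar>e x\<bar> dvd \<bar>e x\<bar> * k"
            using half that by (simp add: dvd_abs_iff[of _ "e x * k", symmetric] abs_mult del: dvd_abs_iff)
              (simp add: dvd_abs_iff[of _ "\<bar>e x\<bar> * k", symmetric] abs_mult del: dvd_abs_iff)
          also have "\<dots> \<longleftrightarrow> even k" using that by (simp add: K_def mult.commute[of 2])
          finally show ?thesis using int_pow_eq_id[OF xc] by simp
        qed
        have "x [^] (2 * e x) = \<one>" if "x \<in> F" for x
          using iff[of x 2] that by (cases "e x = 0") (auto simp: K_def mult.commute)
        moreover have "\<forall>x\<in>F. e x \<noteq> 0 \<longrightarrow> (\<forall>k. x [^] (e x * k) = \<one> \<longleftrightarrow> y [^] (N * k) = \<one>)"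
          using iff rel False by (auto simp: K_def)
        ultimately show ?thesis using m1 by blast
      qed
    qed
  qed
qed

end

section \<open>Terms of a longest sequence relative to an independent family\<close>

locale longest_length_mod = length_mod +
  fixes U :: "'a multiset"
  assumes finite_G: "finite (carrier G)"
    and U_minimal: "minimal_zero_sum_seq G U"
    and U_longest: "\<And>S. minimal_zero_sum_seq G S \<Longrightarrow> size S \<le> size U"
    and U_A: "set_mset U \<subseteq> A"
    and not_cyclic: "\<not> cyclic_group G"
begin

lemma U_G: "set_mset U \<subseteq> carrier G"
  using U_A A_sub by auto

lemma ord_gt_1: "x \<in># U \<Longrightarrow> 1 < ord x"
  using ord_ge_1[OF finite_G, of x] ord_eq_1[of x] U_A A_sub one_notin_A
  by (metis le_neq_implies_less subsetD)

text \<open>The terms of \<open>U\<close> generate the group, which is not cyclic.\<close>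

lemma escape_generate:
  assumes "x \<in> carrier G"
  obtains y where "y \<in># U" "y \<notin> generate G {x}"
proof -
  have "\<not> set_mset U \<subseteq> generate G {x}"
  proof
    assume "set_mset U \<subseteq> generate G {x}"
    then have "generate G {x} = carrier G"
      using support_of_longest[OF U_minimal U_longest] generate_is_subgroup assms by auto
    then have "carrier G = range (\<lambda>n::int. x [^] n)" 
      using generate_pow[OF assms] by (simp add: full_SetCompr_eq)
    then show False using not_cyclic cyclic_group assms by blast
  qed
  then show ?thesis using that by blast
qed

lemma split_False:
  assumes "x \<in># U" "2 < ord x" "subgroup Q G" "generate G {x} \<inter> Q \<subseteq> {\<one>}"
    and "\<And>t. t \<in># U \<Longrightarrow> t \<in> generate G {x} \<or> t \<otimes> t \<in> Q"
  shows False
proof -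
  obtain y where "y \<in># U" "y \<notin> generate G {x}" using escape_generate assms(1) U_G by blast
  then show False using longest_not_split[OF finite_G U_minimal U_longest] assms by blast
qed

text \<open>All terms have order 1 modulo the span, so each one lies on a line of \<open>F\<close>
  or has a trivial double. Thus \<open>U\<close> splits along a member \<open>x\<close> of order
  above 2, with the span of the other members as \<open>Q\<close>.\<close>

lemma independent_not_generating:
  assumes F: "F \<subseteq> set_mset U" "independent F"
    and gen: "\<And>y. y \<in># U \<Longrightarrow> y \<in> span F"
    and big: "\<exists>y\<in>#U. 2 < ord y"
  shows False
proof -
  have fin: "finite F" using F(1) finite_subset by blast
  have FG: "F \<subseteq> carrier G" "F \<subseteq> A" using F U_G U_A by auto
  \<comment> \<open>Otherwise doubling would kill the span, which contains a term of order above
    2.\<close>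
  have "\<exists>x\<in>F. 2 < ord x"
  proof (rule ccontr)
    assume small: "\<not> ?thesis"
    obtain y where y: "y \<in># U" "2 < ord y" using big by blast
    then obtain e where e: "y = lincomb F e" using gen by (auto simp: span_def)
    have "x [^] (2 * e x) = \<one>" if "x \<in> F" for x
    proof -
      have "ord x = 2" using ord_gt_1[of x] small that F by fastforce
      then show ?thesis using int_pow_eq_id[of x] that FG by auto
    qed
    then have "lincomb F (\<lambda>x. 2 * e x) = \<one>" unfolding lincomb_def by (rule finprod_one_eqI)
    then have "y [^] (2::int) = \<one>" using lincomb_mult[OF FG(1) fin, of 2 e] e by simp
    then have "int (ord y) dvd 2" using int_pow_eq_id y U_G by blast
    then show False using y(2) zdvd_imp_le[of "int (ord y)" 2] by simp
  qed
  then obtain x where x: "x \<in> F" "2 < ord x" by blast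
  have xc: "x \<in> carrier G" "F - {x} \<subseteq> carrier G" "finite (F - {x})" using x FG fin by auto
  have sg: "subgroup (span (F - {x})) G" using subgroup_span xc by blast
  have incl: "z \<in> span (F - {x})" if "z \<in> F" "z \<noteq> x" for z
    using span_incl[OF xc(3,2)] that by blast
  show False
  proof (rule split_False[OF _ x(2) sg generate_inter_span[OF fin FG(1) F(2) x(1)]])
    show "x \<in># U" using x F by auto
    fix t assume t: "t \<in># U"
    show "t \<in> generate G {x} \<or> t \<otimes> t \<in> span (F - {x})"
    proof (cases "t \<in> F")
      case True
      then show ?thesis
        using incl subgroup.m_closed[OF sg] generate.incl[of x "{x}" G] by (cases "t = x") auto
    next
      case False
      have tA: "t \<in> A" "t \<in> carrier G" using t U_A U_G by auto
      obtain N :: int and e where r: "0 < N" "\<And>k::int. t [^] k \<in> span F \<longleftrightarrow> N dvd k"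
        "lincomb (insert t F) e = \<one>" "e t = N"
        "(\<forall>x\<in>F. e x = 0) \<or>
          (m dvd N - 1 \<and> ((\<exists>x\<in>F. \<forall>z\<in>F - {x}. e z = 0) \<or> (\<forall>x\<in>F. x [^] (2 * e x) = \<one>)) \<and>
          (\<forall>x\<in>F. e x \<noteq> 0 \<longrightarrow> (\<forall>k. x [^] (e x * k) = \<one> \<longleftrightarrow> t [^] (N * k) = \<one>)))"
        using relation_mod_span[OF fin finite_G FG(2) F(2) tA(1) False] by blast
      have "t [^] (1::int) \<in> span F" using gen[OF t] tA by simp
      then have "N = 1" using r(1,2) by (metis zdvd1_eq abs_of_pos)
      then have t_eq: "t \<otimes> lincomb F e = \<one>" using r(3,4) lincomb_insert[OF fin False, of e] FG tA by simp
      have le: "lincomb F e \<in> carrier G" using FG by simp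
      have tinv: "t = inv (lincomb F e)" using inv_equality[OF t_eq le tA(2)] by simp
      from r(5) consider "\<forall>x\<in>F. e x = 0" | z where "z \<in> F" "\<forall>w\<in>F - {z}. e w = 0" | "\<forall>x\<in>F. x [^] (2 * e x) = \<one>"
        by blast
      then show ?thesis
      proof cases
        case 1
        then have "t = \<one>" using tinv lincomb_zero[OF FG(1)] by simp
        then show ?thesis using subgroup.one_closed[OF sg] by simp
      next
        case 2
        have zc: "z \<in> carrier G" using 2 FG by auto
        have "lincomb F e = z [^] e z" by (rule lincomb_single[OF fin 2(1) FG(1)]) (use 2 in auto)
        then have tz: "t = inv (z [^] e z)" using tinv by simp
        show ?thesis
        proof (cases "z = x")
          case True
          have "subgroup (generate G {x}) G" using generate_is_subgroup xc by auto
          moreover have "x [^] e x \<in> generate G {x}" using generate_pow[OF xc(1)] by auto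
          ultimately show ?thesis using tz True subgroup.m_inv_closed by metis
        next
          case False
          then have "t \<in> span (F - {x})"
            using tz incl[OF 2(1)] subgroup.m_inv_closed[OF sg] int_pow_in_subgroup[OF sg] by blast
          then show ?thesis using subgroup.m_closed[OF sg] by blast
        qed
      next
        case 3
        then have "lincomb F (\<lambda>x. 2 * e x) = \<one>" unfolding lincomb_def by (intro finprod_one_eqI) auto
        then have "lincomb F e [^] (2::int) = \<one>" using lincomb_mult[OF FG(1) fin, of 2 e] by simp
        then have "lincomb F e \<otimes> lincomb F e = \<one>" using le int_pow_mult[OF le, of 1 1] by simp
        then have "t \<otimes> t = \<one>" using tinv le by (metis inv_mult_group inv_one)
        then show ?thesis using subgroup.one_closed[OF sg] by simp
      qed
    qed
  qed
qed

text \<open>The usable consequences of maximizing the product of the orders: terms outside the span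
  satisfy a nontrivial relation, whence \<open>m dvd N - 1\<close>, and
  \<open>ord y <= ord x\<close> records that exchanging \<open>x\<close> for \<open>y\<close> brings
  no gain.\<close>

definition exchange_maximal :: "'a set \<Rightarrow> bool"
  where "exchange_maximal F \<longleftrightarrow> F \<subseteq> set_mset U \<and> independent F \<and>
    (\<forall>y\<in>#U. y \<notin> span F \<longrightarrow> (\<exists>(N::int) e. 1 < N \<and> (\<forall>k::int. y [^] k \<in> span F \<longleftrightarrow> N dvd k) \<and>
      lincomb (insert y F) e = \<one> \<and> e y = N \<and> m dvd N - 1 \<and>
      (\<forall>x\<in>F. e x \<noteq> 0 \<longrightarrow> ord y \<le> ord x \<and> (\<forall>k. x [^] (e x * k) = \<one> \<longleftrightarrow> y [^] (N * k) = \<one>))))"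

text \<open>
  Choose \<open>F\<close> such that the product of the orders of its members is maximal: neither adjoining \<open>y\<close> nor
  exchanging a member of \<open>F\<close> for \<open>y\<close> may increase it.
\<close>

lemma ex_exchange_maximal: "\<exists>F. exchange_maximal F"
proof -
  define \<F> where "\<F> = {F. F \<subseteq> set_mset U \<and> independent F}"
  define w where "w F = (\<Prod>x\<in>F. ord x)" for F
  have finF: "finite \<F>" by (rule finite_subset[of _ "Pow (set_mset U)"]) (auto simp: \<F>_def)
  have ne: "\<F> \<noteq> {}" by (auto simp: \<F>_def independent_def intro!: exI[of _ "{}"])
  have fin_w: "finite (w ` \<F>)" "w ` \<F> \<noteq> {}" using finF ne by auto
  obtain F where F\<F>: "F \<in> \<F>" "w F = Max (w ` \<F>)" using Max_in[OF fin_w] by auto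
  then have max: "w E \<le> w F" if "E \<in> \<F>" for E using Max_ge[OF fin_w(1)] that by auto
  have F: "F \<subseteq> set_mset U" "independent F" using F\<F> by (auto simp: \<F>_def)
  have fin: "finite F" using F(1) finite_subset by blast
  have FG: "F \<subseteq> carrier G" "F \<subseteq> A" using F U_G U_A by auto
  have wpos: "0 < w E" if "E \<subseteq> set_mset U" for E
    unfolding w_def using ord_gt_1 that by (intro prod_pos) force
  show ?thesis
  unfolding exchange_maximal_def
  proof (intro exI[of _ F] conjI F ballI impI)
    fix y assume y: "y \<in># U" "y \<notin> span F"
    have yF: "y \<notin> F" using y span_incl[OF fin FG(1)] by blast
    have yA: "y \<in> A" "y \<in> carrier G" using y U_A U_G by auto
    obtain N :: int and e where r: "0 < N" "\<And>k::int. y [^] k \<in> span F \<longleftrightarrow> N dvd k"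
      "lincomb (insert y F) e = \<one>" "e y = N"
      "(\<forall>x\<in>F. e x = 0) \<or>
        (m dvd N - 1 \<and> ((\<exists>x\<in>F. \<forall>z\<in>F - {x}. e z = 0) \<or> (\<forall>x\<in>F. x [^] (2 * e x) = \<one>)) \<and>
        (\<forall>x\<in>F. e x \<noteq> 0 \<longrightarrow> (\<forall>k. x [^] (e x * k) = \<one> \<longleftrightarrow> y [^] (N * k) = \<one>)))"
      using relation_mod_span[OF fin finite_G FG(2) F(2) yA(1) yF] by blast
    have sp: "lincomb (insert y F) u = y [^] u y \<otimes> lincomb F u" for u
      using lincomb_insert[OF fin yF] FG yA by simp
    have "y [^] (1::int) \<notin> span F" using y yA by simp
    then have N1: "1 < N" using r(1) r(2)[of 1] by (cases "N = 1") auto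
    \<comment> \<open>With a trivial relation \<open>y\<close> could be adjoined to
      \<open>F\<close>.\<close>
    have "\<not> (\<forall>x\<in>F. e x = 0)"
    proof
      assume z: "\<forall>x\<in>F. e x = 0"
      then have yN: "y [^] N = \<one>" using r(3,4) sp[of e] lincomb_zero[OF FG(1), of e] yA by simp
      have "independent (insert y F)"
      proof (rule independent_insert[OF fin _ yF F(2)])
        fix k :: int assume "y [^] k \<in> span F"
        then obtain c where "k = N * c" using r(2) by (auto elim: dvdE)
        then show "y [^] k = \<one>" using int_pow_mult_eq_one[OF yA(2) yN] by simp
      qed (use FG yA in auto)
      then have "w (insert y F) \<le> w F" using y F by (intro max) (auto simp: \<F>_def)
      then have "ord y * w F \<le> w F" using yF fin by (simp add: w_def)
      then show False using ord_gt_1[OF y(1)] wpos[OF F(1)] by simp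
    qed
    then have r5: "m dvd N - 1" "(\<exists>x\<in>F. \<forall>z\<in>F - {x}. e z = 0) \<or> (\<forall>x\<in>F. x [^] (2 * e x) = \<one>)"
      and iff: "\<And>x k. x \<in> F \<Longrightarrow> e x \<noteq> 0 \<Longrightarrow> x [^] (e x * k) = \<one> \<longleftrightarrow> y [^] (N * k) = \<one>"
      using r(5) by blast+
    have "ord y \<le> ord x" if x: "x \<in> F" "e x \<noteq> 0" for x
    proof (rule ccontr)
      assume lt: "\<not> ord y \<le> ord x"
      define E where "E = F - {x}"
      have E: "finite E" "E \<subseteq> carrier G" "y \<notin> E" "x \<notin> E" "insert x E = F" using fin FG yF x by (auto simp: E_def)
      have "independent (insert y E)"
      proof (rule independent_insert)
        show "independent E" using independent_subset[OF fin FG(1) _ F(2)] by (simp add: E_def)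
        fix k :: int assume k: "y [^] k \<in> span E"
        then have "y [^] k \<in> span F" using span_mono[OF fin FG(1), of E] by (auto simp: E_def)
        then obtain c where c: "k = N * c" using r(2) by (auto elim: dvdE)
        obtain u where u: "y [^] k = lincomb E u" using k by (auto simp: span_def)
        \<comment> \<open>Substituting the expression of \<open>y [^] k\<close> by \<open>E\<close>
          into \<open>c\<close> times the relation leaves a relation on \<open>F\<close> with
          exponent \<open>c * e x\<close> at \<open>x\<close>. Independence makes
          \<open>x [^] (e x * c)\<close> trivial, and \<open>iff\<close> carries this over to
          \<open>y [^] k\<close>.\<close>
        define v where "v z = c * e z + (if z = x then 0 else u z)" for z
        have "lincomb (insert y F) (\<lambda>z. c * e z) = \<one>"
          using lincomb_mult[of "insert y F" c e] r(3) fin FG yA by (simp add: int_pow_one)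
        then have ce: "y [^] k \<otimes> lincomb F (\<lambda>z. c * e z) = \<one>" using sp r(4) c by (simp add: mult.commute)
        have "lincomb F v = lincomb F (\<lambda>z. c * e z) \<otimes> lincomb F (\<lambda>z. if z = x then 0 else u z)"
          unfolding v_def by (rule lincomb_add[OF FG(1)])
        also have "lincomb F (\<lambda>z. if z = x then 0 else u z) = lincomb F (\<lambda>z. if z \<in> E then u z else 0)"
          by (rule lincomb_cong[OF FG(1)]) (auto simp: E_def)
        also have "\<dots> = y [^] k" unfolding u by (rule lincomb_subset[OF fin FG(1)]) (simp add: E_def)
        also have "lincomb F (\<lambda>z. c * e z) \<otimes> y [^] k = \<one>" using ce FG yA by (simp add: m_comm)
        finally have "x [^] v x = \<one>" using independentD[OF F(2) _ x(1)] by blast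
        then have "x [^] (e x * c) = \<one>" by (simp add: v_def mult.commute)
        then show "y [^] k = \<one>" using iff[OF x] c by simp
      qed (use E yA in auto)
      then have "w (insert y E) \<le> w F" using y F by (intro max) (auto simp: \<F>_def E_def)
      moreover have "w F = ord x * w E" using E by (simp add: w_def flip: E(5))
      moreover have "w (insert y E) = ord y * w E" using E by (simp add: w_def)
      moreover have "0 < w E" using wpos[of E] F(1) by (auto simp: E_def)
      ultimately show False using lt by simp
    qed
    then show "\<exists>(N::int) e. 1 < N \<and> (\<forall>k::int. y [^] k \<in> span F \<longleftrightarrow> N dvd k) \<and>
       lincomb (insert y F) e = \<one> \<and> e y = N \<and> m dvd N - 1 \<and>
       (\<forall>x\<in>F. e x \<noteq> 0 \<longrightarrow> ord y \<le> ord x \<and> (\<forall>k. x [^] (e x * k) = \<one> \<longleftrightarrow> y [^] (N * k) = \<one>))"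
      using N1 r(2-4) r5(1) iff by blast
  qed
qed

text \<open>Under this hypothesis no term can lie outside the span of an exchange-maximal
  family.\<close>

lemma no_order_one_mod_False:
  assumes "\<And>y N. y \<in># U \<Longrightarrow> 1 < N \<Longrightarrow> N dvd int (ord y) \<Longrightarrow> \<not> m dvd N - 1"
    and big: "\<exists>y\<in>#U. 2 < ord y"
  shows False
proof -
  obtain F where "exchange_maximal F" using ex_exchange_maximal by blast
  then have F: "F \<subseteq> set_mset U" "independent F" and max: "y \<in># U \<Longrightarrow> y \<notin> span F \<Longrightarrow>
      \<exists>N::int. 1 < N \<and> (\<forall>k::int. y [^] k \<in> span F \<longleftrightarrow> N dvd k) \<and> m dvd N - 1" for y
    unfolding exchange_maximal_def by blast+
  show False
  proof (rule independent_not_generating[OF F(1,2) _ big], rule ccontr)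
    fix y assume y: "y \<in># U" "y \<notin> span F"
    obtain N :: int where N: "1 < N" "\<forall>k::int. y [^] k \<in> span F \<longleftrightarrow> N dvd k" "m dvd N - 1"
      using max[OF y] by blast
    have "y [^] int (ord y) = \<one>" using pow_ord_eq_1[of y] y U_G by (simp only: int_pow_int subset_iff)
    moreover have "\<one> \<in> span F" using subgroup.one_closed[OF subgroup_span] F(1) U_G by blast
    ultimately have "N dvd int (ord y)" using N(2) by metis
    then show False using assms(1)[OF y(1) N(1)] N(3) by blast
  qed
qed

end

section \<open>Two homocyclic layers\<close>

context comm_group
begin

lemma subgroup_power_preimage:
  assumes "subgroup H G" "subgroup K G"
  shows "subgroup {g \<in> H. g [^] (k::int) \<in> K} G"
proof (rule subgroupI)
  note H = subgroup.subset[OF assms(1)]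
  show "{g \<in> H. g [^] k \<in> K} \<subseteq> carrier G" using H by auto
  show "{g \<in> H. g [^] k \<in> K} \<noteq> {}"
    using subgroup.one_closed[OF assms(1)] subgroup.one_closed[OF assms(2)]
    by (auto simp: int_pow_one intro!: exI[of _ \<one>])
  show "inv a \<in> {g \<in> H. g [^] k \<in> K}" if "a \<in> {g \<in> H. g [^] k \<in> K}" for a
    using that H subgroup.m_inv_closed[OF assms(1)] subgroup.m_inv_closed[OF assms(2)]
    by (auto simp: int_pow_inv subset_iff)
  show "a \<otimes> b \<in> {g \<in> H. g [^] k \<in> K}"
    if "a \<in> {g \<in> H. g [^] k \<in> K}" "b \<in> {g \<in> H. g [^] k \<in> K}" for a b
    using that H subgroup.m_closed[OF assms(1)] subgroup.m_closed[OF assms(2)]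
    by (auto simp: int_pow_distrib subset_iff)
qed

end

context longest_length_mod
begin

text \<open>The elements whose \<open>k\<close>-th power lies in \<open>K\<close> form a subgroup
  that contains all terms of \<open>U\<close>, hence everything.\<close>

lemma power_in_subgroup:
  assumes "subgroup K G" "\<And>y. y \<in># U \<Longrightarrow> y [^] (k::int) \<in> K" "g \<in> carrier G"
  shows "g [^] k \<in> K"
proof -
  have "{g \<in> carrier G. g [^] k \<in> K} = carrier G"
    by (rule support_of_longest[OF U_minimal U_longest subgroup_power_preimage[OF subgroup_self assms(1)]])
      (use assms(2) U_G in auto)
  then show ?thesis using assms(3) by auto
qed

lemma ord_prime_power:
  assumes "Factorial_Ring.prime (p::nat)" "y \<in> carrier G" "y [^] (int p ^ s) = \<one>"
  shows "\<exists>i\<le>s. ord y = p ^ i"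
proof -
  have "int (ord y) dvd int (p ^ s)" using assms(3) int_pow_eq_id[OF assms(2)] by simp
  then have "ord y dvd p ^ s" by (simp only: int_dvd_int_iff)
  then show ?thesis using divides_primepow_nat[OF assms(1)] by auto
qed

text \<open>Otherwise \<open>p ^ (s - 1)\<close> would kill all terms of \<open>U\<close> and
  therefore the whole group.\<close>

lemma ex_ord_prime_power:
  assumes p: "Factorial_Ring.prime (p::nat)"
    and tors: "\<And>g. g \<in> carrier G \<Longrightarrow> g [^] (int p ^ s) = \<one>"
    and full: "\<exists>g\<in>carrier G. g [^] (int p ^ (s - 1)) \<noteq> \<one>"
  shows "\<exists>y\<in>#U. ord y = p ^ s"
proof (rule ccontr)
  assume no: "\<not> ?thesis"
  have "y [^] (int p ^ (s - 1)) \<in> {\<one>}" if y: "y \<in># U" for y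
  proof -
    have yc: "y \<in> carrier G" using y U_G by auto
    obtain i where i: "i \<le> s" "ord y = p ^ i" using ord_prime_power[OF p yc tors[OF yc]] by blast
    then have "i \<noteq> s" using no y by blast
    then have "ord y dvd p ^ (s - 1)" unfolding i(2) using i(1) by (intro le_imp_power_dvd) simp
    then have "int (ord y) dvd int (p ^ (s - 1))" by (simp only: int_dvd_int_iff)
    then show ?thesis using int_pow_eq_id[OF yc] by simp
  qed
  then have "g [^] (int p ^ (s - 1)) = \<one>" if "g \<in> carrier G" for g
    using power_in_subgroup[OF triv_subgroup _ that] by blast
  then show False using full by blast
qed

text \<open>
  Let \<open>P\<^sup>J\<close> be the exponent of \<open>G\<close> modulo \<open>\<langle>F\<rangle>\<close>, with \<open>F\<close> maximal as above. A term \<open>y\<close> of order \<open>P\<^sup>J\<close>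
  modulo \<open>\<langle>F\<rangle>\<close> can be corrected by an element \<open>h\<close> of \<open>\<langle>F\<rangle>\<close> so that it has order \<open>P\<^sup>J\<close>. Its multiple of
  order \<open>P\<close> is then not in \<open>\<langle>F\<rangle>\<close>, but it is divisible by \<open>P\<^sup>J\<close> in \<open>G\<close>, and \<open>P\<^sup>J G\<close> is contained in \<open>\<langle>F\<rangle>\<close>.
\<close>

lemma two_layers_False:
  fixes p s\<^sub>1 s\<^sub>2 :: nat
  defines "P \<equiv> int p"
  assumes p: "Factorial_Ring.prime p" and s: "0 < s\<^sub>1" "0 < s\<^sub>2" "s\<^sub>1 dvd s\<^sub>2"
    and tors: "\<And>g. g \<in> carrier G \<Longrightarrow> g [^] (P ^ s\<^sub>2) = \<one>"
    and full: "\<exists>g\<in>carrier G. g [^] (P ^ (s\<^sub>2 - 1)) \<noteq> \<one>"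
    and socle\<^sub>1: "\<And>g. g \<in> carrier G \<Longrightarrow> g [^] P = \<one> \<Longrightarrow> \<exists>h\<in>carrier G. g = h [^] (P ^ (s\<^sub>1 - 1))"
    and socle\<^sub>2: "\<And>g. g \<in> carrier G \<Longrightarrow> g [^] (P ^ Suc s\<^sub>1) = \<one> \<Longrightarrow>
      \<exists>h\<in>carrier G. g [^] (P ^ s\<^sub>1) = h [^] (P ^ (s\<^sub>2 - 1))"
    and big: "2 < p ^ s\<^sub>2"
  shows False
proof -
  have P: "1 < P" using prime_gt_1_nat[OF p] by (simp add: P_def)
  have P_inj: "P ^ i dvd P ^ j \<longleftrightarrow> i \<le> j" for i j
  proof -
    have "P ^ i dvd P ^ j \<longleftrightarrow> int (p ^ i) dvd int (p ^ j)" by (simp add: P_def)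
    also have "\<dots> \<longleftrightarrow> p ^ i dvd p ^ j" by (simp only: int_dvd_int_iff)
    also have "\<dots> \<longleftrightarrow> i \<le> j" using prime_ge_2_nat[OF p] by (rule dvd_power_iff_le)
    finally show ?thesis .
  qed
  have ord_P: "\<exists>i\<le>s\<^sub>2. int (ord y) = P ^ i" if "y \<in> carrier G" for y
    using ord_prime_power[OF p that] tors[OF that] by (auto simp: P_def)
  obtain y\<^sub>1 where y1: "y\<^sub>1 \<in># U" "int (ord y\<^sub>1) = P ^ s\<^sub>2"
    using ex_ord_prime_power[OF p, of s\<^sub>2] tors full by (auto simp: P_def)
  have m2: "m dvd P ^ s\<^sub>2 - 2" using ord_mod[OF _ finite_G, of y\<^sub>1] y1 U_A by auto
  have ns2: "\<not> m dvd P ^ s\<^sub>2 - 1"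
  proof
    assume "m dvd P ^ s\<^sub>2 - 1"
    from dvd_diff[OF this m2] show False using m_gt_1 by (simp add: zdvd1_eq)
  qed
  \<comment> \<open>This is where \<open>s\<^sub>1 dvd s\<^sub>2\<close> enters: it makes
    \<open>P ^ s\<^sub>1 - 1\<close> a divisor of \<open>P ^ s\<^sub>2 - 1\<close>.\<close>
  have ns1: "\<not> m dvd P ^ s\<^sub>1 - 1"
  proof
    assume *: "m dvd P ^ s\<^sub>1 - 1"
    obtain t where "s\<^sub>2 = s\<^sub>1 * t" using s(3) by blast
    then have "P ^ s\<^sub>2 - 1 = (P ^ s\<^sub>1) ^ t - 1 ^ t" by (simp add: power_mult)
    also have "P ^ s\<^sub>1 - 1 dvd \<dots>" by (metis dvd_triv_left power_diff_sumr2)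
    finally show False using * ns2 dvd_trans by blast
  qed
  obtain F where "exchange_maximal F" using ex_exchange_maximal by blast
  note F_max = this[unfolded exchange_maximal_def]
  then have F: "F \<subseteq> set_mset U" "independent F" by auto
  note max = F_max[THEN conjunct2, THEN conjunct2, rule_format]
  have fin: "finite F" using F(1) finite_subset by blast
  have FG: "F \<subseteq> carrier G" using F U_G by auto
  have sg: "subgroup (span F) G" using subgroup_span[OF FG] .
  have level: "\<exists>j. \<forall>k::int. y [^] k \<in> span F \<longleftrightarrow> P ^ j dvd k" if y: "y \<in># U" for y
  proof (cases "y \<in> span F")
    case True
    then show ?thesis using int_pow_in_subgroup[OF sg] by (intro exI[of _ 0]) auto
  next
    case False
    have yc: "y \<in> carrier G" using y U_G by auto
    obtain N :: int where N: "1 < N" "\<forall>k::int. y [^] k \<in> span F \<longleftrightarrow> N dvd k" using max[OF y False] by blast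
    have "N dvd P ^ s\<^sub>2" using N(2) tors[OF yc] subgroup.one_closed[OF sg] by metis
    then have "int (nat N) dvd int (p ^ s\<^sub>2)" using N(1) by (simp add: P_def)
    then have "nat N dvd p ^ s\<^sub>2" by (simp only: int_dvd_int_iff)
    then obtain i where "nat N = p ^ i" using divides_primepow_nat[OF p] by auto
    then have "N = P ^ i" using N(1) by (metis P_def int_nat_eq of_nat_power less_imp_le order_less_trans zero_less_one)
    then show ?thesis using N by blast
  qed
  then obtain lev where lev: "\<And>y k. y \<in># U \<Longrightarrow> y [^] (k::int) \<in> span F \<longleftrightarrow> P ^ lev y dvd k" by metis
  have "\<exists>y\<in>#U. 2 < ord y"
  proof (intro bexI[OF _ y1(1)])
    have "int (ord y\<^sub>1) = int (p ^ s\<^sub>2)" using y1 by (simp add: P_def)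
    then show "2 < ord y\<^sub>1" using big by linarith
  qed
  then obtain y' where y': "y' \<in># U" "y' \<notin> span F" using independent_not_generating[OF F] by blast
  define J where "J = Max (lev ` set_mset U)"
  have "J \<in> lev ` set_mset U" unfolding J_def by (rule Max_in) (use y' in auto)
  then obtain y where y: "y \<in># U" "lev y = J" by blast
  have levJ: "lev z \<le> J" if "z \<in># U" for z using that by (auto simp: J_def)
  have "lev y' \<noteq> 0"
  proof
    assume "lev y' = 0"
    then have "y' [^] (1::int) \<in> span F" using lev[OF y'(1), of 1] by simp
    then show False using y' U_G by (metis int_pow_1 subsetD)
  qed
  then have Jpos: "0 < J" using levJ[OF y'(1)] by simp
  have yc: "y \<in> carrier G" using y U_G by auto
  have "y \<notin> span F"
  proof
    assume "y \<in> span F"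
    then have "P ^ J dvd P ^ 0" using lev[OF y(1), of 1] yc y(2) by simp
    then show False using Jpos unfolding P_inj by simp
  qed
  then obtain N :: int and e where N: "1 < N" "\<forall>k::int. y [^] k \<in> span F \<longleftrightarrow> N dvd k"
    "lincomb (insert y F) e = \<one>" "e y = N" "m dvd N - 1"
    and e: "\<forall>x\<in>F. e x \<noteq> 0 \<longrightarrow> ord y \<le> ord x \<and> (\<forall>k. x [^] (e x * k) = \<one> \<longleftrightarrow> y [^] (N * k) = \<one>)"
    using max[OF y(1)] by blast
  have "N dvd k \<longleftrightarrow> P ^ J dvd k" for k using N(2) lev[OF y(1), of k] y(2) by blast
  then have NJ: "N = P ^ J" using N(1) P by (metis dvd_refl zdvd_antisym_nonneg order_less_imp_le
        order_less_trans zero_less_one zero_le_power)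
  have PJ_span: "g [^] (P ^ J) \<in> span F" if "g \<in> carrier G" for g
    by (rule power_in_subgroup[OF sg _ that]) (use lev levJ P_inj in auto)
  have PJ_span': "g [^] (P ^ i) \<in> span F" if "g \<in> carrier G" "J \<le> i" for g i
  proof -
    have "g [^] (P ^ i) = (g [^] (P ^ J)) [^] (P ^ (i - J))"
      using that by (simp add: int_pow_pow flip: power_add)
    then show ?thesis using int_pow_in_subgroup[OF sg PJ_span[OF that(1)]] by simp
  qed
  \<comment> \<open>By the equal-order clause \<open>x [^] e x\<close> has order
    \<open>P ^ (f - J)\<close>, like \<open>y [^] N\<close>. As \<open>ord x\<close> is at least
    \<open>ord y = P ^ f\<close>, the exponent \<open>e x\<close> must be divisible by
    \<open>P ^ J\<close>.\<close>
  have dvd: "P ^ J dvd e x" if x: "x \<in> F" for x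
  proof (cases "e x = 0")
    case False
    have xc: "x \<in> carrier G" using x FG by auto
    obtain g f where gf: "int (ord x) = P ^ g" "int (ord y) = P ^ f" using ord_P[OF xc] ord_P[OF yc] by blast
    have xe: "ord y \<le> ord x" "\<And>k. x [^] (e x * k) = \<one> \<longleftrightarrow> y [^] (N * k) = \<one>" using e x False by blast+
    have "f \<le> g" using xe(1) gf P by (metis of_nat_le_iff power_increasing_iff)
    have "y [^] (P ^ f) = \<one>" using int_pow_eq_id[OF yc] gf(2) by simp
    then have "P ^ J dvd P ^ f" using lev[OF y(1)] y(2) subgroup.one_closed[OF sg] by metis
    then have "J \<le> f" unfolding P_inj .
    then have split: "P ^ f = P ^ J * P ^ (f - J)" by (simp flip: power_add)
    then have "x [^] (e x * P ^ (f - J)) = \<one>" using xe(2) NJ \<open>y [^] (P ^ f) = \<one>\<close> by simp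
    then have "P ^ g dvd e x * P ^ (f - J)" using int_pow_eq_id[OF xc] gf(1) by simp
    then have "P ^ f dvd e x * P ^ (f - J)" using \<open>f \<le> g\<close> P_inj dvd_trans by blast
    then show ?thesis unfolding split using P by simp
  qed simp
  define h where "h = lincomb F (\<lambda>x. e x div P ^ J)"
  have hc: "h \<in> carrier G" "h \<in> span F" using FG by (auto simp: h_def span_def)
  have "h [^] (P ^ J) = lincomb F (\<lambda>x. P ^ J * (e x div P ^ J))"
    unfolding h_def by (rule lincomb_mult[OF FG fin, symmetric])
  also have "\<dots> = lincomb F e" by (rule lincomb_cong[OF FG]) (use dvd in simp)
  finally have hJ: "h [^] (P ^ J) = lincomb F e" .
  have "y \<notin> F" using \<open>y \<notin> span F\<close> span_incl[OF fin FG] by blast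
  then have yh: "(y \<otimes> h) [^] (P ^ J) = \<one>"
    using N(3,4) NJ hJ lincomb_insert[OF fin, of y e] FG yc hc by (simp add: int_pow_distrib)
  define z where "z i = (y \<otimes> h) [^] (P ^ i)" for i
  have zc: "z i \<in> carrier G" for i using yc hc by (simp add: z_def)
  have z_pow: "z i [^] (P ^ j) = z (i + j)" for i j
    using yc hc by (simp add: z_def int_pow_pow power_add)
  have zJ: "z i = \<one>" if "J \<le> i" for i
  proof -
    have "z i = z J [^] (P ^ (i - J))" using z_pow[of J "i - J"] that by simp
    then show ?thesis using yh by (simp add: z_def int_pow_one)
  qed
  \<comment> \<open>The correction \<open>h\<close> lies in the span, so membership depends on
    \<open>y\<close> alone, and \<open>J - 1\<close> is below its level.\<close>
  have z_notin: "z (J - 1) \<notin> span F"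
  proof
    assume "z (J - 1) \<in> span F"
    moreover have "z (J - 1) = y [^] (P ^ (J - 1)) \<otimes> h [^] (P ^ (J - 1))"
      using yc hc by (simp add: z_def int_pow_distrib)
    moreover have hs: "inv (h [^] (P ^ (J - 1))) \<in> span F"
      using hc int_pow_in_subgroup[OF sg] subgroup.m_inv_closed[OF sg] by blast
    ultimately have "(y [^] (P ^ (J - 1)) \<otimes> h [^] (P ^ (J - 1))) \<otimes> inv (h [^] (P ^ (J - 1))) \<in> span F"
      using subgroup.m_closed[OF sg] by metis
    then have "y [^] (P ^ (J - 1)) \<in> span F" using yc hc by (simp add: m_assoc)
    then have "P ^ J dvd P ^ (J - 1)" using lev[OF y(1)] y(2) by blast
    then show False using Jpos unfolding P_inj by simp
  qed
  \<comment> \<open>\<open>P ^ J = N\<close> is 1 modulo \<open>m\<close>, which neither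
    \<open>P ^ s\<^sub>1\<close> nor \<open>P ^ s\<^sub>2\<close> is.\<close>
  have "J \<noteq> s\<^sub>1" "J \<noteq> s\<^sub>2" using N(5) NJ ns1 ns2 by auto
  moreover have "J \<le> s\<^sub>2"
  proof -
    have "y [^] (P ^ s\<^sub>2) \<in> span F" using tors[OF yc] subgroup.one_closed[OF sg] by simp
    then show ?thesis using lev[OF y(1)] y(2) P_inj by blast
  qed
  ultimately consider "J < s\<^sub>1" | "s\<^sub>1 < J" "J < s\<^sub>2" by linarith
  then show False
  proof cases
    case 1
    have "z (J - 1) [^] P = \<one>" using z_pow[of "J - 1" 1] zJ[of J] Jpos by simp
    then obtain g where "g \<in> carrier G" "z (J - 1) = g [^] (P ^ (s\<^sub>1 - 1))" using socle\<^sub>1[OF zc] by blast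
    moreover have "J \<le> s\<^sub>1 - 1" using 1 by linarith
    ultimately show False using z_notin PJ_span'[of g "s\<^sub>1 - 1"] by simp
  next
    case 2
    \<comment> \<open>Chosen so that \<open>z (J - 1)\<close> is the \<open>P ^ s\<^sub>1\<close>-th
      power of \<open>z i\<close>: its height is at least \<open>s\<^sub>1\<close>, hence at least
      \<open>s\<^sub>2 - 1\<close>, which is at least \<open>J\<close>.\<close>
    define i where "i = J - 1 - s\<^sub>1"
    have i: "i + s\<^sub>1 = J - 1" "i + Suc s\<^sub>1 = J" using 2 by (auto simp: i_def)
    have "z i [^] (P ^ Suc s\<^sub>1) = \<one>" using z_pow[of i "Suc s\<^sub>1"] zJ[of J] i by simp
    then obtain g where "g \<in> carrier G" "z i [^] (P ^ s\<^sub>1) = g [^] (P ^ (s\<^sub>2 - 1))" using socle\<^sub>2[OF zc] by blast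
    moreover have "J \<le> s\<^sub>2 - 1" using 2 by linarith
    ultimately show False using z_notin PJ_span'[of g "s\<^sub>2 - 1"] z_pow[of i s\<^sub>1] i by simp
  qed
qed

text \<open>For \<open>F = {x}\<close>, a term \<open>t\<close> off the line has order 2 modulo the
  span. As \<open>m\<close> does not divide \<open>2 - 1\<close>, its relation is trivial, that is,
  \<open>t \<otimes> t = \<one>\<close>; so \<open>U\<close> splits along \<open>x\<close> with
  trivial \<open>Q\<close>.\<close>

lemma squares_in_line_False:
  assumes x: "x \<in># U" "2 < ord x" and sq: "\<And>t. t \<in># U \<Longrightarrow> t \<otimes> t \<in> generate G {x}"
  shows False
proof (rule split_False[OF x triv_subgroup])
  have xA: "x \<in> A" "x \<in> carrier G" using x U_A U_G by auto
  have sgl: "lincomb {x} u = x [^] u x" for u using lincomb_insert[of "{}" x u] xA by (simp add: lincomb_def)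
  have ind: "independent {x}" unfolding independent_def by (simp add: sgl)
  have sp: "span {x} = generate G {x}"
  proof -
    have "span {x} = range (\<lambda>k::int. x [^] k)"
    proof
      show "range (\<lambda>k::int. x [^] k) \<subseteq> span {x}"
      proof
        fix a assume "a \<in> range (\<lambda>k::int. x [^] k)"
        then obtain k :: int where "a = x [^] k" by auto
        then have "a = lincomb {x} (\<lambda>_. k)" by (simp add: sgl)
        then show "a \<in> span {x}" by (auto simp: span_def)
      qed
    qed (auto simp: span_def sgl)
    then show ?thesis using generate_pow[OF xA(2)] by (simp add: full_SetCompr_eq)
  qed
  fix t assume t: "t \<in># U"
  show "t \<in> generate G {x} \<or> t \<otimes> t \<in> {\<one>}"
  proof (cases "t \<in> generate G {x}")
    case False
    have tA: "t \<in> A" "t \<in> carrier G" using t U_A U_G by auto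
    have tx: "t \<notin> {x}" using False generate.incl[of x "{x}" G] by auto
    obtain N :: int and e where r: "0 < N" "\<And>k::int. t [^] k \<in> span {x} \<longleftrightarrow> N dvd k"
      "lincomb (insert t {x}) e = \<one>" "e t = N" "(\<forall>x\<in>{x}. e x = 0) \<or> m dvd N - 1"
      using relation_mod_span[of "{x}" t] finite_G xA ind tA tx by blast
    have tt: "t [^] (2::int) = t \<otimes> t" using int_pow_mult[OF tA(2), of 1 1] tA by simp
    have "N dvd 2" using r(2)[of 2] sq[OF t] sp tt by simp
    then have "N = 1 \<or> N = 2" using r(1) zdvd_imp_le[of N 2] by auto
    moreover have "N \<noteq> 1"
    proof
      assume "N = 1"
      then have "t [^] (1::int) \<in> span {x}" using r(2) by simp
      then show False using False sp tA by simp
    qed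
    ultimately have N: "N = 2" by simp
    then have "\<not> m dvd N - 1" using m_gt_1 by (simp add: zdvd1_eq)
    then have "e x = 0" using r(5) by simp
    then have "t [^] (2::int) = \<one>" using r(3,4) N lincomb_insert[of "{x}" t e] sgl[of e] tx tA xA by simp
    then show ?thesis using tt by simp
  qed simp
qed simp

end

section \<open>Exponent 2p\<close>

context comm_group
begin

text \<open>For terms of order \<open>2 * p\<close> in a group of exponent \<open>2 * p\<close>,
  with \<open>p\<close> odd, this is linear independence of the squares over the field with
  \<open>p\<close> elements; nothing is demanded at the prime 2.\<close>

definition independent_mod :: "nat \<Rightarrow> 'a set \<Rightarrow> bool"
  where "independent_mod p F \<longleftrightarrow> (\<forall>e. lincomb F e = \<one> \<longrightarrow> (\<forall>x\<in>F. int p dvd e x))"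

lemma independent_modD: "independent_mod p F \<Longrightarrow> lincomb F e = \<one> \<Longrightarrow> x \<in> F \<Longrightarrow> int p dvd e x"
  unfolding independent_mod_def by blast

lemma independent_mod_subset:
  assumes "finite F" "F \<subseteq> carrier G" "E \<subseteq> F" "independent_mod p F"
  shows "independent_mod p E"
  unfolding independent_mod_def
proof (intro allI impI ballI)
  fix e x assume e: "lincomb E e = \<one>" "x \<in> E"
  then have "lincomb F (\<lambda>x. if x \<in> E then e x else 0) = \<one>" using lincomb_subset assms by simp
  from independent_modD[OF assms(4) this, of x] e(2) assms(3) show "int p dvd e x" by auto
qed

end

context longest_length_mod
begin

text \<open>
  If a vector with entries below \<open>p\<close> on \<open>F\<close> is minimal, then it stays so when one of these entries is
  shifted by \<open>2p\<close>. Hence all these entries are odd, which rules out relations with \<open>2 y\<close> in place of \<open>y\<close>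
  and forces \<open>F\<close> to be independent.
\<close>

lemma line_of_dependent:
  assumes m: "m = 2" and p: "Factorial_Ring.prime p" "odd (p::nat)"
    and F: "finite F" "F \<noteq> {}" "F \<subseteq> A" "independent_mod p F" "\<And>x. x \<in> F \<Longrightarrow> ord x = 2 * p"
    and y: "y \<in> A" "y \<notin> F" "ord y = 2 * p"
    and u: "lincomb (insert y F) (\<lambda>x. 2 * u x) = \<one>" "u y = 1" "\<And>x. x \<in> F \<Longrightarrow> \<not> int p dvd u x"
  shows "\<exists>x\<in>F. y \<in> generate G {x}"
proof -
  define I where "I = insert y F"
  have FG: "F \<subseteq> carrier G" "y \<in> carrier G" "I \<subseteq> carrier G" "I \<subseteq> A" "finite I" "y \<in> I"
    using F y A_sub by (auto simp: I_def)
  define P where "P = int p"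
  have P: "2 < P" using prime_ge_2_nat[OF p(1)] p(2) unfolding P_def by (cases "p = 2") auto
  have pP: "Factorial_Ring.prime P" using p(1) by (simp add: P_def)
  have P2: "P dvd 2 * a \<longleftrightarrow> P dvd a" for a :: int
  proof -
    have "\<not> P dvd 2" using P zdvd_imp_le[of P 2] by auto
    then show ?thesis using prime_dvd_mult_iff[OF pP] by blast
  qed
  have sp: "lincomb I v = y [^] v y \<otimes> lincomb F v" for v
    unfolding I_def using lincomb_insert[of F y v] F(1) y(2) FG(3) by (simp add: I_def)
  interpret length_lattice I "\<lambda>e. lincomb I e = \<one>" "\<lambda>e. \<phi> (signed_seq I e)" m
    by (rule length_lattice) (use FG in auto)
  have F_only: "P dvd v x" if "lincomb I v = \<one>" "v y = 0" "x \<in> F" for v x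
    using that sp[of v] independent_modD[OF F(4), of v x] FG(1) by (simp add: P_def)
  have ordx: "int (ord x) = 2 * P" if "x \<in> I" for x using that F(5) y(3) by (auto simp: I_def P_def)
  have small: "v x = 0" if "lincomb I v = \<one>" "v y = 0" "x \<in> F" "\<bar>v x\<bar> < P" for v x
    using F_only[OF that(1-3)] that(4) P by (metis abs_of_pos dvd_imp_le_int not_le order_less_trans zero_less_numeral)
  \<comment> \<open>A part with \<open>y\<close>-entry zero has entries divisible by
    \<open>P\<close>, so only the one at \<open>x\<close> can be nonzero; it is then divisible by
    \<open>ord x = 2 * P\<close>. Thus a single entry may exceed \<open>P\<close>. Condition
    \<open>c\<close> excludes intermediate \<open>y\<close>-entries.\<close>
  have minimal_if: "minimal v"
    if v: "lincomb I v = \<one>" "0 < v y" and x: "x \<in> F" "\<bar>v x\<bar> < 2 * P" "\<And>z. z \<in> F \<Longrightarrow> z \<noteq> x \<Longrightarrow> \<bar>v z\<bar> < P"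
      and c: "\<And>w. lincomb I w = \<one> \<Longrightarrow> 0 \<le> w y \<Longrightarrow> w y \<le> v y \<Longrightarrow> w y = 0 \<or> w y = v y" for v x
  proof -
    have zero: "\<forall>z\<in>I. w z = 0" if w: "lincomb I w = \<one>" "w y = 0" "\<And>z. z \<in> F \<Longrightarrow> \<bar>w z\<bar> \<le> \<bar>v z\<bar>" for w
    proof -
      have wz: "w z = 0" if "z \<in> F" "z \<noteq> x" for z
        using small[of w z] w that x(3)[OF that] w(3)[OF that(1)] by linarith
      moreover have xc: "x \<in> carrier G" using x(1) FG by auto
      ultimately have "x [^] w x = \<one>" using w(1,2) sp[of w] lincomb_single[OF F(1) x(1) FG(1)] by simp
      then have "2 * P dvd w x" using int_pow_eq_id[of x] ordx[of x] x(1) FG by (auto simp: I_def)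
      moreover have "\<bar>w x\<bar> < 2 * P" using w(3)[OF x(1)] x(2) by linarith
      ultimately have "w x = 0" using P by (metis abs_of_pos dvd_imp_le_int mult_pos_pos not_le order_less_trans zero_less_numeral)
      then show ?thesis using wz w(2) by (auto simp: I_def)
    qed
    show ?thesis
      unfolding minimal_def
    proof (intro conjI allI impI)
      show "lincomb I v = \<one>" "\<exists>i\<in>I. v i \<noteq> 0" using v FG(6) by (auto intro!: bexI[of _ y])
      fix w assume w: "lincomb I w = \<one> \<and> conformal I w v"
      have cf: "(0 \<le> w z \<and> w z \<le> v z) \<or> (v z \<le> w z \<and> w z \<le> 0)" if "z \<in> I" for z
        using w that by (auto simp: conformal_def)
      have "0 \<le> w y" "w y \<le> v y" using cf[OF FG(6)] v(2) by auto
      then have "w y = 0 \<or> w y = v y" using c w by blast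
      then show "(\<forall>i\<in>I. w i = 0) \<or> (\<forall>i\<in>I. w i = v i)"
      proof
        assume "w y = 0"
        moreover have "\<bar>w z\<bar> \<le> \<bar>v z\<bar>" if "z \<in> F" for z using cf[of z] that by (auto simp: I_def)
        ultimately show ?thesis using zero[of w] w by blast
      next
        assume "w y = v y"
        moreover have "\<bar>v z - w z\<bar> \<le> \<bar>v z\<bar>" if "z \<in> F" for z using cf[of z] that by (auto simp: I_def)
        ultimately have "\<forall>z\<in>I. v z - w z = 0" by (intro zero[OF L_diff[OF v(1) conjunct1[OF w]]]) auto
        then show ?thesis by simp
      qed
    qed
  qed
  have spike2: "minimal (spike x (2 * P))" if "x \<in> F" for x
  proof -
    have "minimal (spike x (int (ord x)))"
    proof (rule spike_minimal)
      fix w assume w: "lincomb I w = \<one>" "\<And>z. z \<in> I \<Longrightarrow> z \<noteq> x \<Longrightarrow> w z = 0"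
      have "x [^] w x = \<one>" using w lincomb_single[of I x w] that FG by (simp add: I_def)
      then show "int (ord x) dvd w x" using int_pow_eq_id that FG by auto
    qed (use FG that finite_G in \<open>auto simp: I_def\<close>)
    then show ?thesis using ordx that by (simp add: I_def)
  qed
  have L_spike2: "lincomb I (spike x (2 * P * k)) = \<one>" if "x \<in> F" for x k
    using lincomb_spike[of I x] that FG ordx[of x] int_pow_eq_id[of x] by (auto simp: I_def)
  \<comment> \<open>The entries are first reduced modulo \<open>2 * P\<close>, which preserves
    parity. They end strictly between \<open>-P\<close> and \<open>P\<close>, because
    \<open>P\<close> does not divide them.\<close>
  have odd_if: "odd (v x)"
    if v: "lincomb I v = \<one>" "0 < v y" and x: "x \<in> F" and z: "\<And>z. z \<in> F \<Longrightarrow> \<not> P dvd v z"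
      and c: "\<And>w. lincomb I w = \<one> \<Longrightarrow> 0 \<le> w y \<Longrightarrow> w y \<le> v y \<Longrightarrow> w y = 0 \<or> w y = v y" for v x
  proof -
    obtain r where r0: "lincomb F r = lincomb F v"
      "\<And>z. z \<in> F \<Longrightarrow> int (ord z) dvd v z - r z \<and> 2 * \<bar>r z\<bar> \<le> int (ord z)"
      using lincomb_balanced[OF finite_G FG(1), of v] by blast
    then have r: "2 * P dvd v z - r z" "\<bar>r z\<bar> \<le> P" if "z \<in> F" for z
      using r0(2)[OF that] ordx[of z] that by (auto simp: I_def)
    define e where "e = r(y := v y)"
    have eF: "e z = r z" if "z \<in> F" for z using that y(2) by (auto simp: e_def)
    have ey: "e y = v y" by (simp add: e_def)
    have "lincomb F e = lincomb F v"
      unfolding r0(1)[symmetric] by (rule lincomb_cong[OF FG(1)]) (rule eF)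
    then have e1: "lincomb I e = \<one>" using sp v(1) ey by simp
    have ne: "\<not> P dvd e t" if "t \<in> F" for t
    proof
      assume "P dvd e t"
      moreover have "P dvd v t - e t" using r(1)[OF that] eF[OF that] dvd_mult_right by metis
      ultimately have "P dvd v t" by (metis diff_add_cancel dvd_add)
      then show False using z that by blast
    qed
    have lt: "\<bar>e t\<bar> < P" if "t \<in> F" for t
    proof -
      have "\<bar>e t\<bar> \<noteq> P" using ne[OF that] by (metis dvd_abs_iff dvd_refl)
      then show ?thesis using r(2)[OF that] eF[OF that] by simp
    qed
    have ex0: "e x \<noteq> 0" using ne[OF x] by auto
    have min_e: "minimal e"
      by (rule minimal_if[OF e1 _ x]) (use ey v(2) lt[OF x] lt c P in auto)
    define e' where "e' = (\<lambda>j. e j + spike x (- sgn (e x) * (2 * P)) j)"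
    have e'1: "lincomb I e' = \<one>"
      using L_add[OF e1 L_spike2[OF x, of "- sgn (e x)"]] by (simp add: e'_def mult_ac)
    have e'y: "e' y = v y" using x y(2) ey by (metis add.right_neutral e'_def spike_simps(2))
    have "\<bar>e' x\<bar> < 2 * P" using ex0 lt[OF x] P by (cases "e x" "0::int" rule: linorder_cases) (auto simp: e'_def)
    moreover have "\<bar>e' t\<bar> < P" if "t \<in> F" "t \<noteq> x" for t using lt[OF that(1)] that(2) by (simp add: e'_def)
    ultimately have "minimal e'"
      by (intro minimal_if[OF e'1 _ x]) (use e'y v(2) c in auto)
    then have "m dvd \<bar>e x\<bar> - 1"
      using flip[OF _ min_e spike2[OF x]] x ex0 lt[OF x] P by (simp add: e'_def I_def)
    then have "odd (e x)" using m by simp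
    moreover have "even (v x - e x)" using r(1)[OF x] eF[OF x] by (metis dvd_mult_left)
    ultimately show ?thesis by simp
  qed
  have u2: "lincomb I (\<lambda>x. 2 * u x) = \<one>" using u(1) by (simp add: I_def)
  have lin: "lincomb I (\<lambda>x. c * (2 * u x)) = \<one>" for c
    using lincomb_mult[OF FG(3,5), of c] u2 by (simp add: int_pow_one)
  \<comment> \<open>If all \<open>y\<close>-entries were even, \<open>2 * u\<close> would have the
    least positive one, and \<open>odd_if\<close> would declare its even entries odd.\<close>
  have "\<exists>v. lincomb I v = \<one> \<and> odd (v y)"
  proof (rule ccontr)
    assume "\<not> ?thesis"
    then have ev: "even (w y)" if "lincomb I w = \<one>" for w using that by blast
    obtain x where x: "x \<in> F" using F(2) by blast
    have "odd ((\<lambda>x. 2 * u x) x)"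
    proof (rule odd_if[OF u2 _ x])
      fix w assume "lincomb I w = \<one>" "0 \<le> w y" "w y \<le> 2 * u y"
      then show "w y = 0 \<or> w y = 2 * u y" using ev[of w] u(2) by (cases "w y = 1") auto
    qed (use u P2 in \<open>auto simp: P_def\<close>)
    then show False by simp
  qed
  then obtain v where v: "lincomb I v = \<one>" "odd (v y)" by blast
  have not_dvd: "\<not> P dvd w x" if w: "lincomb I w = \<one>" "w y = 1" "x \<in> F" for w x
  proof
    assume "P dvd w x"
    have "lincomb I (\<lambda>x. 2 * w x) = \<one>" using lincomb_mult[OF FG(3,5), of 2 w] w by (simp add: int_pow_one)
    from L_diff[OF this u2] have "P dvd 2 * w x - 2 * u x" using F_only[of "\<lambda>x. 2 * w x - 2 * u x" x] w u(2) by simp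
    then have "P dvd 2 * u x" using \<open>P dvd w x\<close> by (metis dvd_diffD dvd_mult dvd_diff_commute diff_diff_eq2 dvd_add_right_iff diff_add_cancel)
    then show False using u(3)[OF w(3)] P2 by (simp add: P_def)
  qed
  have odd_all: "odd (w x)" if "lincomb I w = \<one>" "w y = 1" "x \<in> F" for w x
    by (rule odd_if[OF that(1) _ that(3)]) (use that not_dvd in auto)
  obtain k where k: "v y = 2 * k + 1" using v(2) by (auto elim: oddE)
  \<comment> \<open>Subtracting a multiple of the relation \<open>2 * u\<close> brings the odd
    \<open>y\<close>-entry down to 1.\<close>
  define v' where "v' = (\<lambda>x. v x - k * (2 * u x))"
  have v': "lincomb I v' = \<one>" "v' y = 1" using L_diff[OF v(1) lin[of k]] k u(2) by (auto simp: v'_def)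
  \<comment> \<open>Adding a relation on \<open>F\<close> to \<open>v'\<close> keeps the
    \<open>y\<close>-entry 1, so its entries are differences of odd numbers. They are even and
    divisible by \<open>p\<close>, hence by the orders.\<close>
  have ind: "independent F" unfolding independent_def
  proof (intro allI impI ballI)
    fix w x assume w: "lincomb F w = \<one>" "x \<in> F"
    define w' where "w' = w(y := 0)"
    have "lincomb F w' = lincomb F w" by (rule lincomb_cong[OF FG(1)]) (use y in \<open>auto simp: w'_def\<close>)
    then have "lincomb I w' = \<one>" using sp[of w'] w FG by (simp add: w'_def)
    from odd_all[OF L_add[OF v'(1) this] _ w(2)] odd_all[OF v' w(2)] v'(2)
    have "even (w' x)" by (simp add: w'_def)
    moreover have "w' x = w x" using w(2) y(2) by (auto simp: w'_def)
    moreover have "P dvd w x" using independent_modD[OF F(4) w] by (simp add: P_def)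
    moreover have "coprime 2 P" using p(2) by (simp add: P_def coprime_left_2_iff_odd)
    ultimately have "2 * P dvd w x" using divides_mult by metis
    then show "x [^] w x = \<one>" using int_pow_eq_id[of x] ordx[of x] w FG by (auto simp: I_def)
  qed
  obtain N :: int and e where r: "0 < N" "\<And>k::int. y [^] k \<in> span F \<longleftrightarrow> N dvd k"
    "lincomb I e = \<one>" "e y = N"
    "(\<forall>x\<in>F. e x = 0) \<or> (\<exists>x\<in>F. \<forall>z\<in>F - {x}. e z = 0) \<or> (\<forall>x\<in>F. x [^] (2 * e x) = \<one>)"
    unfolding I_def using relation_mod_span[OF F(1) finite_G F(3) ind y(1,2)] by blast
  have "y \<otimes> lincomb F v' = \<one>" using sp[of v'] v' FG by simp
  then have "y = inv (lincomb F v')" using inv_equality FG by (metis lincomb_closed inv_inv inv_closed inv_comm)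
  moreover have "lincomb F v' \<in> span F" by (simp add: span_def)
  ultimately have "y [^] (1::int) \<in> span F" using subgroup.m_inv_closed[OF subgroup_span[OF FG(1)]] FG by simp
  then have N: "N = 1" using r(1,2) by (metis zdvd1_eq abs_of_pos)
  have odd_e: "odd (e x)" "\<not> P dvd e x" if "x \<in> F" for x using odd_all not_dvd r(3,4) N that by auto
  have no1: "\<not> (\<forall>x\<in>F. e x = 0)" using odd_e(1) F(2) by fastforce
  have no3: "\<not> (\<forall>x\<in>F. x [^] (2 * e x) = \<one>)"
  proof
    assume "\<forall>x\<in>F. x [^] (2 * e x) = \<one>"
    moreover obtain x where x: "x \<in> F" using F(2) by blast
    moreover from this have "x \<in> carrier G" using FG by auto
    ultimately have "2 * P dvd 2 * e x" using int_pow_eq_id[of x "2 * e x"] ordx[of x] by (simp add: I_def)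
    then show False using odd_e(2)[OF x] by simp
  qed
  \<comment> \<open>The entries of \<open>e\<close> are nonzero, and their doubles are not divisible
    by \<open>2 * P\<close>, which leaves the alternative of one member.\<close>
  from r(5) no1 no3 obtain x where x: "x \<in> F" "\<forall>z\<in>F - {x}. e z = 0" by blast
  have xc: "x \<in> carrier G" using x FG by auto
  have "lincomb F e = x [^] e x" by (rule lincomb_single[OF F(1) x(1) FG(1)]) (use x in auto)
  then have "y \<otimes> x [^] e x = \<one>" using r(3,4) N sp[of e] FG by simp
  then have "y = inv (x [^] e x)" using inv_equality FG xc by (metis int_pow_closed)
  also have "\<dots> = x [^] (- e x)" using xc by (simp add: int_pow_neg)
  finally show ?thesis using generate_pow[OF xc] x(1) by auto
qed


text \<open>Otherwise \<open>U\<close> consists of terms killed by \<open>p\<close> and terms killed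
  by \<open>q\<close>. The sums of the two parts are opposite, hence trivial, so minimality leaves
  one part; then \<open>p\<close> or \<open>q\<close> would kill the whole group.\<close>

lemma ex_ord_mult:
  assumes pq: "Factorial_Ring.prime p" "Factorial_Ring.prime q" "(p::nat) \<noteq> q"
    and tors: "\<And>g. g \<in> carrier G \<Longrightarrow> g [^] (int p * int q) = \<one>"
    and full: "\<exists>g\<in>carrier G. g [^] int p \<noteq> \<one>" "\<exists>g\<in>carrier G. g [^] int q \<noteq> \<one>"
  shows "\<exists>x\<in>#U. ord x = p * q"
proof (rule ccontr)
  assume no: "\<not> ?thesis"
  have ords: "y [^] int p = \<one> \<or> y [^] int q = \<one>" if y: "y \<in># U" for y
  proof -
    have yc: "y \<in> carrier G" using y U_G by auto
    have "int (ord y) dvd int (p * q)" using tors[OF yc] int_pow_eq_id[OF yc] by simp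
    then have "ord y dvd p * q" by (simp only: int_dvd_int_iff)
    then obtain a b where ab: "ord y = a * b" "a dvd p" "b dvd q" using division_decomp by blast
    then have "a = 1 \<or> a = p" "b = 1 \<or> b = q" using pq prime_nat_iff by blast+
    then have "ord y dvd p \<or> ord y dvd q" using ab no y by auto
    then show ?thesis using int_pow_eq_id[OF yc] by simp
  qed
  define V where "V = filter_mset (\<lambda>y. y [^] int p = \<one>) U"
  define W where "W = filter_mset (\<lambda>y. y [^] int p \<noteq> \<one>) U"
  note D = minimal_zero_sum_seqD[OF U_minimal]
  have UVW: "U = V + W" by (simp add: V_def W_def)
  have cV: "set_mset V \<subseteq> carrier G" "set_mset W \<subseteq> carrier G" using U_G by (auto simp: V_def W_def)
  define a where "a = seq_sum G V"
  have ac: "a \<in> carrier G" "seq_sum G W \<in> carrier G" using cV by (auto simp: a_def)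
  have sub: "subgroup {g \<in> carrier G. g [^] k \<in> {\<one>}} G" for k :: int
    by (rule subgroup_power_preimage[OF subgroup_self triv_subgroup])
  have "a \<in> {g \<in> carrier G. g [^] int p \<in> {\<one>}}"
    unfolding a_def by (rule seq_sum_in_subgroup[OF sub]) (use cV in \<open>auto simp: V_def\<close>)
  then have ap: "a [^] int p = \<one>" by simp
  have "seq_sum G W \<in> {g \<in> carrier G. g [^] int q \<in> {\<one>}}"
    by (rule seq_sum_in_subgroup[OF sub]) (use cV ords in \<open>auto simp: W_def\<close>)
  then have Wq: "seq_sum G W [^] int q = \<one>" by simp
  have "a \<otimes> seq_sum G W = \<one>" using D(3) UVW cV by (simp add: a_def)
  then have "a = inv (seq_sum G W)" using ac inv_equality by metis
  then have "a [^] int q = \<one>" using Wq ac by (simp add: int_pow_inv)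
  then have "ord a dvd p" "ord a dvd q" using ap int_pow_eq_id[OF ac(1)] by simp_all
  moreover have "coprime p q" using pq primes_coprime by blast
  ultimately have "ord a = 1" using coprime_common_divisor_nat by blast
  then have "a = \<one>" using ord_eq_1[OF ac(1)] by simp
  then have "V = {#} \<or> V = U" using D(4)[of V] UVW by (simp add: a_def)
  then show False
  proof
    assume "V = {#}"
    then have "y \<notin># V" for y by simp
    then have "y [^] int q = \<one>" if "y \<in># U" for y
      using ords[OF that] that unfolding V_def by simp
    then have "g [^] int q = \<one>" if "g \<in> carrier G" for g
      using power_in_subgroup[OF triv_subgroup _ that, of "int q"] by blast
    then show False using full(2) by blast
  next
    assume "V = U"
    then have "y \<in># V" if "y \<in># U" for y using that by simp
    then have "y [^] int p = \<one>" if "y \<in># U" for y using that unfolding V_def by simp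
    then have "g [^] int p = \<one>" if "g \<in> carrier G" for g
      using power_in_subgroup[OF triv_subgroup _ that, of "int p"] by blast
    then show False using full(1) by blast
  qed
qed

text \<open>The exponent of \<open>t\<close> is invertible modulo \<open>p\<close>, since otherwise
  doubling would give a forbidden relation on \<open>F\<close> alone. Scaling by twice the inverse
  makes it 2; members with exponent divisible by \<open>p\<close> then drop out, as their order is
  \<open>2 * p\<close>.\<close>

lemma dependent_mod_relation:
  assumes p: "Factorial_Ring.prime (p::nat)" "odd p"
    and F: "finite F" "F \<subseteq> carrier G" "independent_mod p F" "\<And>x. x \<in> F \<Longrightarrow> ord x = 2 * p"
    and t: "t \<in> carrier G" "t \<notin> F" "ord t = 2 * p" "\<not> independent_mod p (insert t F)"
  shows "\<exists>u E. E \<subseteq> F \<and> E \<noteq> {} \<and> lincomb (insert t E) (\<lambda>x. 2 * u x) = \<one> \<and> u t = 1 \<and>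
    (\<forall>x\<in>E. \<not> int p dvd u x)"
proof -
  have pp: "Factorial_Ring.prime (int p)" using p(1) by simp
  have n2: "\<not> int p dvd 2"
    using p prime_gt_1_nat[OF p(1)] zdvd_imp_le[of "int p" 2] by (cases "p = 2") auto
  have sp: "lincomb (insert t F) u = t [^] u t \<otimes> lincomb F u" for u
    using lincomb_insert[OF F(1) t(2)] t(1) F(2) by simp
  have FG: "insert t F \<subseteq> carrier G" "finite (insert t F)" using t F by auto
  obtain u z where u: "lincomb (insert t F) u = \<one>" "z \<in> insert t F" "\<not> int p dvd u z"
    using t(4) unfolding independent_mod_def by blast
  have two: "x [^] (2 * k) = \<one>" if "int p dvd k" "x \<in> insert t F" for x k
  proof -
    have "x \<in> carrier G" "ord x = 2 * p" using that F t by auto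
    then show ?thesis using int_pow_eq_id[of x "2 * k"] that(1) by simp
  qed
  have pt: "\<not> int p dvd u t"
  proof
    assume dvd: "int p dvd u t"
    have "lincomb (insert t F) (\<lambda>x. 2 * u x) = \<one>" using lincomb_mult[OF FG, of 2 u] u(1) by (simp add: int_pow_one)
    then have "lincomb F (\<lambda>x. 2 * u x) = \<one>" using sp two[OF dvd, of t] F(2) by simp
    from independent_modD[OF F(3) this] have "int p dvd u x" if "x \<in> F" for x
      using that prime_dvd_mult_iff[OF pp] n2 by blast
    then show False using u(2,3) dvd by blast
  qed
  then have "coprime (int p) (u t)" using prime_imp_coprime[OF pp] by blast
  then obtain d c where cd: "d * int p + c * u t = 1" using bezout_int[of "int p" "u t"] by auto
  define v where "v x = (if x = t then 1 else c * u x)" for x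
  have "lincomb (insert t F) (\<lambda>x. (2 * c) * u x) = \<one>"
    using lincomb_mult[OF FG, of "2 * c" u] u(1) by (simp add: int_pow_one)
  then have e: "t [^] (2 * c * u t) \<otimes> lincomb F (\<lambda>x. 2 * c * u x) = \<one>" using sp by simp
  have "2 * c * u t = 2 + 2 * (- d * int p)" using cd by (simp add: algebra_simps)
  then have "t [^] (2 * c * u t) = t [^] (2::int) \<otimes> t [^] (2 * (- d * int p))"
    using int_pow_mult[OF t(1), of 2 "2 * (- d * int p)"] by simp
  moreover have "t [^] (2 * (- d * int p)) = \<one>" by (rule two) auto
  ultimately have tt: "t [^] (2 * c * u t) = t [^] (2::int)" using t(1) by simp
  have "lincomb F (\<lambda>x. 2 * c * u x) = lincomb F (\<lambda>x. 2 * v x)"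
    by (rule lincomb_cong[OF F(2)]) (use t(2) in \<open>auto simp: v_def\<close>)
  then have e2: "t [^] (2::int) \<otimes> lincomb F (\<lambda>x. 2 * v x) = \<one>" using e tt by simp
  define E where "E = {x \<in> F. \<not> int p dvd v x}"
  have E: "E \<subseteq> F" "finite E" "t \<notin> E" "insert t E \<subseteq> carrier G" using F t by (auto simp: E_def)
  have "lincomb F (\<lambda>x. 2 * v x) = lincomb E (\<lambda>x. 2 * v x)"
    by (rule lincomb_mono_neutral[OF F(1) E(1) F(2)]) (use two in \<open>auto simp: E_def\<close>)
  then have e3: "t [^] (2::int) \<otimes> lincomb E (\<lambda>x. 2 * v x) = \<one>" using e2 by simp
  show ?thesis
  proof (intro exI[of _ v] exI[of _ E] conjI ballI)
    show "E \<noteq> {}"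
    proof
      assume "E = {}"
      then have "t [^] (2::int) = \<one>" using e3 t(1) by (simp add: lincomb_def)
      then have "int (2 * p) dvd 2" using int_pow_eq_id[OF t(1), of 2] t(3) by simp
      then show False using n2 by (metis dvd_mult_right of_nat_mult)
    qed
    show "lincomb (insert t E) (\<lambda>x. 2 * v x) = \<one>"
      using lincomb_insert[OF E(2-4), of "\<lambda>x. 2 * v x"] e3 by (simp add: v_def)
  qed (use E in \<open>auto simp: E_def v_def\<close>)
qed

text \<open>For \<open>m = 2\<close> all terms have even order, namely \<open>2\<close> or
  \<open>2 * p\<close>. The terms of order \<open>2 * p\<close> lie on the lines of a largest
  \<open>p\<close>-independent family. Its lines may overlap at the prime 2, so \<open>Q\<close>
  keeps only the \<open>p\<close>-torsion of the span; splitting only asks for squares of terms,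
  which lie there.\<close>

lemma two_prime_False:
  assumes m: "m = 2" and p: "Factorial_Ring.prime (p::nat)" "odd p"
    and tors: "\<And>g. g \<in> carrier G \<Longrightarrow> g [^] (2 * int p) = \<one>"
    and big: "\<exists>y\<in>#U. 2 < ord y"
  shows False
proof -
  have p3: "2 < p" using p prime_gt_1_nat[OF p(1)] by (cases "p = 2") auto
  have ords: "ord y = 2 \<or> ord y = 2 * p" if y: "y \<in># U" for y
  proof -
    have yc: "y \<in> carrier G" "y \<in> A" using y U_G U_A by auto
    have "int (ord y) dvd int (2 * p)" using tors[OF yc(1)] int_pow_eq_id[OF yc(1)] by simp
    then have d: "ord y dvd 2 * p" by (simp only: int_dvd_int_iff)
    have "2 dvd int (ord y) - 2" using ord_mod[OF yc(2) finite_G] m by simp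
    then have "even (ord y)" by simp
    then obtain k where k: "ord y = 2 * k" by blast
    then have "k dvd p" using d by simp
    then show ?thesis using k p(1) prime_nat_iff by auto
  qed
  define \<F> where "\<F> = {F. F \<subseteq> {y \<in> set_mset U. ord y = 2 * p} \<and> independent_mod p F}"
  have fin\<F>: "finite \<F>" by (rule finite_subset[of _ "Pow (set_mset U)"]) (auto simp: \<F>_def)
  have "{} \<in> \<F>" by (auto simp: \<F>_def independent_mod_def)
  then have card\<F>: "finite (card ` \<F>)" "card ` \<F> \<noteq> {}" using fin\<F> by auto
  obtain F where F\<F>: "F \<in> \<F>" "card F = Max (card ` \<F>)" using Max_in[OF card\<F>] by auto
  then have max: "card E \<le> card F" if "E \<in> \<F>" for E using Max_ge[OF card\<F>(1)] that by auto
  have F: "F \<subseteq> set_mset U" "independent_mod p F" "\<And>x. x \<in> F \<Longrightarrow> ord x = 2 * p" using F\<F> by (auto simp: \<F>_def)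
  have fin: "finite F" using F(1) finite_subset by blast
  have FG: "F \<subseteq> carrier G" "F \<subseteq> A" using F U_G U_A by auto
  have line: "\<exists>x\<in>F. t \<in> generate G {x}" if t: "t \<in># U" "ord t = 2 * p" for t
  proof (cases "t \<in> F")
    case True
    then show ?thesis using generate.incl[of t "{t}" G] by blast
  next
    case False
    have tc: "t \<in> carrier G" "t \<in> A" using t U_G U_A by auto
    have "insert t F \<notin> \<F>" using max[of "insert t F"] False fin by auto
    then have "\<not> independent_mod p (insert t F)" using t F by (auto simp: \<F>_def)
    then obtain u E where E: "E \<subseteq> F" "E \<noteq> {}" "lincomb (insert t E) (\<lambda>x. 2 * u x) = \<one>" "u t = 1"
      "\<And>x. x \<in> E \<Longrightarrow> \<not> int p dvd u x"
      using dependent_mod_relation[OF p fin FG(1) F(2,3) tc(1) False t(2)] by blast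
    have "finite E" using E(1) fin finite_subset by blast
    then have "\<exists>x\<in>E. t \<in> generate G {x}"
    proof (rule line_of_dependent[OF m p _ E(2) _ _ _ tc(2) _ t(2) E(3-5)])
      show "independent_mod p E" using independent_mod_subset[OF fin FG(1) E(1) F(2)] .
      show "E \<subseteq> A" "t \<notin> E" using E(1) FG False by auto
      show "ord x = 2 * p" if "x \<in> E" for x using that E(1) F(3) by auto
    qed
    then show ?thesis using E(1) by blast
  qed
  obtain y where y: "y \<in># U" "2 < ord y" using big by blast
  then obtain x where x: "x \<in> F" using line ords[of y] by auto
  have xc: "x \<in> carrier G" "F - {x} \<subseteq> carrier G" "finite (F - {x})" using x FG fin by auto
  have sg: "subgroup (span (F - {x})) G" using subgroup_span xc by blast
  define Q where "Q = {a \<in> span (F - {x}). a [^] int p \<in> {\<one>}}"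
  have sgQ: "subgroup Q G" unfolding Q_def by (rule subgroup_power_preimage[OF sg triv_subgroup])
  show False
  proof (rule split_False[OF _ _ sgQ])
    show "x \<in># U" "2 < ord x" using x F p3 by auto
    show "generate G {x} \<inter> Q \<subseteq> {\<one>}"
    proof
      fix a assume a: "a \<in> generate G {x} \<inter> Q"
      then obtain e where e: "lincomb F e = \<one>" "a = x [^] (- e x)"
        using generate_inter_span_relation[OF fin FG(1) x] by (auto simp: Q_def)
      define k where "k = - e x"
      have ke: "a = x [^] k" using e(2) by (simp add: k_def)
      from independent_modD[OF F(2) e(1) x] have pk: "int p dvd k" by (simp add: k_def)
      have "x [^] (k * int p) = \<one>" using a ke xc(1) by (simp add: Q_def int_pow_pow)
      then have "int (2 * p) dvd k * int p" using int_pow_eq_id[OF xc(1)] F(3)[OF x] by simp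
      then have "even k" using p3 by (simp add: mult.commute)
      moreover have "coprime 2 (int p)" using p(2) by (simp add: coprime_left_2_iff_odd)
      ultimately have "2 * int p dvd k" using divides_mult pk by blast
      then show "a \<in> {\<one>}" using ke int_pow_eq_id[OF xc(1), of k] F(3)[OF x] by simp
    qed
    fix t assume t: "t \<in># U"
    have tc: "t \<in> carrier G" using t U_G by auto
    have t2: "t \<otimes> t = t [^] (2::int)" using int_pow_mult[OF tc, of 1 1] tc by simp
    have tp: "(t \<otimes> t) [^] int p = \<one>" using t2 tors[OF tc] tc by (simp add: int_pow_pow)
    from ords[OF t] show "t \<in> generate G {x} \<or> t \<otimes> t \<in> Q"
    proof
      assume "ord t = 2"
      then have "t \<otimes> t = \<one>" using t2 int_pow_eq_id[OF tc, of 2] by simp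
      then show ?thesis using subgroup.one_closed[OF sgQ] by simp
    next
      assume "ord t = 2 * p"
      then obtain z where z: "z \<in> F" "t \<in> generate G {z}" using line[OF t] by blast
      show ?thesis
      proof (cases "z = x")
        case False
        have "z \<in> carrier G" "z \<in> span (F - {x})" using z FG span_incl[OF xc(3,2), of z] False by auto
        then have "t \<in> span (F - {x})" using z(2) generate_pow[of z] int_pow_in_subgroup[OF sg] by auto
        then show ?thesis using tp subgroup.m_closed[OF sg] by (simp add: Q_def)
      qed (use z in simp)
    qed
  qed
qed

end

section \<open>Direct powers of cyclic groups\<close>

lemma eq_if_dvd_diff:
  fixes n a b :: int
  assumes "n dvd a - b" "0 \<le> a" "a < n" "0 \<le> b" "b < n"
  shows "a = b"
  using assms by (metis mod_eq_dvd_iff mod_pos_pos_trivial)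

lemma carrier_cyclic_power:
  "0 < n \<Longrightarrow> carrier (cyclic_power n r) = (\<Pi>\<^sub>E i\<in>{..<r}. {0..<int n})"
  by (simp add: cyclic_power_def carrier_integer_mod_group)

lemma group_cyclic_power [simp]: "group (cyclic_power n r)"
  by (simp add: cyclic_power_def)

lemma one_cyclic_power: "i < r \<Longrightarrow> \<one>\<^bsub>cyclic_power n r\<^esub> i = 0"
  by (simp add: cyclic_power_def)

lemma mult_cyclic_power:
  "i < r \<Longrightarrow> (u \<otimes>\<^bsub>cyclic_power n r\<^esub> v) i = (u i + v i) mod int n"
  by (simp add: cyclic_power_def)

lemma cyclic_power_eqI:
  assumes "0 < n" "u \<in> carrier (cyclic_power n r)" "v \<in> carrier (cyclic_power n r)"
    and "\<And>i. i < r \<Longrightarrow> u i = v i"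
  shows "u = v"
  using assms by (auto simp: carrier_cyclic_power intro: PiE_ext)

lemma pow_cyclic_power:
  assumes "u \<in> carrier (cyclic_power n r)" "i < r"
  shows "(u [^]\<^bsub>cyclic_power n r\<^esub> (k::int)) i = (k * u i) mod int n"
proof -
  have "(\<lambda>v. v i) \<in> hom (cyclic_power n r) (integer_mod_group n)"
    using assms(2) by (auto simp: hom_def cyclic_power_def)
  from hom_int_pow[OF this, of u k] assms(1) show ?thesis
    by (simp add: int_pow_integer_mod_group)
qed

lemma pow_cyclic_power_eq_iff:
  assumes "0 < n" "u \<in> carrier (cyclic_power n r)" "w \<in> carrier (cyclic_power n r)"
  shows "u [^]\<^bsub>cyclic_power n r\<^esub> (k::int) = w \<longleftrightarrow> (\<forall>i<r. (k * u i) mod int n = w i)"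
proof
  assume *: "\<forall>i<r. (k * u i) mod int n = w i"
  show "u [^]\<^bsub>cyclic_power n r\<^esub> k = w"
    by (rule cyclic_power_eqI[OF assms(1) group.int_pow_closed[OF group_cyclic_power assms(2)] assms(3)])
      (use pow_cyclic_power[OF assms(2)] * in simp)
next
  assume e: "u [^]\<^bsub>cyclic_power n r\<^esub> k = w"
  show "\<forall>i<r. (k * u i) mod int n = w i"
    unfolding e[symmetric] by (simp add: pow_cyclic_power[OF assms(2)])
qed

lemma card_cyclic_power: "0 < n \<Longrightarrow> card (carrier (cyclic_power n r)) = n ^ r"
  by (simp add: carrier_cyclic_power card_PiE)

text \<open>Coordinates are concatenated. This serves to recognize a sum of two elementary 2-groups
  as one.\<close>

lemma cyclic_power_DirProd:
  assumes "0 < n"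
  shows "cyclic_power n r \<times>\<times> cyclic_power n s \<cong> cyclic_power n (r + s)"
proof -
  define f where "f = (\<lambda>(u, v). \<lambda>i\<in>{..<r + s}. if i < r then u i else (v (i - r) :: int))"
  let ?H = "cyclic_power n r \<times>\<times> cyclic_power n s" and ?K = "cyclic_power n (r + s)"
  note car = carrier_cyclic_power[OF assms]
  have f_in: "f (u, v) \<in> carrier ?K" if "u \<in> carrier (cyclic_power n r)" "v \<in> carrier (cyclic_power n s)" for u v
    using that unfolding car f_def by (auto simp: PiE_iff)
  have "f \<in> hom ?H ?K"
  proof (rule homI)
    fix x y assume "x \<in> carrier ?H" "y \<in> carrier ?H"
    then obtain u v u' v' where xy: "x = (u, v)" "y = (u', v')"
      "u \<in> carrier (cyclic_power n r)" "v \<in> carrier (cyclic_power n s)"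
      "u' \<in> carrier (cyclic_power n r)" "v' \<in> carrier (cyclic_power n s)" by auto
    have c: "u \<otimes>\<^bsub>cyclic_power n r\<^esub> u' \<in> carrier (cyclic_power n r)"
      "v \<otimes>\<^bsub>cyclic_power n s\<^esub> v' \<in> carrier (cyclic_power n s)"
      using xy monoid.m_closed[OF group.is_monoid[OF group_cyclic_power]] by blast+
    show "f (x \<otimes>\<^bsub>?H\<^esub> y) = f x \<otimes>\<^bsub>?K\<^esub> f y"
    proof (rule cyclic_power_eqI[OF assms])
      show "f x \<otimes>\<^bsub>?K\<^esub> f y \<in> carrier ?K"
        using xy f_in monoid.m_closed[OF group.is_monoid[OF group_cyclic_power]] by blast
      show "f (x \<otimes>\<^bsub>?H\<^esub> y) i = (f x \<otimes>\<^bsub>?K\<^esub> f y) i" if "i < r + s" for i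
        using that xy by (auto simp: f_def mult_cyclic_power)
    qed (use xy c f_in in simp)
  qed (use f_in in auto)
  moreover have "bij_betw f (carrier ?H) (carrier ?K)"
  proof -
    define g where "g w = (\<lambda>i\<in>{..<r}. w i, \<lambda>i\<in>{..<s}. w (i + r))" for w :: "nat \<Rightarrow> int"
    have g_in: "fst (g w) \<in> carrier (cyclic_power n r)" "snd (g w) \<in> carrier (cyclic_power n s)"
      if "w \<in> carrier ?K" for w
      using that unfolding car g_def by (auto simp: PiE_iff)
    have "g (f (u, v)) = (u, v)" if uv: "u \<in> carrier (cyclic_power n r)" "v \<in> carrier (cyclic_power n s)" for u v
    proof (rule prod_eqI)
      show "fst (g (f (u, v))) = fst (u, v)"
        by (rule cyclic_power_eqI[OF assms g_in(1)[OF f_in[OF uv]]]) (use uv in \<open>simp_all add: g_def f_def\<close>)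
      show "snd (g (f (u, v))) = snd (u, v)"
        by (rule cyclic_power_eqI[OF assms g_in(2)[OF f_in[OF uv]]]) (use uv in \<open>simp_all add: g_def f_def\<close>)
    qed
    moreover have "f (g w) = w" if w: "w \<in> carrier ?K" for w
    proof (rule cyclic_power_eqI[OF assms _ w])
      show "f (g w) \<in> carrier ?K" using f_in[OF g_in[OF w]] by simp
      show "f (g w) i = w i" if "i < r + s" for i using that by (auto simp: f_def g_def)
    qed
    moreover have "g w \<in> carrier ?H" if "w \<in> carrier ?K" for w
      using g_in[OF that] by (simp add: mem_Times_iff)
    then have "g ` carrier ?K \<subseteq> carrier ?H" by blast
    moreover have "f ` carrier ?H \<subseteq> carrier ?K" using f_in by auto
    ultimately show ?thesis by (intro bij_betw_byWitness[of _ g]) auto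
  qed
  ultimately show ?thesis unfolding is_iso_def iso_def by blast
qed

text \<open>
  The last two conditions say that a nonzero element of order \<open>P\<close> has height at least \<open>s\<^sub>1 - 1\<close>, and
  height at least \<open>s\<^sub>2 - 1\<close> as soon as its height is at least \<open>s\<^sub>1\<close>.
\<close>

definition two_layered :: "('a, 'b) monoid_scheme \<Rightarrow> int \<Rightarrow> nat \<Rightarrow> nat \<Rightarrow> bool"
  where "two_layered K P s\<^sub>1 s\<^sub>2 \<longleftrightarrow>
    (\<forall>g\<in>carrier K. g [^]\<^bsub>K\<^esub> (P ^ s\<^sub>2) = \<one>\<^bsub>K\<^esub>) \<and>
    (\<exists>g\<in>carrier K. g [^]\<^bsub>K\<^esub> (P ^ (s\<^sub>2 - 1)) \<noteq> \<one>\<^bsub>K\<^esub>) \<and>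
    (\<forall>g\<in>carrier K. g [^]\<^bsub>K\<^esub> P = \<one>\<^bsub>K\<^esub> \<longrightarrow> (\<exists>h\<in>carrier K. g = h [^]\<^bsub>K\<^esub> (P ^ (s\<^sub>1 - 1)))) \<and>
    (\<forall>g\<in>carrier K. g [^]\<^bsub>K\<^esub> (P ^ Suc s\<^sub>1) = \<one>\<^bsub>K\<^esub> \<longrightarrow>
      (\<exists>h\<in>carrier K. g [^]\<^bsub>K\<^esub> (P ^ s\<^sub>1) = h [^]\<^bsub>K\<^esub> (P ^ (s\<^sub>2 - 1))))"

lemma two_layered_iso:
  assumes "group G" "group K" "G \<cong> K" "two_layered K P s\<^sub>1 s\<^sub>2"
  shows "two_layered G P s\<^sub>1 s\<^sub>2"
proof -
  obtain f where f: "f \<in> hom G K" "bij_betw f (carrier G) (carrier K)"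
    using assms(3) by (auto simp: is_iso_def iso_def)
  have fc: "f g \<in> carrier K" if "g \<in> carrier G" for g using that f(2) bij_betwE by blast
  have inj: "f g = f h \<longleftrightarrow> g = h" if "g \<in> carrier G" "h \<in> carrier G" for g h
    using that f(2) by (auto simp: bij_betw_def inj_on_eq_iff)
  have pow: "f (g [^]\<^bsub>G\<^esub> k) = f g [^]\<^bsub>K\<^esub> k" if "g \<in> carrier G" for g and k :: int
    using hom_int_pow[OF f(1) that assms(1,2)] .
  have one: "f \<one>\<^bsub>G\<^esub> = \<one>\<^bsub>K\<^esub>" using hom_one[OF f(1) assms(1,2)] .
  have pc: "g [^]\<^bsub>G\<^esub> k \<in> carrier G" if "g \<in> carrier G" for g and k :: int
    using group.int_pow_closed[OF assms(1) that] .
  have oc: "\<one>\<^bsub>G\<^esub> \<in> carrier G" using group.is_monoid[OF assms(1)] monoid.one_closed by blast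
  have eq1: "g [^]\<^bsub>G\<^esub> k = \<one>\<^bsub>G\<^esub> \<longleftrightarrow> f g [^]\<^bsub>K\<^esub> k = \<one>\<^bsub>K\<^esub>" if "g \<in> carrier G" for g and k :: int
    using inj[OF pc[OF that] oc] pow[OF that] one by simp
  have surj: "\<exists>g\<in>carrier G. f g = h" if "h \<in> carrier K" for h
    using that f(2) by (metis bij_betw_imp_surj_on imageE)
  have ex: "(\<exists>h\<in>carrier G. g [^]\<^bsub>G\<^esub> l = h [^]\<^bsub>G\<^esub> k) \<longleftrightarrow> (\<exists>h\<in>carrier K. f g [^]\<^bsub>K\<^esub> l = h [^]\<^bsub>K\<^esub> k)"
    if "g \<in> carrier G" for g and k l :: int
  proof
    assume "\<exists>h\<in>carrier G. g [^]\<^bsub>G\<^esub> l = h [^]\<^bsub>G\<^esub> k"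
    then obtain h where h: "h \<in> carrier G" "g [^]\<^bsub>G\<^esub> l = h [^]\<^bsub>G\<^esub> k" by blast
    then have "f g [^]\<^bsub>K\<^esub> l = f h [^]\<^bsub>K\<^esub> k" using pow[OF that, of l] pow[OF h(1), of k] by simp
    then show "\<exists>h\<in>carrier K. f g [^]\<^bsub>K\<^esub> l = h [^]\<^bsub>K\<^esub> k" using fc[OF h(1)] by blast
  next
    assume "\<exists>h\<in>carrier K. f g [^]\<^bsub>K\<^esub> l = h [^]\<^bsub>K\<^esub> k"
    then obtain h where h: "h \<in> carrier G" "f g [^]\<^bsub>K\<^esub> l = f h [^]\<^bsub>K\<^esub> k" using surj by blast
    then have "f (g [^]\<^bsub>G\<^esub> l) = f (h [^]\<^bsub>G\<^esub> k)" using pow[OF that, of l] pow[OF h(1), of k] by simp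
    then have "g [^]\<^bsub>G\<^esub> l = h [^]\<^bsub>G\<^esub> k" using inj[OF pc[OF that] pc[OF h(1)]] by blast
    then show "\<exists>h\<in>carrier G. g [^]\<^bsub>G\<^esub> l = h [^]\<^bsub>G\<^esub> k" using h(1) by blast
  qed
  have one_pow: "g [^]\<^bsub>G\<^esub> (1::int) = g" "f g [^]\<^bsub>K\<^esub> (1::int) = f g" if "g \<in> carrier G" for g
    using group.int_pow_1[OF assms(1) that] group.int_pow_1[OF assms(2) fc[OF that]] by simp_all
  have ex1: "(\<exists>h\<in>carrier G. g = h [^]\<^bsub>G\<^esub> k) \<longleftrightarrow> (\<exists>h\<in>carrier K. f g = h [^]\<^bsub>K\<^esub> k)"
    if "g \<in> carrier G" for g and k :: int using ex[OF that, of 1 k] one_pow[OF that] by simp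
  have K: "f g [^]\<^bsub>K\<^esub> (P ^ s\<^sub>2) = \<one>\<^bsub>K\<^esub>"
    "f g [^]\<^bsub>K\<^esub> P = \<one>\<^bsub>K\<^esub> \<Longrightarrow> \<exists>h\<in>carrier K. f g = h [^]\<^bsub>K\<^esub> (P ^ (s\<^sub>1 - 1))"
    "f g [^]\<^bsub>K\<^esub> (P ^ Suc s\<^sub>1) = \<one>\<^bsub>K\<^esub> \<Longrightarrow> \<exists>h\<in>carrier K. f g [^]\<^bsub>K\<^esub> (P ^ s\<^sub>1) = h [^]\<^bsub>K\<^esub> (P ^ (s\<^sub>2 - 1))"
    if "g \<in> carrier G" for g
    using assms(4) fc[OF that] unfolding two_layered_def by blast+
  obtain h where h: "h \<in> carrier G" "f h [^]\<^bsub>K\<^esub> (P ^ (s\<^sub>2 - 1)) \<noteq> \<one>\<^bsub>K\<^esub>"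
    using assms(4) surj unfolding two_layered_def by metis
  show ?thesis
    unfolding two_layered_def
  proof (intro conjI ballI impI)
    fix g assume g: "g \<in> carrier G"
    show "g [^]\<^bsub>G\<^esub> (P ^ s\<^sub>2) = \<one>\<^bsub>G\<^esub>" using K(1)[OF g] eq1[OF g] by simp
    show "\<exists>h\<in>carrier G. g = h [^]\<^bsub>G\<^esub> (P ^ (s\<^sub>1 - 1))" if "g [^]\<^bsub>G\<^esub> P = \<one>\<^bsub>G\<^esub>"
      unfolding ex1[OF g] by (rule K(2)[OF g that[unfolded eq1[OF g]]])
    show "\<exists>h\<in>carrier G. g [^]\<^bsub>G\<^esub> (P ^ s\<^sub>1) = h [^]\<^bsub>G\<^esub> (P ^ (s\<^sub>2 - 1))" if "g [^]\<^bsub>G\<^esub> (P ^ Suc s\<^sub>1) = \<one>\<^bsub>G\<^esub>"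
      unfolding ex[OF g] by (rule K(3)[OF g that[unfolded eq1[OF g]]])
  next
    show "\<exists>g\<in>carrier G. g [^]\<^bsub>G\<^esub> (P ^ (s\<^sub>2 - 1)) \<noteq> \<one>\<^bsub>G\<^esub>" using h eq1[OF h(1)] by blast
  qed
qed

lemma two_layered_cyclic_powers:
  fixes p :: nat
  assumes p: "1 < p" and r: "0 < r\<^sub>2" and s: "0 < s\<^sub>1" "s\<^sub>1 \<le> s\<^sub>2"
  shows "two_layered (cyclic_power (p ^ s\<^sub>1) r\<^sub>1 \<times>\<times> cyclic_power (p ^ s\<^sub>2) r\<^sub>2) (int p) s\<^sub>1 s\<^sub>2"
proof -
  let ?C = "cyclic_power (p ^ s\<^sub>1) r\<^sub>1" and ?D = "cyclic_power (p ^ s\<^sub>2) r\<^sub>2"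
  define P where "P = int p"
  have P: "1 < P" using p by (simp add: P_def)
  have n: "0 < p ^ s\<^sub>1" "0 < p ^ s\<^sub>2" using p by simp_all
  have nP: "int (p ^ s\<^sub>1) = P ^ s\<^sub>1" "int (p ^ s\<^sub>2) = P ^ s\<^sub>2" by (simp_all add: P_def)
  have carC: "carrier ?C = (\<Pi>\<^sub>E i\<in>{..<r\<^sub>1}. {0..<P ^ s\<^sub>1})" "carrier ?D = (\<Pi>\<^sub>E i\<in>{..<r\<^sub>2}. {0..<P ^ s\<^sub>2})"
    using carrier_cyclic_power[OF n(1)] carrier_cyclic_power[OF n(2)] nP by simp_all
  have pow: "(u, v) [^]\<^bsub>?C \<times>\<times> ?D\<^esub> (k::int) = (u [^]\<^bsub>?C\<^esub> k, v [^]\<^bsub>?D\<^esub> k)"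
    if "u \<in> carrier ?C" "v \<in> carrier ?D" for u v k
  proof -
    have "fst ((u, v) [^]\<^bsub>?C \<times>\<times> ?D\<^esub> k) = fst (u, v) [^]\<^bsub>?C\<^esub> k"
      by (rule hom_int_pow[of fst "?C \<times>\<times> ?D"]) (use that in \<open>auto simp: hom_def DirProd_group\<close>)
    moreover have "snd ((u, v) [^]\<^bsub>?C \<times>\<times> ?D\<^esub> k) = snd (u, v) [^]\<^bsub>?D\<^esub> k"
      by (rule hom_int_pow[of snd "?C \<times>\<times> ?D"]) (use that in \<open>auto simp: hom_def DirProd_group\<close>)
    ultimately show ?thesis by (simp add: prod_eq_iff)
  qed
  have pc: "u [^]\<^bsub>cyclic_power k r\<^esub> (l::int) \<in> carrier (cyclic_power k r)" if "u \<in> carrier (cyclic_power k r)" for u k r l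
    using group.int_pow_closed[OF group_cyclic_power that] .
  have oc: "\<one>\<^bsub>cyclic_power k r\<^esub> \<in> carrier (cyclic_power k r)" for k r
    using group.is_monoid[OF group_cyclic_power] monoid.one_closed by blast
  have eqC: "u [^]\<^bsub>?C\<^esub> (k::int) = w \<longleftrightarrow> (\<forall>i<r\<^sub>1. (k * u i) mod P ^ s\<^sub>1 = w i)"
    if "u \<in> carrier ?C" "w \<in> carrier ?C" for u w k
    by (simp only: pow_cyclic_power_eq_iff[OF n(1) that] nP)
  have eqD: "v [^]\<^bsub>?D\<^esub> (k::int) = w \<longleftrightarrow> (\<forall>i<r\<^sub>2. (k * v i) mod P ^ s\<^sub>2 = w i)"
    if "v \<in> carrier ?D" "w \<in> carrier ?D" for v w k
    by (simp only: pow_cyclic_power_eq_iff[OF n(2) that] nP)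
  have one: "(u, v) [^]\<^bsub>?C \<times>\<times> ?D\<^esub> (k::int) = \<one>\<^bsub>?C \<times>\<times> ?D\<^esub> \<longleftrightarrow>
      (\<forall>i<r\<^sub>1. P ^ s\<^sub>1 dvd k * u i) \<and> (\<forall>i<r\<^sub>2. P ^ s\<^sub>2 dvd k * v i)"
    if "u \<in> carrier ?C" "v \<in> carrier ?D" for u v k
  proof -
    have "(u, v) [^]\<^bsub>?C \<times>\<times> ?D\<^esub> k = \<one>\<^bsub>?C \<times>\<times> ?D\<^esub> \<longleftrightarrow> u [^]\<^bsub>?C\<^esub> k = \<one>\<^bsub>?C\<^esub> \<and> v [^]\<^bsub>?D\<^esub> k = \<one>\<^bsub>?D\<^esub>"
      unfolding pow[OF that] by simp
    then show ?thesis unfolding eqC[OF that(1) oc] eqD[OF that(2) oc]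
      by (simp only: one_cyclic_power mod_eq_0_iff_dvd cong: imp_cong)
  qed
  have cancel: "P ^ (s - 1) dvd a" if "P ^ s dvd P * a" "0 < s" for s a
  proof -
    have "P ^ s = P * P ^ (s - 1)" using that(2) by (cases s) auto
    then have "P * P ^ (s - 1) dvd P * a" using that(1) by (simp only:)
    then show ?thesis using P by (simp only: dvd_mult_cancel_left) auto
  qed
  have bnd: "0 \<le> a div P ^ k \<and> a div P ^ k < b" if "0 \<le> a" "a < b" for a b k
  proof -
    have "1 \<le> P ^ k" using P by (intro one_le_power) simp
    then have "a div P ^ k \<le> a" "0 \<le> a div P ^ k"
      using zdiv_mono2[OF that(1), of 1 "P ^ k"] pos_imp_zdiv_nonneg_iff[of "P ^ k" a] that(1) by auto
    then show ?thesis using that(2) by linarith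
  qed
  show ?thesis
    unfolding two_layered_def P_def[symmetric]
  proof (intro conjI ballI impI)
    fix g assume "g \<in> carrier (?C \<times>\<times> ?D)"
    then obtain u v where g: "g = (u, v)" and uv: "u \<in> carrier ?C" "v \<in> carrier ?D" by auto
    have u: "0 \<le> u i" "u i < P ^ s\<^sub>1" if "i < r\<^sub>1" for i using uv(1) that unfolding carC by (auto simp: PiE_iff)
    have v: "0 \<le> v i" "v i < P ^ s\<^sub>2" if "i < r\<^sub>2" for i using uv(2) that unfolding carC by (auto simp: PiE_iff)
    have "P ^ s\<^sub>1 dvd P ^ s\<^sub>2" using s(2) by (rule le_imp_power_dvd)
    then show "g [^]\<^bsub>?C \<times>\<times> ?D\<^esub> (P ^ s\<^sub>2) = \<one>\<^bsub>?C \<times>\<times> ?D\<^esub>"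
      unfolding g one[OF uv] by (simp add: dvd_mult2)
    {
      assume "g [^]\<^bsub>?C \<times>\<times> ?D\<^esub> P = \<one>\<^bsub>?C \<times>\<times> ?D\<^esub>"
      then have "\<forall>i<r\<^sub>1. P ^ s\<^sub>1 dvd P * u i" "\<forall>i<r\<^sub>2. P ^ s\<^sub>2 dvd P * v i" unfolding g one[OF uv] by auto
      then have du: "P ^ (s\<^sub>1 - 1) dvd u i" if "i < r\<^sub>1" for i using cancel[of s\<^sub>1] s that by blast
      have "P ^ (s\<^sub>2 - 1) dvd v i" if "i < r\<^sub>2" for i
        using cancel[of s\<^sub>2] s that \<open>\<forall>i<r\<^sub>2. P ^ s\<^sub>2 dvd P * v i\<close> by simp
      moreover have "P ^ (s\<^sub>1 - 1) dvd P ^ (s\<^sub>2 - 1)" using s by (intro le_imp_power_dvd) simp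
      ultimately have dv: "P ^ (s\<^sub>1 - 1) dvd v i" if "i < r\<^sub>2" for i using that dvd_trans by blast
      \<comment> \<open>Each coordinate is divisible by \<open>P ^ (s\<^sub>1 - 1)\<close>, so a
        root is found by dividing coordinatewise.\<close>
      define u' where "u' = (\<lambda>i\<in>{..<r\<^sub>1}. u i div P ^ (s\<^sub>1 - 1))"
      define v' where "v' = (\<lambda>i\<in>{..<r\<^sub>2}. v i div P ^ (s\<^sub>1 - 1))"
      have c: "u' \<in> carrier ?C" "v' \<in> carrier ?D"
        unfolding carC u'_def v'_def by (simp_all add: PiE_iff bnd[OF u] bnd[OF v])
      have "P ^ (s\<^sub>1 - 1) * u' i mod P ^ s\<^sub>1 = u i" if "i < r\<^sub>1" for i
      proof -
        have "P ^ (s\<^sub>1 - 1) * u' i = u i" using du[OF that] that by (simp add: u'_def)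
        then show ?thesis using u[OF that] by (simp only: mod_pos_pos_trivial)
      qed
      moreover have "P ^ (s\<^sub>1 - 1) * v' i mod P ^ s\<^sub>2 = v i" if "i < r\<^sub>2" for i
      proof -
        have "P ^ (s\<^sub>1 - 1) * v' i = v i" using dv[OF that] that by (simp add: v'_def)
        then show ?thesis using v[OF that] by (simp only: mod_pos_pos_trivial)
      qed
      ultimately have "u' [^]\<^bsub>?C\<^esub> (P ^ (s\<^sub>1 - 1)) = u" "v' [^]\<^bsub>?D\<^esub> (P ^ (s\<^sub>1 - 1)) = v"
        unfolding eqC[OF c(1) uv(1)] eqD[OF c(2) uv(2)] by blast+
      then show "\<exists>h\<in>carrier (?C \<times>\<times> ?D). g = h [^]\<^bsub>?C \<times>\<times> ?D\<^esub> (P ^ (s\<^sub>1 - 1))"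
        using c g pow[OF c] by (intro bexI[of _ "(u', v')"]) auto
    }
    {
      assume "g [^]\<^bsub>?C \<times>\<times> ?D\<^esub> (P ^ Suc s\<^sub>1) = \<one>\<^bsub>?C \<times>\<times> ?D\<^esub>"
      then have "P ^ s\<^sub>2 dvd P * (P ^ s\<^sub>1 * v i)" if "i < r\<^sub>2" for i
        using that unfolding g one[OF uv] by (simp add: mult.assoc)
      then have "P ^ (s\<^sub>2 - 1) dvd P ^ s\<^sub>1 * v i" if "i < r\<^sub>2" for i
        using cancel[of s\<^sub>2] s that by simp
      then have "\<forall>i. \<exists>c. i < r\<^sub>2 \<longrightarrow> P ^ s\<^sub>1 * v i = P ^ (s\<^sub>2 - 1) * c" by (auto elim: dvdE)
      then obtain c where c: "\<And>i. i < r\<^sub>2 \<Longrightarrow> P ^ s\<^sub>1 * v i = P ^ (s\<^sub>2 - 1) * c i" by metis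
      \<comment> \<open>The power \<open>P ^ s\<^sub>1\<close> kills the first factor, where the
        unit serves as root; in the second factor the coordinates are multiples of
        \<open>P ^ (s\<^sub>2 - 1)\<close>.\<close>
      define v' where "v' = (\<lambda>i\<in>{..<r\<^sub>2}. c i mod P ^ s\<^sub>2)"
      have v': "v' \<in> carrier ?D" unfolding carC v'_def using P by (auto simp: PiE_iff)
      have "P ^ (s\<^sub>2 - 1) * v' i mod P ^ s\<^sub>2 = (v [^]\<^bsub>?D\<^esub> (P ^ s\<^sub>1)) i" if "i < r\<^sub>2" for i
        unfolding pow_cyclic_power[OF uv(2) that] nP c[OF that] v'_def
        using that by (simp add: mod_mult_right_eq)
      then have "v' [^]\<^bsub>?D\<^esub> (P ^ (s\<^sub>2 - 1)) = v [^]\<^bsub>?D\<^esub> (P ^ s\<^sub>1)"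
        unfolding eqD[OF v' pc[OF uv(2)]] by blast
      moreover have "P ^ (s\<^sub>2 - 1) * \<one>\<^bsub>?C\<^esub> i mod P ^ s\<^sub>1 = (u [^]\<^bsub>?C\<^esub> (P ^ s\<^sub>1)) i" if "i < r\<^sub>1" for i
        unfolding pow_cyclic_power[OF uv(1) that] nP one_cyclic_power[OF that] by simp
      then have "\<one>\<^bsub>?C\<^esub> [^]\<^bsub>?C\<^esub> (P ^ (s\<^sub>2 - 1)) = u [^]\<^bsub>?C\<^esub> (P ^ s\<^sub>1)"
        unfolding eqC[OF oc pc[OF uv(1)]] by blast
      ultimately show "\<exists>h\<in>carrier (?C \<times>\<times> ?D). g [^]\<^bsub>?C \<times>\<times> ?D\<^esub> (P ^ s\<^sub>1) = h [^]\<^bsub>?C \<times>\<times> ?D\<^esub> (P ^ (s\<^sub>2 - 1))"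
        using v' oc g pow[OF uv] pow[OF oc v'] by (intro bexI[of _ "(\<one>\<^bsub>?C\<^esub>, v')"]) auto
    }
  next
    \<comment> \<open>An element of full order \<open>P ^ s\<^sub>2\<close>; it has a coordinate
      because \<open>r\<^sub>2\<close> is positive.\<close>
    define v where "v = (\<lambda>i\<in>{..<r\<^sub>2}. 1::int)"
    have "1 < P ^ s\<^sub>2" using P s by (simp add: one_less_power)
    then have v: "v \<in> carrier ?D" unfolding carC by (auto simp: v_def)
    have "\<not> P ^ s\<^sub>2 dvd P ^ (s\<^sub>2 - 1)"
    proof -
      have "P ^ (s\<^sub>2 - 1) < P ^ s\<^sub>2" using P s by (intro power_strict_increasing) auto
      then show ?thesis using P by (simp add: zdvd_not_zless)
    qed
    then have "(\<one>\<^bsub>?C\<^esub>, v) [^]\<^bsub>?C \<times>\<times> ?D\<^esub> (P ^ (s\<^sub>2 - 1)) \<noteq> \<one>\<^bsub>?C \<times>\<times> ?D\<^esub>"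
      unfolding one[OF oc v] using r by (auto simp: v_def)
    then show "\<exists>g\<in>carrier (?C \<times>\<times> ?D). g [^]\<^bsub>?C \<times>\<times> ?D\<^esub> (P ^ (s\<^sub>2 - 1)) \<noteq> \<one>\<^bsub>?C \<times>\<times> ?D\<^esub>"
      using oc v by (intro bexI[of _ "(\<one>\<^bsub>?C\<^esub>, v)"]) auto
  qed
qed

context comm_group
begin

lemma mult_eq_imp_div_eq:
  assumes "a \<in> carrier G" "b \<in> carrier G" "c \<in> carrier G" "d \<in> carrier G" "a \<otimes> b = c \<otimes> d"
  shows "a \<otimes> inv c = d \<otimes> inv b"
proof -
  have "a = c \<otimes> d \<otimes> inv b" using assms inv_solve_right by (metis m_closed)
  also have "\<dots> = (d \<otimes> inv b) \<otimes> c" using assms by (simp add: m_ac)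
  finally show ?thesis using assms inv_solve_right' by (metis inv_closed m_closed)
qed

text \<open>Pairs of exponents of \<open>a\<close> and \<open>b\<close> embed the square of the
  cyclic group. As \<open>p_rank\<close> is a \<open>Max\<close>, the ranks must also be bounded,
  which follows from \<open>r < 2 ^ r <= card K\<close>.\<close>

lemma p_rank_ge_2:
  assumes fin: "finite (carrier G)" and p: "Factorial_Ring.prime (p::nat)"
    and ab: "a \<in> carrier G" "b \<in> carrier G" "ord a = p" "ord b = p" "a \<notin> generate G {b}"
  shows "2 \<le> p_rank p G"
proof -
  let ?C = "cyclic_power p 2"
  have p1: "1 < p" using prime_gt_1_nat[OF p] .
  define f where "f v = a [^] (v 0 :: int) \<otimes> b [^] (v 1 :: int)" for v :: "nat \<Rightarrow> int"
  define H where "H = f ` carrier ?C"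
  have car: "carrier ?C = (\<Pi>\<^sub>E i\<in>{..<2}. {0..<int p})" using carrier_cyclic_power p1 by simp
  have rng: "0 \<le> v 0 \<and> v 0 < int p \<and> 0 \<le> v 1 \<and> v 1 < int p" if "v \<in> carrier ?C" for v
    using that unfolding car by (auto simp: PiE_iff)
  have pow_mod: "x [^] (k mod int p) = x [^] (k::int)" if "x \<in> carrier G" "ord x = p" for x k
  proof -
    have "x [^] (int p * (k div int p)) = \<one>" using int_pow_eq_id[OF that(1)] that(2) by simp
    moreover have "k = k mod int p + int p * (k div int p)" by simp
    ultimately show ?thesis using int_pow_mult[OF that(1), of "k mod int p" "int p * (k div int p)"] that(1) by simp
  qed
  have gb: "subgroup (generate G {b}) G" using generate_is_subgroup ab by auto
  have fhom: "f (u \<otimes>\<^bsub>?C\<^esub> v) = f u \<otimes> f v" for u v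
    using ab by (simp add: f_def mult_cyclic_power pow_mod int_pow_mult m_ac)
  have fG: "f v \<in> carrier G" for v using ab by (simp add: f_def)
  have inj: "inj_on f (carrier ?C)"
  proof (rule inj_onI)
    fix u v assume uv: "u \<in> carrier ?C" "v \<in> carrier ?C" "f u = f v"
    have "a [^] u 0 \<otimes> b [^] u 1 = a [^] v 0 \<otimes> b [^] v 1" using uv(3) by (simp add: f_def)
    then have eq: "a [^] (u 0 - v 0) = b [^] (v 1 - u 1)"
      using ab mult_eq_imp_div_eq[of "a [^] u 0" "b [^] u 1" "a [^] v 0" "b [^] v 1"] by (simp add: int_pow_diff)
    have "int p dvd u 0 - v 0"
    proof (rule ccontr)
      assume "\<not> int p dvd u 0 - v 0"
      then have "coprime (int p) (u 0 - v 0)" using p by (intro prime_imp_coprime) simp_all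
      \<comment> \<open>An exponent of \<open>a\<close> prime to \<open>p\<close> could be inverted,
        which would express \<open>a\<close> by \<open>b\<close>.\<close>
      then obtain d c where cd: "d * int p + c * (u 0 - v 0) = 1" using bezout_int[of "int p" "u 0 - v 0"] by auto
      have "a [^] (int p * d) = \<one>" using int_pow_eq_id[OF ab(1)] ab(3) by simp
      then have "a [^] (d * int p + c * (u 0 - v 0)) = (a [^] (u 0 - v 0)) [^] c"
        using ab by (simp add: int_pow_mult int_pow_pow mult.commute)
      then have "a = (a [^] (u 0 - v 0)) [^] c" unfolding cd using ab by simp
      also have "\<dots> = b [^] ((v 1 - u 1) * c)" using ab eq by (simp add: int_pow_pow)
      also have "\<dots> \<in> generate G {b}" using generate_pow[OF ab(2)] by auto
      finally show False using ab(5) by simp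
    qed
    then have e0: "u 0 = v 0" using rng[OF uv(1)] rng[OF uv(2)] by (intro eq_if_dvd_diff) auto
    then have "b [^] (v 1 - u 1) = \<one>" using eq by simp
    then have "int p dvd v 1 - u 1" using int_pow_eq_id[OF ab(2)] ab(4) by simp
    then have "v 1 = u 1" using rng[OF uv(1)] rng[OF uv(2)] by (intro eq_if_dvd_diff) auto
    with e0 show "u = v" using uv p1 by (intro cyclic_power_eqI[of p u 2 v]) (auto simp: less_2_cases_iff)
  qed
  have sgH: "subgroup H G"
  proof -
    have "group_hom ?C G f"
      by (intro group_hom.intro group_hom_axioms.intro homI) (use fhom fG in auto)
    from group_hom.img_is_subgroup[OF this] show ?thesis by (simp add: H_def)
  qed
  have "f \<in> iso ?C (G\<lparr>carrier := H\<rparr>)"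
    using inj fhom by (auto simp: iso_def hom_def bij_betw_def H_def)
  then have "G\<lparr>carrier := H\<rparr> \<cong> ?C"
    using group.iso_sym[OF group_cyclic_power] is_iso_def by blast
  then have 2: "2 \<in> {r. \<exists>H. subgroup H G \<and> G\<lparr>carrier := H\<rparr> \<cong> cyclic_power p r}" using sgH by blast
  have "{r. \<exists>H. subgroup H G \<and> G\<lparr>carrier := H\<rparr> \<cong> cyclic_power p r} \<subseteq> {..card (carrier G)}"
  proof
    fix r assume "r \<in> {r. \<exists>H. subgroup H G \<and> G\<lparr>carrier := H\<rparr> \<cong> cyclic_power p r}"
    then obtain K where K: "subgroup K G" "G\<lparr>carrier := K\<rparr> \<cong> cyclic_power p r" by blast
    have "r < 2 ^ r" by (rule less_exp)
    also have "\<dots> \<le> p ^ r" using p1 by (intro power_mono) auto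
    also have "\<dots> = card K" using iso_same_card[OF K(2)] card_cyclic_power[of p r] p1 by simp
    also have "\<dots> \<le> card (carrier G)" using subgroup.subset[OF K(1)] fin by (simp add: card_mono)
    finally show "r \<in> {..card (carrier G)}" by simp
  qed
  then have "finite {r. \<exists>H. subgroup H G \<and> G\<lparr>carrier := H\<rparr> \<cong> cyclic_power p r}" using finite_subset by blast
  then show ?thesis unfolding p_rank_def using 2 by (rule Max_ge)
qed

end

section \<open>Exponent and Davenport constant\<close>

context comm_group
begin

lemma group_exponent:
  assumes "finite (carrier G)"
  shows "0 < group_exponent G" "g \<in> carrier G \<Longrightarrow> g [^] int (group_exponent G) = \<one>"
    and "0 < n \<Longrightarrow> (\<And>g. g \<in> carrier G \<Longrightarrow> g [^] int n = \<one>) \<Longrightarrow> group_exponent G \<le> n"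
proof -
  let ?Q = "\<lambda>n::nat. 0 < n \<and> (\<forall>g\<in>carrier G. g [^] n = \<one>)"
  have "?Q (order G)" using assms pow_order_eq_1 order_gt_0_iff_finite by blast
  then have "?Q (group_exponent G)" unfolding group_exponent_def by (rule LeastI)
  then show "0 < group_exponent G" "g \<in> carrier G \<Longrightarrow> g [^] int (group_exponent G) = \<one>"
    by (auto simp only: int_pow_int)
  show "group_exponent G \<le> n" if "0 < n" "\<And>g. g \<in> carrier G \<Longrightarrow> g [^] int n = \<one>"
    unfolding group_exponent_def by (rule Least_le) (use that in \<open>simp add: int_pow_int\<close>)
qed

lemma ex_pow_neq_one:
  assumes "finite (carrier G)" "0 < n" "n < group_exponent G"
  shows "\<exists>g\<in>carrier G. g [^] int n \<noteq> \<one>"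
  using group_exponent(3)[OF assms(1,2)] assms(3) by fastforce

end

section \<open>The individual hypotheses on the group\<close>

context longest_length_mod
begin

text \<open>\<open>U\<close> is encoded by its multiplicities. They are nonnegative, so conformal
  vectors encode subsequences faithfully, and \<open>f_uminus\<close> applies.\<close>

lemma size_U_mod: "m dvd int (size U) - 2"
proof -
  define I where "I = set_mset U"
  have I: "finite I" "I \<subseteq> A" "I \<subseteq> carrier G" using U_A U_G by (auto simp: I_def)
  interpret length_lattice I "\<lambda>e. lincomb I e = \<one>" "\<lambda>e. \<phi> (signed_seq I e)" m
    by (rule length_lattice[OF I(1,2)])
  have count_signed: "count (signed_seq I e) x = (if x \<in> I then nat (e x) else 0)" if "\<And>x. x \<in> I \<Longrightarrow> 0 \<le> e x" for e x
  proof -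
    have "count (signed_seq I e) x = (\<Sum>y\<in>I. if y = x then nat (e x) else 0)"
      unfolding signed_seq_def count_sum using that by (intro sum.cong) auto
    then show ?thesis using I(1) by simp
  qed
  define c where "c x = int (count U x)" for x
  have cU: "signed_seq I c = U"
    by (rule multiset_eqI, subst count_signed) (auto simp: c_def I_def not_in_iff)
  note D = minimal_zero_sum_seqD[OF U_minimal]
  have "minimal c"
    unfolding minimal_def
  proof (intro conjI allI impI)
    show "lincomb I c = \<one>" using D(3) seq_sum_signed_seq[OF I(1,3), of c] cU by simp
    obtain x where "x \<in># U" using D(2) by blast
    then show "\<exists>x\<in>I. c x \<noteq> 0" by (auto simp: I_def c_def)
    fix w assume w: "lincomb I w = \<one> \<and> conformal I w c"
    then have rng: "0 \<le> w x" "w x \<le> c x" if "x \<in> I" for x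
      using that unfolding conformal_def c_def by force+
    have cw: "count (signed_seq I w) x = (if x \<in> I then nat (w x) else 0)" for x
      by (rule count_signed) (rule rng)
    have "signed_seq I w \<subseteq># U"
      by (rule mset_subset_eqI) (use rng in \<open>auto simp: cw c_def nat_le_iff\<close>)
    moreover have "seq_sum G (signed_seq I w) = \<one>" using seq_sum_signed_seq[OF I(1,3)] w by simp
    ultimately have "signed_seq I w = {#} \<or> signed_seq I w = U" by (rule D(4))
    then show "(\<forall>x\<in>I. w x = 0) \<or> (\<forall>x\<in>I. w x = c x)"
    proof
      assume e: "signed_seq I w = {#}"
      have "w x = 0" if "x \<in> I" for x using cw[of x] rng[OF that] that unfolding e by simp
      then show ?thesis by blast
    next
      assume e: "signed_seq I w = U"
      have "w x = c x" if "x \<in> I" for x using cw[of x] rng[OF that] that unfolding e c_def by simp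
      then show ?thesis by blast
    qed
  qed
  from f_uminus[OF this] have "m dvd 2 - (\<Sum>x\<in>I. \<bar>c x\<bar>)" .
  also have "(\<Sum>x\<in>I. \<bar>c x\<bar>) = int (size U)"
    by (simp add: c_def I_def size_multiset_overloaded_eq)
  finally show ?thesis by (simp add: dvd_diff_commute)
qed

text \<open>Orders are powers of \<open>p\<close> and the terms generate the group, so a term of
  largest order attains the exponent.\<close>

lemma p_group_False:
  assumes p: "Factorial_Ring.prime p" "order G = p ^ n"
    and g: "gcd (int (group_exponent G) - 2) (int (size U) - 2) = 1"
  shows False
proof -
  have fin_ord: "finite (ord ` set_mset U)" "ord ` set_mset U \<noteq> {}"
    using minimal_zero_sum_seqD(2)[OF U_minimal] by auto
  obtain x where x: "x \<in># U" "ord x = Max (ord ` set_mset U)" using Max_in[OF fin_ord] by auto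
  have pow: "\<exists>i. ord y = p ^ i" if "y \<in># U" for y
    using ord_dvd_group_order[of y] divides_primepow_nat[OF p(1)] p(2) that U_G by auto
  have "y [^] int (ord x) \<in> {\<one>}" if y: "y \<in># U" for y
  proof -
    obtain i j where ij: "ord y = p ^ i" "ord x = p ^ j" using pow x(1) y by metis
    have "ord y \<le> ord x" using x(2) Max_ge[OF fin_ord(1)] y by simp
    then have "i \<le> j" using ij prime_gt_1_nat[OF p(1)] by (simp add: power_increasing_iff)
    then have "int (ord y) dvd int (ord x)" using ij by (simp add: le_imp_power_dvd)
    then show ?thesis using int_pow_eq_id[of y] y U_G by auto
  qed
  then have "g [^] int (ord x) = \<one>" if "g \<in> carrier G" for g
    using power_in_subgroup[OF triv_subgroup _ that, of "int (ord x)"] by blast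
  then have "group_exponent G \<le> ord x"
    using group_exponent(3)[OF finite_G, of "ord x"] ord_gt_1[OF x(1)] by simp
  moreover have xc: "x \<in> carrier G" using x U_G by auto
  then have "int (ord x) dvd int (group_exponent G)"
    using group_exponent(2)[OF finite_G] int_pow_eq_id by blast
  then have "ord x \<le> group_exponent G" using group_exponent(1)[OF finite_G] by (simp add: dvd_imp_le)
  ultimately have "group_exponent G = ord x" by simp
  moreover have "m dvd int (ord x) - 2" using ord_mod[OF _ finite_G] x(1) U_A by blast
  ultimately have "m dvd int (group_exponent G) - 2" by simp
  from gcd_greatest[OF this size_U_mod] show False unfolding g using m_gt_1 by (simp add: zdvd1_eq)
qed

text \<open>\<open>m\<close> divides \<open>2 * p - 2\<close>, which is a power of 2, so
  \<open>m = 2\<close>.\<close>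

lemma two_prime_power_False:
  assumes p: "Factorial_Ring.prime (p::nat)" "odd p" "p - 1 = 2 ^ k" and exp: "group_exponent G = p * 2"
    and m: "Factorial_Ring.prime m" and x: "x \<in># U" "ord x = p * 2"
  shows False
proof -
  have p1: "1 < p" using prime_gt_1_nat[OF p(1)] .
  have "m dvd int (p * 2) - 2" using ord_mod[of x] x U_A finite_G by auto
  also have "int (p * 2) - 2 = int (2 * (p - 1))" using p1 by (simp add: of_nat_diff)
  also have "\<dots> = 2 ^ Suc k" using p(3) by simp
  finally have "m dvd 2" using prime_dvd_power[OF m] by blast
  then have "m = 2" using m by (simp add: primes_dvd_imp_eq)
  moreover have "\<exists>y\<in>#U. 2 < ord y" using x p1 by (intro bexI[of _ x]) auto
  moreover have "g [^] (2 * int p) = \<one>" if "g \<in> carrier G" for g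
    using group_exponent(2)[OF finite_G that] exp by (simp add: mult.commute)
  ultimately show False using two_prime_False p(1,2) by blast
qed

text \<open>The exponents 6 and 10 are \<open>2 * p\<close> with \<open>p - 1\<close> a power of 2.
  Otherwise \<open>E\<close> is a prime power and \<open>m\<close> divides \<open>E - 2\<close>, so
  an identity \<open>E - 2 - a * (N - 1) = 1\<close> forbids \<open>m dvd N - 1\<close> for a proper
  divisor \<open>N > 1\<close>. For \<open>E = 8\<close> and \<open>N = 4\<close> there is no such
  identity, as 3 divides both \<open>E - 2\<close> and \<open>N - 1\<close>.\<close>

lemma small_exponent_False:
  assumes m: "Factorial_Ring.prime m" and exp: "group_exponent G \<in> {3, 4, 5, 6, 7, 9, 10, 11}"
  shows False
proof -
  define E where "E = group_exponent G"
  note ge = group_exponent[OF finite_G, folded E_def]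
  have full: "\<exists>g\<in>carrier G. g [^] int n \<noteq> \<one>" if "0 < n" "n < E" for n
    using ex_pow_neq_one[OF finite_G] that by (simp add: E_def)
  have ord_dvd: "int (ord y) dvd int E" if "y \<in># U" for y
    using ge(2) int_pow_eq_id U_G that by blast
  have pq: ?thesis if p: "Factorial_Ring.prime (p::nat)" "odd p" "p - 1 = 2 ^ k" "E = p * 2" for p k
  proof -
    have "1 < p" using prime_gt_1_nat[OF p(1)] .
    have "\<exists>x\<in>#U. ord x = p * 2"
    proof (rule ex_ord_mult[OF p(1) two_is_prime_nat])
      show "p \<noteq> 2" using p(2) by auto
      show "g [^] (int p * int 2) = \<one>" if "g \<in> carrier G" for g using ge(2)[OF that] p(4) by simp
      show "\<exists>g\<in>carrier G. g [^] int p \<noteq> \<one>" "\<exists>g\<in>carrier G. g [^] int 2 \<noteq> \<one>"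
        using full[of p] full[of 2] p(4) \<open>1 < p\<close> by simp_all
    qed
    then show ?thesis using two_prime_power_False[OF p(1-3) _ m] p(4) by (auto simp: E_def)
  qed
  have prime_power: ?thesis
    if p: "Factorial_Ring.prime (p::nat)" "E = p ^ s" "0 < s" "2 < E"
      and cop: "\<And>N. 1 < N \<Longrightarrow> N dvd int E \<Longrightarrow> N \<noteq> int E \<Longrightarrow> \<exists>a. int E - 2 - a * (N - 1) = 1" for p s
  proof -
    have "p ^ (s - 1) < E" using p prime_gt_1_nat[OF p(1)] by (auto intro!: power_strict_increasing)
    then have "\<exists>x\<in>#U. ord x = p ^ s"
      using ex_ord_prime_power[OF p(1), of s] ge(2) full[of "p ^ (s - 1)"] p prime_gt_0_nat[OF p(1)] by simp
    then obtain x where x: "x \<in># U" "ord x = E" using p(2) by auto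
    have mE: "m dvd int E - 2" using ord_mod[of x] x U_A finite_G by auto
    show ?thesis
    proof (rule no_order_one_mod_False)
      show "\<exists>y\<in>#U. 2 < ord y" using x p(4) by auto
      fix y N assume y: "y \<in># U" "1 < N" "N dvd int (ord y)"
      have "N dvd int E" using dvd_trans[OF y(3) ord_dvd[OF y(1)]] .
      \<comment> \<open>For \<open>N = E\<close> the choice \<open>a = 1\<close> gives
        \<open>-1\<close>, which is just as good.\<close>
      then consider "int E - 2 - 1 * (N - 1) = - 1" | a where "int E - 2 - a * (N - 1) = 1" using cop[OF y(2)] by force
      then show "\<not> m dvd N - 1"
      proof (cases, goal_cases)
        case 1
        show ?case using dvd_diff[OF mE dvd_mult[of m "N - 1" 1]] 1 m_gt_1 by (auto simp: zdvd1_eq)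
      next
        case (2 a)
        show ?case using dvd_diff[OF mE dvd_mult[of m "N - 1" a]] 2 m_gt_1 by (auto simp: zdvd1_eq)
      qed
    qed
  qed
  have primes: "Factorial_Ring.prime (3::nat)" "Factorial_Ring.prime (5::nat)"
    "Factorial_Ring.prime (7::nat)" "Factorial_Ring.prime (11::nat)"
    by (simp_all add: prime_nat_numeral_eq)
  have prime: False if p: "Factorial_Ring.prime (p::nat)" "E = p" "2 < p" for p
  proof (rule prime_power[OF p(1), of 1])
    fix N assume N: "1 < N" "N dvd int E" "N \<noteq> int E"
    then have "int (nat N) dvd int p" using p(2) by simp
    then have "nat N dvd p" by (simp only: int_dvd_int_iff)
    then have "nat N = 1 \<or> nat N = p" using p(1) prime_nat_iff by blast
    then show "\<exists>a. int E - 2 - a * (N - 1) = 1" using N p(2) by auto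
  qed (use p in simp_all)
  have divs: "N \<in> {2..int E}" if "1 < N" "N dvd int E" for N
    using that zdvd_imp_le[of N "int E"] ge(1) by auto
  consider "E = 6" | "E = 10" | "E = 2 ^ 2" | "E = 3 ^ 2" | "E = 3" | "E = 5" | "E = 7" | "E = 11"
    using exp by (auto simp: E_def)
  then show False
  proof cases
    case 1
    then show False using pq[OF primes(1), of 1] by simp
  next
    case 2
    then show False using pq[OF primes(2), of 2] by simp
  next
    case 3
    have "\<exists>a. int E - 2 - a * (N - 1) = 1" if N: "1 < N" "N dvd int E" "N \<noteq> int E" for N
    proof -
      have "N = 2 \<or> N = 3" using divs[OF N(1,2)] N(3) 3 by auto
      then show ?thesis using N(2) 3 by auto
    qed
    then show False by (intro prime_power[OF two_is_prime_nat 3]) (use 3 in simp_all)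
  next
    case 4
    have "\<exists>a. int E - 2 - a * (N - 1) = 1" if N: "1 < N" "N dvd int E" "N \<noteq> int E" for N
    proof -
      have "N = 2 \<or> N = 3 \<or> N = 4 \<or> N = 5 \<or> N = 6 \<or> N = 7 \<or> N = 8" using divs[OF N(1,2)] N(3) 4 by auto
      then have "N = 3" using N(2) 4 by auto
      then show ?thesis using 4 by (intro exI[of _ 3]) simp
    qed
    then show False by (intro prime_power[OF primes(1) 4]) (use 4 in simp_all)
  qed (use prime primes in simp_all)
qed

lemma two_primes_False:
  assumes m: "Factorial_Ring.prime m" and pq: "Factorial_Ring.prime (p::nat)" "Factorial_Ring.prime (q::nat)" "p \<noteq> q"
    and exp: "group_exponent G = p * q"
    and cond: "gcd (int (p * q) - 2) (int (size U) - 2) = 1 \<or>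
      gcd (int (p * q) - 2) (int (p + q) - 3) = 1 \<or>
      (q = 2 \<and> (\<exists>k. p - 1 = 2 ^ k)) \<or> (q = 2 \<and> p_rank p G = 1)"
  shows False
proof -
  have gt: "1 < p" "1 < q" using prime_gt_1_nat pq by auto
  note ge = group_exponent[OF finite_G, unfolded exp]
  have full: "\<exists>g\<in>carrier G. g [^] int n \<noteq> \<one>" if "0 < n" "n < p * q" for n
    using ex_pow_neq_one[OF finite_G] that exp by simp
  have tors: "g [^] (int p * int q) = \<one>" if "g \<in> carrier G" for g using ge(2)[OF that] by simp
  obtain x where x: "x \<in># U" "ord x = p * q"
    using ex_ord_mult[OF pq tors] full[of p] full[of q] gt by auto
  have xc: "x \<in> carrier G" using x U_G by auto
  have m_pq: "m dvd int (p * q) - 2" using ord_mod[of x] x U_A finite_G by auto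
  have gcd_False: False if "gcd (int (p * q) - 2) a = 1" "m dvd a" for a
  proof -
    have "m dvd gcd (int (p * q) - 2) a" by (rule gcd_greatest[OF m_pq that(2)])
    then show False unfolding that(1) using m_gt_1 by (simp add: zdvd1_eq)
  qed
  have "2 * 2 \<le> p * q" using gt by (intro mult_le_mono) auto
  then have big: "2 < ord x" using x by simp
  have odd_p: "odd p" if "q = 2" using primes_dvd_imp_eq[OF two_is_prime_nat pq(1)] pq(3) that by auto
  from cond show False
  proof (elim disjE conjE exE)
    assume "gcd (int (p * q) - 2) (int (size U) - 2) = 1"
    from gcd_False[OF this size_U_mod] show False .
  next
    assume g: "gcd (int (p * q) - 2) (int (p + q) - 3) = 1"
    \<comment> \<open>Modulo \<open>m\<close>, from \<open>a * b = 2\<close> and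
      \<open>a = 1\<close> follow \<open>b = 2\<close> and \<open>a + b = 3\<close>.\<close>
    have ne: "\<not> m dvd int a - 1" if "int a * int b = int (p * q)" "int a + int b = int (p + q)" for a b
    proof
      assume *: "m dvd int a - 1"
      have "int (p + q) - 3 = (int a - 1) - ((int b * (int a - 1)) - (int (p * q) - 2))"
        using that by (simp add: algebra_simps)
      also have "m dvd \<dots>" by (rule dvd_diff[OF * dvd_diff[OF dvd_mult[OF *] m_pq]])
      finally have "m dvd int (p + q) - 3" .
      from gcd_False[OF g this] show False .
    qed
    show False
    proof (rule no_order_one_mod_False)
      show "\<exists>y\<in>#U. 2 < ord y" using x(1) big by blast
      fix y N assume y: "y \<in># U" "1 < N" "N dvd int (ord y)"
      have "int (ord y) dvd int (p * q)" using tors int_pow_eq_id[of y] y(1) U_G by auto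
      then have "int (nat N) dvd int (p * q)" using y dvd_trans by auto
      then have "nat N dvd p * q" by (simp only: int_dvd_int_iff)
      then obtain a b where ab: "nat N = a * b" "a dvd p" "b dvd q" using division_decomp by blast
      then have "a = 1 \<or> a = p" "b = 1 \<or> b = q" using pq prime_nat_iff by blast+
      moreover have "nat N \<noteq> 1" "int (nat N) = N" using y(2) by auto
      ultimately have "N = int p \<or> N = int q \<or> N = int (p * q)" using ab(1) by auto
      moreover have "\<not> m dvd int (p * q) - 1"
      proof
        assume "m dvd int (p * q) - 1"
        from dvd_diff[OF this m_pq] show False using m_gt_1 by (simp add: zdvd1_eq)
      qed
      ultimately show "\<not> m dvd N - 1" using ne[of p q] ne[of q p] by (auto simp: mult.commute add.commute)
    qed
  next
    fix k assume "q = 2" "p - 1 = 2 ^ k"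
    then show False using two_prime_power_False[OF pq(1) odd_p _ _ m x(1), of k] exp x(2) by simp
  next
    assume q: "q = 2" and rank: "p_rank p G = 1"
    \<comment> \<open>Otherwise \<open>t \<otimes> t\<close> and \<open>x \<otimes> x\<close>, both
      of order \<open>p\<close>, would generate a subgroup of rank two.\<close>
    show False
    proof (rule squares_in_line_False[OF x(1) big], rule ccontr)
      fix t assume t: "t \<in># U" and notin: "t \<otimes> t \<notin> generate G {x}"
      have tc: "t \<in> carrier G" using t U_G by auto
      have sgx: "subgroup (generate G {x}) G" using generate_is_subgroup xc by auto
      have xx: "x \<otimes> x \<in> generate G {x}" using subgroup.m_closed[OF sgx] generate.incl[of x "{x}" G] by blast
      have gen: "generate G {x \<otimes> x} \<subseteq> generate G {x}"
        using generate_subgroup_incl[OF _ sgx] xx by simp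
      have sq: "g \<otimes> g = g [^] (2::int)" if "g \<in> carrier G" for g using int_pow_mult[OF that, of 1 1] that by simp
      have ord_sq: "ord (g \<otimes> g) = p" if g: "g \<in> carrier G" "g \<otimes> g \<noteq> \<one>" for g
      proof -
        have "(g \<otimes> g) [^] int p = \<one>" using tors[OF g(1)] q g(1) unfolding sq[OF g(1)] by (simp add: int_pow_pow mult.commute)
        then have "int (ord (g \<otimes> g)) dvd int p" using int_pow_eq_id[of "g \<otimes> g"] g(1) by blast
        then have "ord (g \<otimes> g) dvd p" by (simp only: int_dvd_int_iff)
        moreover have "ord (g \<otimes> g) \<noteq> 1" using ord_eq_1[of "g \<otimes> g"] g by simp
        ultimately show ?thesis using pq(1) prime_nat_iff by blast
      qed
      have "x \<otimes> x \<noteq> \<one>" using sq[OF xc] int_pow_eq_id[OF xc, of 2] zdvd_imp_le[of "int (ord x)" 2] big by auto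
      moreover have "t \<otimes> t \<noteq> \<one>" using notin subgroup.one_closed[OF sgx] by auto
      ultimately have "2 \<le> p_rank p G"
        using p_rank_ge_2[OF finite_G pq(1), of "t \<otimes> t" "x \<otimes> x"] ord_sq xc tc notin gen by blast
      then show False using rank by simp
    qed
  qed
qed

text \<open>Excluding elementary 2-groups gives \<open>2 < p ^ s\<^sub>2\<close>: the value 2 would
  force \<open>p = 2\<close> and \<open>s\<^sub>1 = s\<^sub>2 = 1\<close>.\<close>

lemma cyclic_powers_False:
  assumes p: "Factorial_Ring.prime (p::nat)" and pos: "0 < r\<^sub>2" "0 < s\<^sub>1" "0 < s\<^sub>2" "s\<^sub>1 dvd s\<^sub>2"
    and iso: "G \<cong> cyclic_power (p ^ s\<^sub>1) r\<^sub>1 \<times>\<times> cyclic_power (p ^ s\<^sub>2) r\<^sub>2"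
    and ne: "\<not> elementary_2_group G"
  shows False
proof -
  let ?K = "cyclic_power (p ^ s\<^sub>1) r\<^sub>1 \<times>\<times> cyclic_power (p ^ s\<^sub>2) r\<^sub>2"
  have p1: "1 < p" using prime_gt_1_nat[OF p] .
  have K: "group ?K" by (simp add: DirProd_group)
  have "s\<^sub>1 \<le> s\<^sub>2" using pos dvd_imp_le by blast
  then have two: "two_layered G (int p) s\<^sub>1 s\<^sub>2"
    using two_layered_iso[OF is_group K iso two_layered_cyclic_powers[OF p1 pos(1,2)]] by blast
  have "2 < p ^ s\<^sub>2"
  proof (rule ccontr)
    assume "\<not> 2 < p ^ s\<^sub>2"
    moreover have "p ^ 1 \<le> p ^ s\<^sub>2" using p1 pos(3) by (intro power_increasing) auto
    ultimately have p2: "p = 2" "p ^ s\<^sub>2 = 2" using p1 by auto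
    then have "2 ^ s\<^sub>2 = (2 ^ 1 :: nat)" by simp
    then have "s\<^sub>2 = 1" using power_inject_exp[of "2::nat" s\<^sub>2 1] by simp
    then have "s\<^sub>1 = 1" using pos(4) by simp
    then have "G \<cong> cyclic_power 2 r\<^sub>1 \<times>\<times> cyclic_power 2 r\<^sub>2" using iso p2 \<open>s\<^sub>2 = 1\<close> by simp
    then have "G \<cong> cyclic_power 2 (r\<^sub>1 + r\<^sub>2)" using cyclic_power_DirProd[of 2 r\<^sub>1 r\<^sub>2] iso_trans by auto
    then show False using ne by (auto simp: elementary_2_group_def)
  qed
  then show False
    using two_layers_False[OF p pos(2-4)] two unfolding two_layered_def by blast
qed

end

theorem theorem1p2:
  fixes G :: "('a, 'b) monoid_scheme"
  assumes "comm_group G" and "finite (carrier G)"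
    and "\<not> cyclic_group G" and "\<not> elementary_2_group G"
    and "(\<exists>p. Factorial_Ring.prime p \<and> is_p_group p G \<and>
            gcd (int (group_exponent G) - 2) (int (davenport_constant G) - 2) = 1)
       \<or> (\<exists>p r\<^sub>1 r\<^sub>2 s\<^sub>1 s\<^sub>2 :: nat. Factorial_Ring.prime p \<and> 0 < r\<^sub>1 \<and> 0 < r\<^sub>2 \<and> 0 < s\<^sub>1 \<and> 0 < s\<^sub>2 \<and> s\<^sub>1 dvd s\<^sub>2 \<and>
            G \<cong> cyclic_power (p ^ s\<^sub>1) r\<^sub>1 \<times>\<times> cyclic_power (p ^ s\<^sub>2) r\<^sub>2)
       \<or> (\<exists>p q :: nat. Factorial_Ring.prime p \<and> Factorial_Ring.prime q \<and> p \<noteq> q \<and> group_exponent G = p * q \<and>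
            (gcd (int (p * q) - 2) (int (davenport_constant G) - 2) = 1
             \<or> gcd (int (p * q) - 2) (int (p + q) - 3) = 1
             \<or> (q = 2 \<and> (\<exists>m. p - 1 = 2 ^ m))
             \<or> (q = 2 \<and> p_rank p G = 1)))
       \<or> group_exponent G \<in> {3, 4, 5, 6, 7, 9, 10, 11}"
  shows "\<forall>U. minimal_zero_sum_seq G U \<and> size U = davenport_constant G \<longrightarrow>
    (\<exists>k Us Vs. 0 < k \<and> length Us = k \<and> length Vs = k + 1 \<and>
       (\<forall>W \<in> set Us \<union> set Vs. minimal_zero_sum_seq G W \<and>
          set_mset W \<subseteq> set_mset U \<union> (\<lambda>g. inv\<^bsub>G\<^esub> g) ` set_mset U) \<and>
       sum_list Us = sum_list Vs)"
proof (intro allI impI, rule ccontr)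
  fix U
  assume U: "minimal_zero_sum_seq G U \<and> size U = davenport_constant G"
  interpret comm_group G by fact
  define A where "A = set_mset U \<union> (\<lambda>g. inv\<^bsub>G\<^esub> g) ` set_mset U"
  assume "\<not> (\<exists>k Us Vs. 0 < k \<and> length Us = k \<and> length Vs = k + 1 \<and>
       (\<forall>W \<in> set Us \<union> set Vs. minimal_zero_sum_seq G W \<and>
          set_mset W \<subseteq> set_mset U \<union> (\<lambda>g. inv\<^bsub>G\<^esub> g) ` set_mset U) \<and>
       sum_list Us = sum_list Vs)"
  then have no: "\<not> (0 < length Us \<and> length Vs = length Us + 1 \<and>
       (\<forall>W \<in> set Us \<union> set Vs. minimal_zero_sum_seq G W \<and> set_mset W \<subseteq> A) \<and> sum_list Us = sum_list Vs)" for Us Vs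
    unfolding A_def by blast
  note D = minimal_zero_sum_seqD[OF conjunct1[OF U]]
  have A: "A \<subseteq> carrier G" using D(1) by (auto simp: A_def)
  have longest: "size S \<le> size U" if "minimal_zero_sum_seq G S" for S
    using size_le_davenport_constant[OF assms(2) that] U by simp
  have "\<exists>(m::int) \<phi>. Factorial_Ring.prime m \<and>
    (\<forall>S T. set_mset S \<subseteq> A \<and> set_mset T \<subseteq> A \<and> seq_sum G S = \<one>\<^bsub>G\<^esub> \<and> seq_sum G T = \<one>\<^bsub>G\<^esub> \<longrightarrow>
      m dvd \<phi> (S + T) - \<phi> S - \<phi> T) \<and>
    (\<forall>W. minimal_zero_sum_seq G W \<and> set_mset W \<subseteq> A \<longrightarrow> m dvd \<phi> W - 1)"
  proof (rule ex_length_mod[OF A])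
    fix Us Vs
    assume *: "\<forall>W\<in>set Us \<union> set Vs. minimal_zero_sum_seq G W \<and> set_mset W \<subseteq> A" "sum_list Us = sum_list Vs"
    show "length Vs \<noteq> length Us + 1"
    proof
      assume l: "length Vs = length Us + 1"
      \<comment> \<open>The theorem demands \<open>k > 0\<close>; for \<open>k = 0\<close> the only
        factor on the right would be empty.\<close>
      then have "Us = []" using no[of Us Vs] * by auto
      moreover from this obtain W where "Vs = [W]" using l by (auto simp: length_Suc_conv)
      ultimately show False using * minimal_zero_sum_seqD(2)[of W] by auto
    qed
  qed
  then obtain m :: int and \<phi> where m: "Factorial_Ring.prime m"
    and \<phi>: "\<And>S T. set_mset S \<subseteq> A \<Longrightarrow> set_mset T \<subseteq> A \<Longrightarrow> seq_sum G S = \<one>\<^bsub>G\<^esub> \<Longrightarrow> seq_sum G T = \<one>\<^bsub>G\<^esub> \<Longrightarrow>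
        m dvd \<phi> (S + T) - \<phi> S - \<phi> T"
      "\<And>W. minimal_zero_sum_seq G W \<Longrightarrow> set_mset W \<subseteq> A \<Longrightarrow> m dvd \<phi> W - 1" by blast
  \<comment> \<open>A zero term would be all of \<open>U\<close>; since \<open>U\<close> generates
    the group, the group would be trivial and so cyclic.\<close>
  have one: "\<one>\<^bsub>G\<^esub> \<notin> A"
  proof
    assume "\<one>\<^bsub>G\<^esub> \<in> A"
    then have "\<one>\<^bsub>G\<^esub> \<in># U" using D(1) by (auto simp: A_def) (metis inv_eq_1_iff subsetD)
    then have "{#\<one>\<^bsub>G\<^esub>#} = U" using D(4)[of "{#\<one>\<^bsub>G\<^esub>#}"] by simp
    then have "set_mset U \<subseteq> {\<one>\<^bsub>G\<^esub>}" by auto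
    then have "{\<one>\<^bsub>G\<^esub>} = carrier G" using support_of_longest[OF conjunct1[OF U] longest triv_subgroup] by blast
    then have "carrier G = range (\<lambda>n::int. \<one>\<^bsub>G\<^esub> [^]\<^bsub>G\<^esub> n)" by (auto simp: int_pow_one)
    then show False using assms(3) cyclic_group by blast
  qed
  interpret longest_length_mod G A \<phi> m U
  proof unfold_locales
    show "inv\<^bsub>G\<^esub> x \<in> A" if "x \<in> A" for x using that D(1) by (auto simp: A_def)
    show "1 < m" using prime_gt_1_int[OF m] .
    show "set_mset U \<subseteq> A" by (auto simp: A_def)
  qed (use A one \<phi> U longest assms(2,3) in auto)
  note size_U = conjunct2[OF U]
  from assms(5) show False
  proof (elim disjE, goal_cases)
    case 1
    then show ?case
      unfolding is_p_group_def by (elim exE conjE) (rule p_group_False[unfolded size_U]; assumption)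
  next
    case 2
    then show ?case by (elim exE conjE) (rule cyclic_powers_False[OF _ _ _ _ _ _ assms(4)]; assumption)
  next
    case 3
    then show ?case by (elim exE conjE) (rule two_primes_False[OF m, unfolded size_U]; assumption)
  next
    case 4
    then show ?case by (rule small_exponent_False[OF m])
  qed
qed

end
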